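(* Let $n\ge1$. The inclusion map $C(S^1)^{(n)}\to C^*_{\mathrm{env}}(C(S^1)^{(n)})\cong M_n(\mathbb C)$ induces isomorphisms (bijections) $\mathcal V_0(C(S^1)^{(n)},m)\cong\mathcal V_0(M_n(\mathbb C),m)$ for every $m\ge1$, intertwining the connecting maps $\imath_{mm'}$ ($m'\ge m$) for $C(S^1)^{(n)}$ with those for $M_n(\mathbb C)$. It follows that $K_0(C(S^1)^{(n)})\cong K_0(M_n(\mathbb C))\cong\mathbb Z$.
   Context: $C(S^1)^{(n)}\subseteq M_n(\mathbb C)$ is the operator system of $n\times n$ Toeplitz matrices $(t_{i-j})_{i,j=1}^n$, $t_k\in\mathbb C$; its $C^*$-envelope is $M_n(\mathbb C)$. For a unital operator system $E$ with unit $e$, realized inside its $C^*$-envelope $A=C^*_{\mathrm{env}}(E)$ (with $A=E$ if $E$ is a $C^*$-algebra), let $H(E,m)$ be the space of self-adjoint elements of $M_m(E)$ that are invertible in $M_m(A)$, and $\mathcal V_0(E,m)=\pi_0(H(E,m))$ the set of its path components. The inclusion $E\subseteq A$ gives $H(E,m)\subseteq H(A,m)$ and hence a map $\mathcal V_0(E,m)\to\mathcal V_0(A,m)$. For $m'\ge m$ the connecting map $\imath_{mm'}:\mathcal V_0(E,m)\to\mathcal V_0(E,m')$ is $[x]\mapsto[x\oplus e_{m'-m}]$, where $e_k$ is the unit of $M_k(E)$. $\mathcal V_0(E)=\varinjlim_m\mathcal V_0(E,m)$ is a commutative semigroup under $[x]+[x']=[x\oplus x']$ with identity element $[e]$, and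 $K_0(E)$ is its Grothendieck group. For a unital $C^*$-algebra this is isomorphic to the usual $K_0$-group. *)

theory Defs
  imports
    "HOL-Analysis.Analysis"
    "HOL-Algebra.Elementary_Groups"
    "Jordan_Normal_Form.Schur_Decomposition"
begin

section \<open>Operator systems inside a matrix algebra\<close>

text \<open>
  All operator systems considered here are concrete, i.e. subspaces of the C*-algebra
  of complex \<open>n \<times> n\<close> matrices, which is \<open>carrier_mat n n\<close>.
\<close>

definition toeplitz :: "nat \<Rightarrow> complex mat set" where
  "toeplitz n =
     {T \<in> carrier_mat n n. \<exists>t :: int \<Rightarrow> complex. \<forall>i<n. \<forall>j<n. T $$ (i, j) = t (int i - int j)}"

definition operator_system :: "nat \<Rightarrow> complex mat set \<Rightarrow> bool" where
  "operator_system n E \<longleftrightarrow>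
     E \<subseteq> carrier_mat n n \<and> 1\<^sub>m n \<in> E \<and>
     (\<forall>x\<in>E. \<forall>y\<in>E. x + y \<in> E) \<and> (\<forall>c. \<forall>x\<in>E. c \<cdot>\<^sub>m x \<in> E) \<and> (\<forall>x\<in>E. mat_adjoint x \<in> E)"

text \<open>
  Unital C*-subalgebras; norm-closedness is automatic in finite dimension.
\<close>

definition cstar_subalgebra :: "nat \<Rightarrow> complex mat set \<Rightarrow> bool" where
  "cstar_subalgebra n A \<longleftrightarrow> operator_system n A \<and> (\<forall>x\<in>A. \<forall>y\<in>A. x * y \<in> A)"

definition cstar_generated :: "nat \<Rightarrow> complex mat set \<Rightarrow> complex mat set" where
  "cstar_generated n E = \<Inter>{A. cstar_subalgebra n A \<and> E \<subseteq> A}"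

text \<open>
  \<open>mat_over n m S\<close> is the space \<open>M\<^sub>m(S)\<close>, an element being an \<open>m \<times> m\<close> array of
  \<open>n \<times> n\<close> blocks from \<open>S\<close>, written as one matrix of size \<open>m n\<close>.
\<close>

definition mat_block :: "nat \<Rightarrow> complex mat \<Rightarrow> nat \<Rightarrow> nat \<Rightarrow> complex mat" where
  "mat_block n X a b = mat n n (\<lambda>(i, j). X $$ (a * n + i, b * n + j))"

definition mat_over :: "nat \<Rightarrow> nat \<Rightarrow> complex mat set \<Rightarrow> complex mat set" where
  "mat_over n m S =
     {X \<in> carrier_mat (m * n) (m * n). \<forall>a<m. \<forall>b<m. mat_block n X a b \<in> S}"

subsection \<open>The C*-envelope\<close>

text \<open>
  Arveson's description of the C*-envelope: it is the quotient of the C*-algebra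
  generated by \<open>E\<close> by the Shilov ideal, the largest boundary ideal.  An ideal \<open>J\<close> of
  \<open>A\<close> is a boundary ideal for \<open>E\<close> if the quotient map from \<open>A\<close> to \<open>A / J\<close> restricts to
  a complete order embedding of \<open>E\<close>.  So \<open>A\<close> together with the inclusion of \<open>E\<close> is the
  C*-envelope iff \<open>E\<close> generates \<open>A\<close> and zero is the only boundary ideal.
  The class of \<open>X\<close> is positive in \<open>M\<^sub>m(A) / M\<^sub>m(J)\<close> iff \<open>Z\<^sup>* Z - X\<close> lies in \<open>M\<^sub>m(J)\<close>
  for some \<open>Z\<close> in \<open>M\<^sub>m(A)\<close>.
\<close>

definition cstar_ideal :: "nat \<Rightarrow> complex mat set \<Rightarrow> complex mat set \<Rightarrow> bool" where
  "cstar_ideal n A J \<longleftrightarrow>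
     J \<subseteq> A \<and> 0\<^sub>m n n \<in> J \<and> (\<forall>x\<in>J. \<forall>y\<in>J. x + y \<in> J) \<and>
     (\<forall>a\<in>A. \<forall>x\<in>J. a * x \<in> J \<and> x * a \<in> J)"

definition boundary_ideal ::
    "nat \<Rightarrow> complex mat set \<Rightarrow> complex mat set \<Rightarrow> complex mat set \<Rightarrow> bool" where
  "boundary_ideal n A E J \<longleftrightarrow>
     cstar_ideal n A J \<and>
     (\<forall>m\<ge>1. \<forall>X \<in> mat_over n m E.
        (\<exists>Z \<in> mat_over n m A. mat_adjoint Z * Z - X \<in> mat_over n m J) \<longrightarrow>
        (\<exists>Z \<in> mat_over n m A. X = mat_adjoint Z * Z))"

definition is_cstar_envelope :: "nat \<Rightarrow> complex mat set \<Rightarrow> complex mat set \<Rightarrow> bool" where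
  "is_cstar_envelope n A E \<longleftrightarrow>
     operator_system n E \<and> cstar_generated n E = A \<and>
     (\<forall>J. boundary_ideal n A E J \<longrightarrow> J = {0\<^sub>m n n})"

section \<open>Path components\<close>

definition mat_topology :: "nat \<Rightarrow> complex mat topology" where
  "mat_topology k =
     pullback_topology (carrier_mat k k) (\<lambda>X. restrict (\<lambda>p. X $$ p) ({..<k} \<times> {..<k}))
       (product_topology (\<lambda>_. euclidean) ({..<k} \<times> {..<k}))"

text \<open>
  The map induced on path components by \<open>f\<close>, a continuous map into \<open>Y\<close>.
\<close>

definition pi0_map :: "'b topology \<Rightarrow> ('a \<Rightarrow> 'b) \<Rightarrow> 'a set \<Rightarrow> 'b set" where
  "pi0_map Y f C = (\<Union>x\<in>C. path_component_of_set Y (f x))"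

lemma pi0_map_path_component:
  assumes "continuous_map X Y f" and "x \<in> topspace X"
  shows "pi0_map Y f (path_component_of_set X x) = path_component_of_set Y (f x)"
proof -
  have *: "path_component_of Y (f x) (f y)" if xy: "path_component_of X x y" for y
  proof -
    obtain g where "pathin X g" "g 0 = x" "g 1 = y"
      using xy by (auto simp: path_component_of_def)
    then have "pathin Y (f \<circ> g)" "(f \<circ> g) 0 = f x" "(f \<circ> g) 1 = f y"
      using assms(1) by (auto simp: pathin_def intro: continuous_map_compose)
    then show ?thesis
      unfolding path_component_of_def by blast
  qed
  have "path_component_of X x x"
    using assms(2) by (simp add: path_component_of_refl)
  with * show ?thesis
    unfolding pi0_map_def
    by (auto intro: path_component_of_trans)
qed

section \<open>The groups \<open>K\<^sub>0\<close>\<close>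

text \<open>
  In what follows, \<open>E\<close> is an operator system of \<open>n \<times> n\<close> matrices and \<open>A\<close> is its
  C*-envelope, in which invertibility is understood.
\<close>

definition H_set :: "nat \<Rightarrow> complex mat set \<Rightarrow> complex mat set \<Rightarrow> nat \<Rightarrow> complex mat set" where
  "H_set n A E m =
     {X \<in> mat_over n m E. mat_adjoint X = X \<and>
        (\<exists>Y \<in> mat_over n m A. X * Y = 1\<^sub>m (m * n) \<and> Y * X = 1\<^sub>m (m * n))}"

definition H_space ::
    "nat \<Rightarrow> complex mat set \<Rightarrow> complex mat set \<Rightarrow> nat \<Rightarrow> complex mat topology" where
  "H_space n A E m = subtopology (mat_topology (m * n)) (H_set n A E m)"

definition V0 ::
    "nat \<Rightarrow> complex mat set \<Rightarrow> complex mat set \<Rightarrow> nat \<Rightarrow> complex mat set set" where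
  "V0 n A E m = path_components_of (H_space n A E m)"

text \<open>The map \<open>V0 n A E m \<rightarrow> V0 n A A m\<close> induced by the inclusion of \<open>E\<close> in \<open>A\<close>.\<close>

definition V0_incl :: "nat \<Rightarrow> complex mat set \<Rightarrow> nat \<Rightarrow> complex mat set \<Rightarrow> complex mat set" where
  "V0_incl n A m = pi0_map (H_space n A A m) (\<lambda>x. x)"

definition direct_sum_mat :: "complex mat \<Rightarrow> complex mat \<Rightarrow> complex mat" where
  "direct_sum_mat x y =
     four_block_mat x (0\<^sub>m (dim_row x) (dim_col y)) (0\<^sub>m (dim_row y) (dim_col x)) y"

definition V0_connect ::
    "nat \<Rightarrow> complex mat set \<Rightarrow> complex mat set \<Rightarrow> nat \<Rightarrow> nat \<Rightarrow> complex mat set \<Rightarrow> complex mat set"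
  where
  "V0_connect n A E m m' =
     pi0_map (H_space n A E m') (\<lambda>x. direct_sum_mat x (1\<^sub>m ((m' - m) * n)))"

text \<open>
  The direct limit over \<open>m \<ge> 1\<close>, as a quotient of the disjoint union of the sets
  \<open>V0 n A E m\<close>.
\<close>

definition V0_union ::
    "nat \<Rightarrow> complex mat set \<Rightarrow> complex mat set \<Rightarrow> (nat \<times> complex mat set) set" where
  "V0_union n A E = (SIGMA m:{1..}. V0 n A E m)"

definition V0_rel ::
    "nat \<Rightarrow> complex mat set \<Rightarrow> complex mat set \<Rightarrow>
     ((nat \<times> complex mat set) \<times> (nat \<times> complex mat set)) set" where
  "V0_rel n A E =
     {((m, c), (m', c')). (m, c) \<in> V0_union n A E \<and> (m', c') \<in> V0_union n A E \<and>
        (\<exists>k. m \<le> k \<and> m' \<le> k \<and> V0_connect n A E m k c = V0_connect n A E m' k c')}"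

definition V0_class ::
    "nat \<Rightarrow> complex mat set \<Rightarrow> complex mat set \<Rightarrow> nat \<Rightarrow> complex mat \<Rightarrow>
     (nat \<times> complex mat set) set" where
  "V0_class n A E m x = V0_rel n A E `` {(m, path_component_of_set (H_space n A E m) x)}"

definition V0_lim ::
    "nat \<Rightarrow> complex mat set \<Rightarrow> complex mat set \<Rightarrow> (nat \<times> complex mat set) set monoid" where
  "V0_lim n A E =
     \<lparr>carrier = V0_union n A E // V0_rel n A E,
      monoid.mult = (\<lambda>a b. \<Union>{V0_class n A E (m + m') (direct_sum_mat x x') | m x m' x'.
         1 \<le> m \<and> x \<in> H_set n A E m \<and> V0_class n A E m x = a \<and>
         1 \<le> m' \<and> x' \<in> H_set n A E m' \<and> V0_class n A E m' x' = b}),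
      one = V0_class n A E 1 (1\<^sub>m n)\<rparr>"

text \<open>
  The Grothendieck group of a commutative monoid; the pair \<open>(a, b)\<close> represents the
  formal difference of \<open>a\<close> and \<open>b\<close>.
\<close>

definition grothendieck_rel :: "('a, 'b) monoid_scheme \<Rightarrow> (('a \<times> 'a) \<times> ('a \<times> 'a)) set" where
  "grothendieck_rel M =
     {((a, b), (c, d)). a \<in> carrier M \<and> b \<in> carrier M \<and> c \<in> carrier M \<and> d \<in> carrier M \<and>
        (\<exists>k \<in> carrier M. a \<otimes>\<^bsub>M\<^esub> d \<otimes>\<^bsub>M\<^esub> k = c \<otimes>\<^bsub>M\<^esub> b \<otimes>\<^bsub>M\<^esub> k)}"

definition grothendieck_group :: "('a, 'b) monoid_scheme \<Rightarrow> ('a \<times> 'a) set monoid" where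
  "grothendieck_group M =
     \<lparr>carrier = (carrier M \<times> carrier M) // grothendieck_rel M,
      monoid.mult = (\<lambda>p q. \<Union>{grothendieck_rel M `` {(a \<otimes>\<^bsub>M\<^esub> c, b \<otimes>\<^bsub>M\<^esub> d)} | a b c d.
         (a, b) \<in> p \<and> (c, d) \<in> q}),
      one = grothendieck_rel M `` {(\<one>\<^bsub>M\<^esub>, \<one>\<^bsub>M\<^esub>)}\<rparr>"

definition K0 ::
    "nat \<Rightarrow> complex mat set \<Rightarrow> complex mat set \<Rightarrow>
     ((nat \<times> complex mat set) set \<times> (nat \<times> complex mat set) set) set monoid" where
  "K0 n A E = grothendieck_group (V0_lim n A E)"

end

theory Submission
  imports Defs
begin

text \<open>
  For every \<open>m\<close> the path components of the invertible self-adjoint elements are classified by the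
  number of negative eigenvalues, both for \<open>M\<^sub>m(M\<^sub>n(\<complex>))\<close>, which is standard, and for block
  Toeplitz matrices, which is the point of the theorem. Everything else follows from this
  classification, because the inclusion and the connecting maps preserve that number.
  
  Both cases are treated by one argument. Put \<open>N = m n\<close>. In both cases the self-adjoint elements are
  the real combinations \<open>T = \<Sum> c\<^sub>x x x\<^sup>*\<close> of rank-one matrices with \<open>x\<close> in a family \<open>X\<close> of vectors:
  all of \<open>\<complex>\<^sup>N\<close> by diagonalization of Hermitian forms, and the vectors with entries \<open>\<xi>\<^sub>a z\<^sup>i\<close>, \<open>\<bar>z\<bar> = 1\<close>,
  in the Toeplitz case, by Fourier inversion on a finite cyclic group and polarization
  (\<open>hermitian_toeplitz_span\<close>). The only property of \<open>X\<close> that the argument uses is that \<open>X\<close> is not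
  contained in a union of two hyperplanes (\<open>generic_family\<close>).
  
  The matrix \<open>T + \<tau> x x\<^sup>*\<close> stays invertible as long as \<open>1 + \<tau> x\<^sup>* T\<^sup>-\<^sup>1 x\<close> does not vanish
  (\<open>rank_one_step\<close>). The numbers \<open>c\<^sub>x x\<^sup>* T\<^sup>-\<^sup>1 x\<close> add up to the trace of \<open>T\<^sup>-\<^sup>1 T\<close>, which is \<open>N\<close>. So if
  more than \<open>N\<close> vectors occur in \<open>T\<close>, one of these numbers is less than 1, and the weight of that
  vector can be moved to 0 (\<open>linked_card_le\<close>). Hence every \<open>T\<close> can be joined to a combination of a
  basis with nonzero weights. Such combinations are related by two moves: a basis vector can be exchanged
  for another vector of \<open>X\<close> with a weight of the same sign (\<open>linked_exchange\<close>), and the signs at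
  two basis vectors can be swapped by passing through a third vector of \<open>X\<close> that has nonzero coordinates
  at both (\<open>linked_swap\<close>). Therefore two combinations with equally many negative weights can be joined
  (\<open>linked_bases\<close>).
  
  Conversely the number of negative weights is constant on paths. It is the number \<open>q\<close>
  such that the form of \<open>T\<close> is positive on a subspace of codimension \<open>q\<close> and negative on a subspace of
  dimension \<open>q\<close>; a dimension count makes \<open>q\<close> unique, and these conditions are open
  (\<open>inertia_near_basis\<close>).
  
  The negative index is additive on direct sums and vanishes on identity matrices, so in the limit over
  \<open>m\<close> the semigroup becomes the natural numbers, and both Grothendieck groups are the integers. That the
  full matrix algebra is the C*-envelope holds because products of shifts give all matrix units,
  so that the Toeplitz matrices generate, and because the matrix algebra is simple.
\<close>

unbundle no vec_syntax

section \<open>Weighted sums of rank-one matrices\<close>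

text \<open>
  The standard inner product, conjugate linear in the first argument, so that \<open>cip N x v\<close> is the
  number \<open>x\<^sup>* v\<close>.
\<close>

definition cip :: "nat \<Rightarrow> complex vec \<Rightarrow> complex vec \<Rightarrow> complex" where
  "cip N x v = (\<Sum>i<N. cnj (x $ i) * v $ i)"

definition outer_sum :: "nat \<Rightarrow> complex vec set \<Rightarrow> (complex vec \<Rightarrow> real) \<Rightarrow> complex mat" where
  "outer_sum N F c = mat N N (\<lambda>(i, j). \<Sum>x\<in>F. complex_of_real (c x) * x $ i * cnj (x $ j))"

definition invertible_in :: "nat \<Rightarrow> complex mat \<Rightarrow> bool" where
  "invertible_in N T \<longleftrightarrow> (\<exists>Y\<in>carrier_mat N N. T * Y = 1\<^sub>m N \<and> Y * T = 1\<^sub>m N)"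

lemma outer_sum_carrier [simp]: "outer_sum N F c \<in> carrier_mat N N" "dim_row (outer_sum N F c) = N" "dim_col (outer_sum N F c) = N"
  by (auto simp: outer_sum_def)

lemma outer_sum_index: "i < N \<Longrightarrow> j < N \<Longrightarrow> outer_sum N F c $$ (i, j) = (\<Sum>x\<in>F. complex_of_real (c x) * x $ i * cnj (x $ j))"
  by (simp add: outer_sum_def)

lemma outer_sum_cong: "(\<And>x. x \<in> F \<Longrightarrow> c x = d x) \<Longrightarrow> outer_sum N F c = outer_sum N F d"
  unfolding outer_sum_def by (intro cong_mat refl) (auto intro!: sum.cong)

lemma outer_sum_mono_neutral: "finite G \<Longrightarrow> F \<subseteq> G \<Longrightarrow> (\<And>x. x \<in> G - F \<Longrightarrow> c x = 0) \<Longrightarrow> outer_sum N F c = outer_sum N G c"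
  unfolding outer_sum_def by (intro cong_mat refl) (auto intro!: sum.mono_neutral_left)

lemma cip_add: "u \<in> carrier_vec N \<Longrightarrow> v \<in> carrier_vec N \<Longrightarrow> cip N x (u + v) = cip N x u + cip N x v"
  unfolding cip_def sum.distrib[symmetric] by (intro sum.cong refl) (auto simp: algebra_simps)

lemma cip_smult: "v \<in> carrier_vec N \<Longrightarrow> cip N x (a \<cdot>\<^sub>v v) = a * cip N x v"
  unfolding cip_def sum_distrib_left by (intro sum.cong refl) (auto simp: algebra_simps)

lemma cip_smult_left: "x \<in> carrier_vec N \<Longrightarrow> cip N (a \<cdot>\<^sub>v x) v = cnj a * cip N x v"
  unfolding cip_def sum_distrib_left by (intro sum.cong refl) (auto simp: algebra_simps)

lemma cip_minus_left: "x \<in> carrier_vec N \<Longrightarrow> y \<in> carrier_vec N \<Longrightarrow> cip N (x - y) v = cip N x v - cip N y v"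
  unfolding cip_def sum_subtractf[symmetric] by (intro sum.cong refl) (auto simp: algebra_simps)

lemma cip_minus: "u \<in> carrier_vec N \<Longrightarrow> v \<in> carrier_vec N \<Longrightarrow> cip N x (u - v) = cip N x u - cip N x v"
  unfolding cip_def sum_subtractf[symmetric] by (intro sum.cong refl) (auto simp: algebra_simps)

lemma cip_zero [simp]: "cip N x (0\<^sub>v N) = 0"
  by (auto simp: cip_def)

lemma cip_cnj: "cnj (cip N x y) = cip N y x"
  by (simp add: cip_def mult.commute)

lemma mult_mat_vec_index: "T \<in> carrier_mat N N \<Longrightarrow> v \<in> carrier_vec N \<Longrightarrow> i < N \<Longrightarrow>
   (T *\<^sub>v v) $ i = (\<Sum>j<N. T $$ (i, j) * v $ j)"
  by (auto simp: scalar_prod_def lessThan_atLeast0)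

lemma cip_mult_mat_vec: "T \<in> carrier_mat N N \<Longrightarrow> v \<in> carrier_vec N \<Longrightarrow>
   cip N u (T *\<^sub>v v) = (\<Sum>i<N. \<Sum>j<N. cnj (u $ i) * T $$ (i, j) * v $ j)"
  by (auto simp: cip_def mult_mat_vec_index sum_distrib_left mult.assoc
     simp del: index_mult_mat_vec intro!: sum.cong)

lemma outer_sum_mult_index: "v \<in> carrier_vec N \<Longrightarrow> i < N \<Longrightarrow>
   (outer_sum N F c *\<^sub>v v) $ i = (\<Sum>x\<in>F. complex_of_real (c x) * x $ i * cip N x v)"
proof -
  assume v: "v \<in> carrier_vec N" and i: "i < N"
  have "(outer_sum N F c *\<^sub>v v) $ i = (\<Sum>j<N. \<Sum>x\<in>F. complex_of_real (c x) * x $ i * (cnj (x $ j) * v $ j))"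
    using v i by (subst mult_mat_vec_index) (auto simp: outer_sum_index sum_distrib_right mult.assoc intro!: sum.cong)
  also have "\<dots> = (\<Sum>x\<in>F. \<Sum>j<N. complex_of_real (c x) * x $ i * (cnj (x $ j) * v $ j))"
    by (rule sum.swap)
  finally show ?thesis by (simp add: cip_def sum_distrib_left)
qed

lemma cip_outer_sum: "v \<in> carrier_vec N \<Longrightarrow>
   cip N u (outer_sum N F c *\<^sub>v v) = (\<Sum>x\<in>F. complex_of_real (c x) * cip N u x * cip N x v)"
proof -
  assume v: "v \<in> carrier_vec N"
  have "cip N u (outer_sum N F c *\<^sub>v v) = (\<Sum>i<N. \<Sum>x\<in>F. cnj (u $ i) * (complex_of_real (c x) * x $ i * cip N x v))"
    using v unfolding cip_def[of N u "_ *\<^sub>v _"]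
    by (auto simp: outer_sum_mult_index sum_distrib_left simp del: index_mult_mat_vec intro!: sum.cong)
  also have "\<dots> = (\<Sum>x\<in>F. \<Sum>i<N. cnj (u $ i) * (complex_of_real (c x) * x $ i * cip N x v))"
    by (rule sum.swap)
  also have "\<dots> = (\<Sum>x\<in>F. complex_of_real (c x) * cip N u x * cip N x v)"
    by (auto simp: cip_def[of N u] sum_distrib_left sum_distrib_right mult_ac intro!: sum.cong)
  finally show ?thesis .
qed

lemma cip_outer_sum_self: "v \<in> carrier_vec N \<Longrightarrow>
   cip N v (outer_sum N F c *\<^sub>v v) = complex_of_real (\<Sum>x\<in>F. c x * (cmod (cip N x v))\<^sup>2)"
  by (auto simp: cip_outer_sum complex_norm_square cip_cnj mult_ac intro!: sum.cong simp del: of_real_power)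

lemma cip_outer_sum_left: "u \<in> carrier_vec N \<Longrightarrow> v \<in> carrier_vec N \<Longrightarrow>
   cip N (outer_sum N F c *\<^sub>v u) v = cip N u (outer_sum N F c *\<^sub>v v)"
  by (subst cip_cnj[symmetric]) (auto simp: cip_outer_sum cip_cnj mult_ac intro!: sum.cong)

lemma invertible_in_iff:
  assumes T: "T \<in> carrier_mat N N"
  shows "invertible_in N T \<longleftrightarrow> (\<forall>v\<in>carrier_vec N. T *\<^sub>v v = 0\<^sub>v N \<longrightarrow> v = 0\<^sub>v N)"
proof
  assume "invertible_in N T"
  then obtain Y where Y: "Y \<in> carrier_mat N N" "Y * T = 1\<^sub>m N"
    unfolding invertible_in_def by auto
  show "\<forall>v\<in>carrier_vec N. T *\<^sub>v v = 0\<^sub>v N \<longrightarrow> v = 0\<^sub>v N"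
  proof (intro ballI impI)
    fix v assume v: "v \<in> carrier_vec N" "T *\<^sub>v v = 0\<^sub>v N"
    have "v = (Y * T) *\<^sub>v v" using Y v by simp
    also have "\<dots> = Y *\<^sub>v (T *\<^sub>v v)" using Y T v by (intro assoc_mult_mat_vec)
    also have "\<dots> = 0\<^sub>v N" unfolding v(2) using Y(1) by (intro eq_vecI) (auto simp: scalar_prod_def)
    finally show "v = 0\<^sub>v N" .
  qed
next
  assume "\<forall>v\<in>carrier_vec N. T *\<^sub>v v = 0\<^sub>v N \<longrightarrow> v = 0\<^sub>v N"
  then have "Determinant.det T \<noteq> 0" using det_0_iff_vec_prod_zero[OF T] by auto
  from det_non_zero_imp_unit[OF T this, of "()"] show "invertible_in N T"
    unfolding invertible_in_def Units_def ring_mat_simps by auto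
qed

lemma invertible_in_solve:
  assumes T: "T \<in> carrier_mat N N" "invertible_in N T" and x: "x \<in> carrier_vec N"
  obtains y where "y \<in> carrier_vec N" "T *\<^sub>v y = x"
proof -
  obtain Y where Y: "Y \<in> carrier_mat N N" "T * Y = 1\<^sub>m N"
    using T unfolding invertible_in_def by auto
  have "T *\<^sub>v (Y *\<^sub>v x) = x" using Y T x by (subst assoc_mult_mat_vec[symmetric]) auto
  moreover have "Y *\<^sub>v x \<in> carrier_vec N" using Y x by simp
  ultimately show ?thesis using that by blast
qed

text \<open>
  The conditions are fewer than \<open>N\<close> linear equations in \<open>N\<close> unknowns; padded with zero rows they have
  a square coefficient matrix of determinant 0.
\<close>

lemma exists_orthogonal:
  assumes F: "finite F" "card F < N"
  obtains v where "v \<in> carrier_vec N" "v \<noteq> 0\<^sub>v N" "\<And>x. x \<in> F \<Longrightarrow> cip N x v = 0"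
proof -
  obtain xs where xs: "set xs = F" "distinct xs" using finite_distinct_list[OF F(1)] by auto
  then have len: "length xs < N" using F(2) by (metis distinct_card)
  define A where "A = mat\<^sub>r N N (\<lambda>i. if i = N - 1 then 0\<^sub>v N else if i < length xs then vec N (\<lambda>j. cnj (xs ! i $ j)) else 0\<^sub>v N)"
  have A: "A \<in> carrier_mat N N" by (simp add: A_def)
  have "Determinant.det A = 0" unfolding A_def using len by (intro det_row_0) auto
  then obtain v where v: "v \<in> carrier_vec N" "v \<noteq> 0\<^sub>v N" "A *\<^sub>v v = 0\<^sub>v N"
    using det_0_iff_vec_prod_zero[OF A] by auto
  have "cip N x v = 0" if "x \<in> F" for x
  proof -
    obtain i where i: "i < length xs" "x = xs ! i" using \<open>x \<in> F\<close> xs by (metis in_set_conv_nth)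
    with len have "i < N" "i \<noteq> N - 1 \<or> length xs = N" by auto
    show ?thesis
    proof (cases "i = N - 1")
      case False
      have "0 = (A *\<^sub>v v) $ i" using v \<open>i < N\<close> by simp
      also have "\<dots> = (\<Sum>j<N. A $$ (i, j) * v $ j)" using A v \<open>i < N\<close> by (intro mult_mat_vec_index)
      also have "\<dots> = cip N x v" unfolding cip_def using False i len by (auto simp: A_def intro!: sum.cong)
      finally show ?thesis by simp
    qed (use i len in auto)
  qed
  then show ?thesis by (rule that[OF v(1,2)])
qed

section \<open>Paths of matrices\<close>

lemma continuous_map_mat_topology_iff:
  "continuous_map Z (mat_topology N) g \<longleftrightarrow>
     g \<in> topspace Z \<rightarrow> carrier_mat N N \<and>
     (\<forall>i<N. \<forall>j<N. continuous_map Z euclidean (\<lambda>z. g z $$ (i, j)))"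
    (is "?l \<longleftrightarrow> ?c \<and> ?e")
proof -
  let ?f = "\<lambda>X. restrict (\<lambda>p. X $$ p) ({..<N} \<times> {..<N}) :: nat \<times> nat \<Rightarrow> complex"
  let ?P = "product_topology (\<lambda>_. euclidean) ({..<N} \<times> {..<N}) :: (nat \<times> nat \<Rightarrow> complex) topology"
  show ?thesis
  proof
    assume l: ?l
    have "?c" using continuous_map_funspace[OF l] by (auto simp: mat_topology_def topspace_pullback_topology)
    moreover have "continuous_map Z euclidean (\<lambda>z. g z $$ (i, j))" if "i < N" "j < N" for i j
    proof -
      have "continuous_map ?P euclidean (\<lambda>h. h (i, j))"
        using that by (intro continuous_map_product_projection) auto
      then have "continuous_map (mat_topology N) euclidean ((\<lambda>h. h (i, j)) \<circ> ?f)"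
        unfolding mat_topology_def by (rule continuous_map_pullback)
      from continuous_map_compose[OF l this] show ?thesis using that by (simp add: o_def)
    qed
    ultimately show "?c \<and> ?e" by blast
  next
    assume r: "?c \<and> ?e"
    show ?l unfolding mat_topology_def
    proof (rule continuous_map_pullback')
      show "continuous_map Z ?P (?f \<circ> g)"
        unfolding continuous_map_componentwise using r by (auto simp: o_def)
      show "topspace Z \<subseteq> g -` carrier_mat N N" using r by auto
    qed
  qed
qed

definition linked :: "nat \<Rightarrow> complex mat set \<Rightarrow> complex mat \<Rightarrow> complex mat \<Rightarrow> bool" where
  "linked N S = path_component_of (subtopology (mat_topology N) S)"

lemma topspace_mat_topology [simp]: "topspace (mat_topology N) = carrier_mat N N"
  by (auto simp: mat_topology_def topspace_pullback_topology)

lemma linkedI: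
  assumes g: "\<And>t. t \<in> {0..1} \<Longrightarrow> g t \<in> S" and S: "S \<subseteq> carrier_mat N N"
    and c: "\<And>i j. i < N \<Longrightarrow> j < N \<Longrightarrow> continuous_on {0..1::real} (\<lambda>t. g t $$ (i, j))"
  shows "linked N S (g 0) (g 1)"
proof -
  have "pathin (subtopology (mat_topology N) S) g"
    unfolding pathin_def continuous_map_in_subtopology continuous_map_mat_topology_iff
    using assms by auto
  then show ?thesis unfolding linked_def path_component_of_def by blast
qed

lemma linked_sym: "linked N S T T' \<Longrightarrow> linked N S T' T"
  unfolding linked_def by (rule path_component_of_sym)

lemma linked_trans [trans]: "linked N S T T' \<Longrightarrow> linked N S T' T'' \<Longrightarrow> linked N S T T''"
  unfolding linked_def by (rule path_component_of_trans)

lemma linked_refl: "T \<in> S \<Longrightarrow> T \<in> carrier_mat N N \<Longrightarrow> linked N S T T"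
  unfolding linked_def by (simp add: path_component_of_refl)

lemma linked_mem: assumes "linked N S T T'" shows "T \<in> S" "T' \<in> S"
proof -
  from path_component_in_topspace[OF assms[unfolded linked_def]] show "T \<in> S" "T' \<in> S"
    by auto
qed

section \<open>Moves between weighted sums\<close>

text \<open>
  For a family \<open>X\<close> whose rank-one matrices span the self-adjoint part of an operator system,
  these are its invertible self-adjoint elements.
\<close>

definition nondeg :: "nat \<Rightarrow> complex vec set \<Rightarrow> complex mat set" where
  "nondeg N X = {outer_sum N F c | F c. finite F \<and> F \<subseteq> X \<and> invertible_in N (outer_sum N F c)}"

text \<open>
  A basis is characterized by having \<open>N\<close> elements and trivial orthogonal complement. In this form dual
  vectors come from \<open>exists_orthogonal\<close>, without any sums of vectors.
\<close>

definition basis :: "nat \<Rightarrow> complex vec set \<Rightarrow> bool" where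
  "basis N F \<longleftrightarrow> finite F \<and> F \<subseteq> carrier_vec N \<and> card F = N \<and>
     (\<forall>v\<in>carrier_vec N. (\<forall>x\<in>F. cip N x v = 0) \<longrightarrow> v = 0\<^sub>v N)"

lemma nondeg_carrier: "nondeg N X \<subseteq> carrier_mat N N"
  by (auto simp: nondeg_def)

lemma nondegI: "finite F \<Longrightarrow> F \<subseteq> X \<Longrightarrow> invertible_in N (outer_sum N F c) \<Longrightarrow> outer_sum N F c \<in> nondeg N X"
  by (auto simp: nondeg_def)

lemma outer_sum_update_mult:
  assumes "finite F" "x \<in> F" "F \<subseteq> carrier_vec N" "v \<in> carrier_vec N"
  shows "outer_sum N F (c(x := a)) *\<^sub>v v = outer_sum N F c *\<^sub>v v + (complex_of_real (a - c x) * cip N x v) \<cdot>\<^sub>v x"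
proof (rule eq_vecI)
  have x: "x \<in> carrier_vec N" using assms by auto
  show "dim_vec (outer_sum N F (c(x := a)) *\<^sub>v v) = dim_vec (outer_sum N F c *\<^sub>v v + (complex_of_real (a - c x) * cip N x v) \<cdot>\<^sub>v x)"
    using x by simp
  fix i assume "i < dim_vec (outer_sum N F c *\<^sub>v v + (complex_of_real (a - c x) * cip N x v) \<cdot>\<^sub>v x)"
  then have i: "i < N" using x by simp
  have "(\<Sum>z\<in>F. complex_of_real ((c(x := a)) z) * z $ i * cip N z v) =
        (\<Sum>z\<in>F. complex_of_real (c z) * z $ i * cip N z v) + complex_of_real (a - c x) * x $ i * cip N x v"
    using assms(1,2) by (simp add: sum.remove[of F x] algebra_simps)
  then show "(outer_sum N F (c(x := a)) *\<^sub>v v) $ i = (outer_sum N F c *\<^sub>v v + (complex_of_real (a - c x) * cip N x v) \<cdot>\<^sub>v x) $ i"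
    using i x assms(4) by (simp add: outer_sum_mult_index del: index_mult_mat_vec)
qed

text \<open>
  If \<open>y = T\<^sup>-\<^sup>1 x\<close>, then \<open>x\<^sup>* y = y\<^sup>* T y\<close>, and the form of a Hermitian matrix is real.
\<close>

lemma cip_preimage_real:
  assumes "y \<in> carrier_vec N" "outer_sum N F c *\<^sub>v y = x"
  shows "cip N x y = complex_of_real (Re (cip N x y))" "cip N y x = complex_of_real (Re (cip N x y))"
proof -
  have "cip N y x = complex_of_real (\<Sum>x\<in>F. c x * (cmod (cip N x y))\<^sup>2)"
    using cip_outer_sum_self[OF assms(1), of F c] assms(2) by simp
  moreover have "cip N x y = cnj (cip N y x)" by (simp add: cip_cnj)
  ultimately show "cip N x y = complex_of_real (Re (cip N x y))" "cip N y x = complex_of_real (Re (cip N x y))"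
    by simp_all
qed

text \<open>
  If \<open>(T + \<tau> x x\<^sup>*) v = 0\<close>, pairing with \<open>y = T\<^sup>-\<^sup>1 x\<close> gives \<open>(1 + \<tau> x\<^sup>* y) x\<^sup>* v = 0\<close>. As long as
  \<open>1 + \<tau> x\<^sup>* y > 0\<close> this forces \<open>x\<^sup>* v = 0\<close>, hence \<open>T v = 0\<close> and \<open>v = 0\<close>. The factor is affine in
  \<open>\<tau>\<close>, so it is positive on the whole segment once it is positive at the far end.
\<close>

lemma rank_one_step:
  assumes F: "finite F" "F \<subseteq> X" and X: "X \<subseteq> carrier_vec N" and inv: "invertible_in N (outer_sum N F c)"
    and x: "x \<in> F" and y: "y \<in> carrier_vec N" "outer_sum N F c *\<^sub>v y = x"
    and pos: "1 + (a - c x) * Re (cip N x y) > 0"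
  shows "linked N (nondeg N X) (outer_sum N F c) (outer_sum N F (c(x := a)))"
proof -
  define g where "g t = outer_sum N F (c(x := c x + t * (a - c x)))" for t
  have xc: "x \<in> carrier_vec N" using F X x by auto
  have "g t \<in> nondeg N X" if t: "t \<in> {0..1}" for t
  proof -
    define Q where "Q = Re (cip N x y)"
    have Q: "cip N y x = complex_of_real Q" using cip_preimage_real[OF y] by (simp add: Q_def)
    have "0 < (1 - t) * 1 + t * (1 + (a - c x) * Q)"
    proof (cases "t = 0")
      case False
      then have "0 < t * (1 + (a - c x) * Q)" using t pos by (auto simp: Q_def intro!: mult_pos_pos)
      then show ?thesis using t by auto
    qed auto
    then have pt: "1 + t * (a - c x) * Q > 0" by (simp add: algebra_simps)
    have "v = 0\<^sub>v N" if v: "v \<in> carrier_vec N" "g t *\<^sub>v v = 0\<^sub>v N" for v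
    proof -
      define s where "s = cip N x v"
      have e: "outer_sum N F c *\<^sub>v v + (complex_of_real (t * (a - c x)) * s) \<cdot>\<^sub>v x = 0\<^sub>v N"
        using v outer_sum_update_mult[of F x N v c "c x + t * (a - c x)"] F X x by (auto simp: g_def s_def)
      have "0 = cip N y (outer_sum N F c *\<^sub>v v + (complex_of_real (t * (a - c x)) * s) \<cdot>\<^sub>v x)"
        unfolding e by simp
      also have "\<dots> = cip N y (outer_sum N F c *\<^sub>v v) + complex_of_real (t * (a - c x)) * s * complex_of_real Q"
        using v xc Q by (subst cip_add) (auto simp: cip_smult intro!: mult_mat_vec_carrier[of _ _ N])
      also have "cip N y (outer_sum N F c *\<^sub>v v) = s"
        using cip_outer_sum_left[OF y(1) v(1), of F c] y(2) by (simp add: s_def)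
      finally have "s * complex_of_real (1 + t * (a - c x) * Q) = 0"
        by (simp add: algebra_simps)
      then have "s = 0" using pt by (metis mult_eq_0_iff less_irrefl of_real_eq_0_iff)
      then have "outer_sum N F c *\<^sub>v v = 0\<^sub>v N"
        unfolding e[symmetric] using xc v by (intro eq_vecI) auto
      then show ?thesis using inv v by (auto simp: invertible_in_iff)
    qed
    then show ?thesis unfolding g_def using F by (intro nondegI) (auto simp: invertible_in_iff)
  qed
  moreover have "continuous_on {0..1} (\<lambda>t. (c(x := c x + t * (a - c x))) z)" for z
    by (cases "z = x") (auto intro!: continuous_intros)
  ultimately have "linked N (nondeg N X) (g 0) (g 1)"
    by (intro linkedI nondeg_carrier)
       (auto simp: g_def outer_sum_index simp del: fun_upd_apply intro!: continuous_intros)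
  then show ?thesis by (simp add: g_def)
qed

text \<open>
  The left-hand side is the trace of \<open>Y (\<Sum> c\<^sub>x x x\<^sup>*)\<close>.
\<close>

lemma sum_weights_inverse:
  assumes inv: "Y \<in> carrier_mat N N" "Y * outer_sum N F c = 1\<^sub>m N" and F: "F \<subseteq> carrier_vec N"
  shows "(\<Sum>x\<in>F. c x * Re (cip N x (Y *\<^sub>v x))) = real N"
proof -
  have "(\<Sum>x\<in>F. complex_of_real (c x) * cip N x (Y *\<^sub>v x)) =
        (\<Sum>x\<in>F. \<Sum>i<N. \<Sum>j<N. Y $$ (i, j) * (complex_of_real (c x) * x $ j * cnj (x $ i)))"
    using F inv by (intro sum.cong refl) (auto simp: cip_mult_mat_vec subset_iff sum_distrib_left mult_ac)
  also have "\<dots> = (\<Sum>i<N. \<Sum>x\<in>F. \<Sum>j<N. Y $$ (i, j) * (complex_of_real (c x) * x $ j * cnj (x $ i)))"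
    by (rule sum.swap)
  also have "\<dots> = (\<Sum>i<N. \<Sum>j<N. \<Sum>x\<in>F. Y $$ (i, j) * (complex_of_real (c x) * x $ j * cnj (x $ i)))"
    by (intro sum.cong refl sum.swap)
  also have "\<dots> = (\<Sum>i<N. (Y * outer_sum N F c) $$ (i, i))"
    using inv(1) by (intro sum.cong refl)
      (auto simp: scalar_prod_def outer_sum_index sum_distrib_left lessThan_atLeast0 simp del: inv(2) intro!: sum.cong)
  also have "\<dots> = complex_of_real (real N)" by (simp add: inv(2))
  finally have "Re (\<Sum>x\<in>F. complex_of_real (c x) * cip N x (Y *\<^sub>v x)) = real N" by simp
  then show ?thesis by simp
qed

text \<open>
  With more than \<open>N\<close> vectors the average of the numbers \<open>c\<^sub>x x\<^sup>* T\<^sup>-\<^sup>1 x\<close> is less than 1. A vector for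
  which this number is less than 1 can be removed by a rank-one step, since then the factor
  \<open>1 - c\<^sub>x x\<^sup>* T\<^sup>-\<^sup>1 x\<close> is positive.
\<close>

lemma linked_card_le:
  assumes "finite F" "F \<subseteq> X" "X \<subseteq> carrier_vec N" "invertible_in N (outer_sum N F c)"
  shows "\<exists>G d. finite G \<and> G \<subseteq> X \<and> card G \<le> N \<and> linked N (nondeg N X) (outer_sum N F c) (outer_sum N G d)"
  using assms
proof (induction "card F" arbitrary: F c rule: less_induct)
  case less
  show ?case
  proof (cases "card F \<le> N")
    case True
    with less.prems show ?thesis by (intro exI[of _ F] exI[of _ c]) (auto intro!: linked_refl nondegI)
  next
    case False
    obtain Y where Y: "Y \<in> carrier_mat N N" "outer_sum N F c * Y = 1\<^sub>m N" "Y * outer_sum N F c = 1\<^sub>m N"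
      using less.prems(4) by (auto simp: invertible_in_def)
    have Fc: "F \<subseteq> carrier_vec N" using less.prems by auto
    have "\<exists>x\<in>F. c x * Re (cip N x (Y *\<^sub>v x)) < 1"
    proof (rule ccontr)
      assume "\<not> ?thesis"
      then have "(\<Sum>x\<in>F. 1) \<le> (\<Sum>x\<in>F. c x * Re (cip N x (Y *\<^sub>v x)))"
        by (intro sum_mono) (auto simp: not_less)
      with sum_weights_inverse[OF Y(1,3) Fc] False show False by simp
    qed
    then obtain x where x: "x \<in> F" "c x * Re (cip N x (Y *\<^sub>v x)) < 1" by auto
    then have xc: "x \<in> carrier_vec N" using Fc by auto
    have "outer_sum N F c *\<^sub>v (Y *\<^sub>v x) = x" using Y xc by (subst assoc_mult_mat_vec[symmetric]) auto
    then have l: "linked N (nondeg N X) (outer_sum N F c) (outer_sum N F (c(x := 0)))"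
      using less.prems x Y xc by (intro rank_one_step[where y = "Y *\<^sub>v x"]) auto
    have e: "outer_sum N F (c(x := 0)) = outer_sum N (F - {x}) c"
    proof -
      have "outer_sum N (F - {x}) c = outer_sum N (F - {x}) (c(x := 0))" by (intro outer_sum_cong) auto
      also have "\<dots> = outer_sum N F (c(x := 0))" using less.prems by (intro outer_sum_mono_neutral) auto
      finally show ?thesis by simp
    qed
    have "invertible_in N (outer_sum N (F - {x}) c)"
      using linked_mem(2)[OF l] unfolding e nondeg_def by auto
    moreover have "card (F - {x}) < card F" using less.prems(1) x(1) by (intro psubset_card_mono) auto
    ultimately obtain G d where "finite G" "G \<subseteq> X" "card G \<le> N"
        "linked N (nondeg N X) (outer_sum N (F - {x}) c) (outer_sum N G d)"
      using less.hyps[of "F - {x}" c] less.prems by blast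
    with l show ?thesis unfolding e by (meson linked_trans)
  qed
qed

lemma basisD:
  assumes "basis N F"
  shows "finite F" "F \<subseteq> carrier_vec N" "card F = N"
    "\<And>v. v \<in> carrier_vec N \<Longrightarrow> (\<And>x. x \<in> F \<Longrightarrow> cip N x v = 0) \<Longrightarrow> v = 0\<^sub>v N"
  using assms by (auto simp: basis_def)

lemma basis_dual:
  assumes F: "basis N F" and b: "b \<in> F"
  obtains f where "f \<in> carrier_vec N" "\<And>x. x \<in> F \<Longrightarrow> cip N x f = (if x = b then 1 else 0)"
proof -
  note F' = basisD[OF F]
  have "card (F - {b}) < card F" using F'(1) b by (intro psubset_card_mono) auto
  then obtain f where f: "f \<in> carrier_vec N" "f \<noteq> 0\<^sub>v N" "\<And>x. x \<in> F - {b} \<Longrightarrow> cip N x f = 0"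
    using exists_orthogonal[of "F - {b}" N] F' by auto
  then have "cip N b f \<noteq> 0" using F'(4)[of f] by blast
  then show ?thesis using f by (intro that[of "(1 / cip N b f) \<cdot>\<^sub>v f"]) (auto simp: cip_smult)
qed

text \<open>
  A vector orthogonal to all \<open>x\<close> of nonzero weight is in the kernel, so at least \<open>N\<close> vectors of nonzero
  weight are present.
\<close>

lemma invertible_in_card_le_basis:
  assumes F: "finite F" "F \<subseteq> carrier_vec N" "card F \<le> N" and inv: "invertible_in N (outer_sum N F c)"
  shows "basis N F" "x \<in> F \<Longrightarrow> c x \<noteq> 0"
proof -
  have z: "v = 0\<^sub>v N" if v: "v \<in> carrier_vec N" "\<And>x. x \<in> F \<Longrightarrow> c x \<noteq> 0 \<Longrightarrow> cip N x v = 0" for v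
  proof -
    have "(outer_sum N F c *\<^sub>v v) $ i = 0" if "i < N" for i
      using v that by (auto simp: outer_sum_mult_index simp del: index_mult_mat_vec intro!: sum.neutral)
    then have "outer_sum N F c *\<^sub>v v = 0\<^sub>v N" by (intro eq_vecI) (auto simp del: index_mult_mat_vec)
    with inv v(1) show ?thesis by (auto simp: invertible_in_iff)
  qed
  have "\<not> card F < N" using exists_orthogonal[OF F(1)] z by metis
  with F z show basis: "basis N F" unfolding basis_def by auto
  show "c x \<noteq> 0" if x: "x \<in> F"
  proof
    assume "c x = 0"
    obtain f where f: "f \<in> carrier_vec N" "\<And>y. y \<in> F \<Longrightarrow> cip N y f = (if y = x then 1 else 0)"
      using basis_dual[OF basis x] by blast
    have "f = 0\<^sub>v N" using f \<open>c x = 0\<close> by (intro z) auto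
    with f(2)[OF x] show False by simp
  qed
qed

lemma basis_invertible:
  assumes F: "basis N F" and c: "\<And>x. x \<in> F \<Longrightarrow> c x \<noteq> 0"
  shows "invertible_in N (outer_sum N F c)"
  unfolding invertible_in_iff[OF outer_sum_carrier(1)]
proof (intro ballI impI)
  fix v assume v: "v \<in> carrier_vec N" "outer_sum N F c *\<^sub>v v = 0\<^sub>v N"
  show "v = 0\<^sub>v N"
  proof (rule basisD(4)[OF F v(1)])
    fix b assume b: "b \<in> F"
    obtain f where f: "f \<in> carrier_vec N" "\<And>y. y \<in> F \<Longrightarrow> cip N y f = (if y = b then 1 else 0)"
      using basis_dual[OF F b] by blast
    have "0 = cip N f (outer_sum N F c *\<^sub>v v)" by (simp add: v)
    also have "\<dots> = (\<Sum>x\<in>F. complex_of_real (c x) * cip N f x * cip N x v)"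
      by (rule cip_outer_sum[OF v(1)])
    also have "\<dots> = (\<Sum>x\<in>F. if x = b then complex_of_real (c x) * cip N x v else 0)"
      using f(2) by (intro sum.cong) (auto simp: cip_cnj[of N _ f, symmetric])
    also have "\<dots> = complex_of_real (c b) * cip N b v" using b basisD(1)[OF F] by simp
    finally show "cip N b v = 0" using c[OF b] by simp
  qed
qed

text \<open>
  A vector orthogonal to \<open>F - {b}\<close> is a multiple of the dual vector \<open>f\<close>, and \<open>w\<close> is not orthogonal
  to \<open>f\<close>.
\<close>

lemma basis_exchange:
  assumes F: "basis N F" and b: "b \<in> F"
    and f: "f \<in> carrier_vec N" "\<And>x. x \<in> F \<Longrightarrow> cip N x f = (if x = b then 1 else 0)"
    and w: "w \<in> carrier_vec N" "cip N w f \<noteq> 0"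
  shows "basis N (insert w (F - {b}))"
  unfolding basis_def
proof (intro conjI ballI impI)
  note F' = basisD[OF F]
  show "finite (insert w (F - {b}))" "insert w (F - {b}) \<subseteq> carrier_vec N" using F' w by auto
  have "w \<notin> F - {b}" using f(2)[of w] w by (auto split: if_splits)
  then show "card (insert w (F - {b})) = N" using F' b by (metis card.remove card_insert_disjoint finite_Diff)
  fix v assume v: "v \<in> carrier_vec N" "\<forall>x\<in>insert w (F - {b}). cip N x v = 0"
  have e: "v - cip N b v \<cdot>\<^sub>v f = 0\<^sub>v N"
    using v f by (intro F'(4)) (auto simp: cip_minus cip_smult)
  have "v = (v - cip N b v \<cdot>\<^sub>v f) + cip N b v \<cdot>\<^sub>v f" using v f by (intro eq_vecI) auto
  then have v_eq: "v = cip N b v \<cdot>\<^sub>v f" unfolding e using f by auto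
  then have "cip N w v = cip N b v * cip N w f" using f by (metis cip_smult)
  then have "cip N b v = 0" using v w by simp
  then have "v = 0 \<cdot>\<^sub>v f" using v_eq by simp
  then show "v = 0\<^sub>v N" using f by auto
qed

lemma linked_rescale:
  assumes F: "basis N F" "F \<subseteq> X" and s: "\<And>x. x \<in> F \<Longrightarrow> c x * d x > 0"
  shows "linked N (nondeg N X) (outer_sum N F c) (outer_sum N F d)"
proof -
  define g where "g t = outer_sum N F (\<lambda>x. (1 - t) * c x + t * d x)" for t
  have "g t \<in> nondeg N X" if t: "t \<in> {0..1}" for t
  proof -
    have "(1 - t) * c x + t * d x \<noteq> 0" if x: "x \<in> F" for x
    proof
      assume "(1 - t) * c x + t * d x = 0"
      then have "0 = ((1 - t) * c x + t * d x) * c x" by simp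
      also have "\<dots> = (1 - t) * (c x)\<^sup>2 + t * (c x * d x)" by (simp add: algebra_simps power2_eq_square)
      also have "\<dots> > 0"
      proof (cases "t = 0")
        case False
        then have "t * (c x * d x) > 0" using t s[OF x] by auto
        then show ?thesis using t by (intro add_nonneg_pos) auto
      qed (use s[OF x] in auto)
      finally show False by simp
    qed
    then show ?thesis unfolding g_def using F
      by (intro nondegI basis_invertible) (auto dest: basisD)
  qed
  then have "linked N (nondeg N X) (g 0) (g 1)"
    by (intro linkedI nondeg_carrier) (auto simp: g_def outer_sum_index intro!: continuous_intros)
  then show ?thesis by (simp add: g_def)
qed

text \<open>
  The exchange takes two rank-one steps: first \<open>w\<close> receives a small weight \<open>s\<close> of the same sign as
  \<open>c b\<close>, then the weight of \<open>b\<close> is moved to 0. With \<open>T\<close> the matrix after the first step and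
  \<open>\<alpha> = w\<^sup>* f\<close>, the dual vector satisfies \<open>T f = c\<^sub>b b + s \<alpha> w\<close>. Pairing this identity with
  \<open>T\<^sup>-\<^sup>1 b\<close> and \<open>T\<^sup>-\<^sup>1 w\<close> gives \<open>1 - c\<^sub>b b\<^sup>* T\<^sup>-\<^sup>1 b = (s / c\<^sub>b) \<bar>\<alpha>\<bar>\<^sup>2 (1 - s w\<^sup>* T\<^sup>-\<^sup>1 w)\<close>, which is positive,
  so the second step is possible.
\<close>

lemma linked_exchange:
  assumes F: "basis N F" "F \<subseteq> X" and X: "X \<subseteq> carrier_vec N" and c: "\<And>x. x \<in> F \<Longrightarrow> c x \<noteq> 0" and b: "b \<in> F"
    and f: "f \<in> carrier_vec N" "\<And>x. x \<in> F \<Longrightarrow> cip N x f = (if x = b then 1 else 0)"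
    and w: "w \<in> X" "w \<notin> F" "cip N w f \<noteq> 0"
  shows "linked N (nondeg N X) (outer_sum N F c) (outer_sum N (insert w (F - {b})) (c(w := c b)))"
proof -
  define G where "G = insert w F"
  define c0 where "c0 = c(w := 0)"
  note F' = basisD[OF F(1)]
  have G: "finite G" "G \<subseteq> X" "w \<in> G" "b \<in> G" "G \<subseteq> carrier_vec N" using F F' w b X by (auto simp: G_def)
  have wc: "w \<in> carrier_vec N" and bc: "b \<in> carrier_vec N" using G by auto
  have bw: "b \<noteq> w" using b w by auto
  have T0: "outer_sum N F c = outer_sum N G c0"
  proof -
    have "outer_sum N F c = outer_sum N F c0" using w by (intro outer_sum_cong) (auto simp: c0_def)
    also have "\<dots> = outer_sum N G c0" using G w by (intro outer_sum_mono_neutral) (auto simp: G_def c0_def)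
    finally show ?thesis .
  qed
  have inv0: "invertible_in N (outer_sum N G c0)" unfolding T0[symmetric] using F(1) c by (rule basis_invertible)
  obtain y where y: "y \<in> carrier_vec N" "outer_sum N G c0 *\<^sub>v y = w"
    using invertible_in_solve[OF _ inv0 wc] by auto
  define Q where "Q = Re (cip N w y)"
  have Q: "cip N w y = complex_of_real Q" using cip_preimage_real[OF y] by (simp add: Q_def)
  \<comment> \<open>small enough for the first step to keep the matrix invertible\<close>
  define e where "e = 1 / (\<bar>c b * Q\<bar> + 1)"
  have e: "e > 0" by (simp add: e_def)
  have "\<bar>e * (c b * Q)\<bar> < 1" unfolding abs_mult[of e] using e by (simp add: e_def field_simps abs_mult)
  then have p: "1 + (c b * e) * Q > 0" by (simp add: mult_ac)
  define s where "s = c b * e"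
  define c1 where "c1 = c0(w := s)"
  have l1: "linked N (nondeg N X) (outer_sum N G c0) (outer_sum N G c1)"
    unfolding c1_def using p G by (intro rank_one_step[OF G(1,2) X inv0 G(3) y]) (auto simp: c0_def s_def Q_def)
  have inv1: "invertible_in N (outer_sum N G c1)" using linked_mem(2)[OF l1] by (auto simp: nondeg_def)
  obtain z where z: "z \<in> carrier_vec N" "outer_sum N G c1 *\<^sub>v z = b"
    using invertible_in_solve[OF _ inv1 bc] by auto
  define R where "R = Re (cip N b z)"
  have R: "cip N z b = complex_of_real R" using cip_preimage_real[OF z] by (simp add: R_def)
  define \<alpha> where "\<alpha> = cip N w f"
  have Tf: "cip N u (outer_sum N G c1 *\<^sub>v f) = complex_of_real (c b) * cip N u b + complex_of_real s * cip N u w * \<alpha>" for u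
  proof -
    have "cip N u (outer_sum N G c1 *\<^sub>v f) = complex_of_real s * cip N u w * \<alpha>
         + (\<Sum>x\<in>F. complex_of_real (c1 x) * cip N u x * cip N x f)"
      using F'(1) w by (simp add: cip_outer_sum[OF f(1)] G_def c1_def \<alpha>_def)
    also have "(\<Sum>x\<in>F. complex_of_real (c1 x) * cip N u x * cip N x f) =
        (\<Sum>x\<in>F. if x = b then complex_of_real (c b) * cip N u b else 0)"
      using f(2) w bw by (intro sum.cong) (auto simp: c1_def c0_def)
    finally show ?thesis using F'(1) b by simp
  qed
  have Ty: "outer_sum N G c1 *\<^sub>v y = complex_of_real (1 + s * Q) \<cdot>\<^sub>v w"
  proof -
    have "outer_sum N G c1 *\<^sub>v y = w + complex_of_real (s * Q) \<cdot>\<^sub>v w"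
      using outer_sum_update_mult[OF G(1,3,5) y(1), of c0 s] unfolding y(2) c1_def Q by (simp add: c0_def)
    also have "\<dots> = complex_of_real (1 + s * Q) \<cdot>\<^sub>v w"
      using wc by (intro eq_vecI) (auto simp: algebra_simps)
    finally show ?thesis .
  qed
  have sQ: "1 + s * Q > 0" using p by (simp add: s_def)
  have 1: "1 = complex_of_real (c b) * complex_of_real R + complex_of_real s * cip N z w * \<alpha>"
    using Tf[of z] cip_outer_sum_left[OF z(1) f(1), of G c1] f(2)[OF b] by (simp add: z(2) R)
  have "complex_of_real (1 + s * Q) * \<alpha> = cip N (outer_sum N G c1 *\<^sub>v y) f"
    unfolding Ty by (simp add: cip_smult_left[OF wc] \<alpha>_def)
  also have "\<dots> = complex_of_real (c b) * cip N y b + complex_of_real s * cip N y w * \<alpha>"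
    using Tf[of y] cip_outer_sum_left[OF y(1) f(1), of G c1] by simp
  also have "cip N y w = complex_of_real Q" using Q by (metis cip_cnj complex_cnj_complex_of_real)
  finally have 2: "complex_of_real (c b) * cip N y b = \<alpha>" by (simp add: algebra_simps)
  have "cip N y b = cip N y (outer_sum N G c1 *\<^sub>v z)" by (simp add: z)
  also have "\<dots> = complex_of_real (1 + s * Q) * cip N w z"
    using cip_outer_sum_left[OF y(1) z(1), of G c1] by (simp add: Ty cip_smult_left[OF wc])
  finally have "complex_of_real (c b * (1 + s * Q)) * cip N w z = \<alpha>" using 2 by (simp add: mult_ac)
  then have "cnj (complex_of_real (c b * (1 + s * Q)) * cip N w z) = cnj \<alpha>" by simp
  then have 3: "complex_of_real (c b * (1 + s * Q)) * cip N z w = cnj \<alpha>" by (simp add: cip_cnj)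
  have 4: "1 - complex_of_real (c b * R) = complex_of_real s * cip N z w * \<alpha>"
    using 1 by (metis add_diff_cancel_left' of_real_mult)
  have "complex_of_real (c b * (1 + s * Q)) * (1 - complex_of_real (c b * R)) =
        complex_of_real s * \<alpha> * (complex_of_real (c b * (1 + s * Q)) * cip N z w)"
    unfolding 4 by (simp only: mult_ac)
  also have "\<dots> = complex_of_real (s * (cmod \<alpha>)\<^sup>2)"
    unfolding 3 by (simp add: complex_norm_square mult.assoc del: of_real_power)
  finally have "complex_of_real (c b * (1 + s * Q) * (1 - c b * R)) = complex_of_real (s * (cmod \<alpha>)\<^sup>2)"
    by simp
  then have "c b * (1 + s * Q) * (1 - c b * R) = s * (cmod \<alpha>)\<^sup>2" unfolding of_real_eq_iff .
  then have "(1 + s * Q) * (1 - c b * R) = e * (cmod \<alpha>)\<^sup>2" using c[OF b] by (simp add: s_def)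
  moreover have "e * (cmod \<alpha>)\<^sup>2 > 0" using e w(3) by (simp add: \<alpha>_def)
  ultimately have q: "1 - c b * R > 0" using sQ by (metis zero_less_mult_pos)
  have l2: "linked N (nondeg N X) (outer_sum N G c1) (outer_sum N G (c1(b := 0)))"
    using q bw by (intro rank_one_step[OF G(1,2) X inv1 G(4) z]) (auto simp: c1_def c0_def R_def)
  have T2: "outer_sum N G (c1(b := 0)) = outer_sum N (insert w (F - {b})) (c(w := s))"
  proof -
    have "outer_sum N (insert w (F - {b})) (c(w := s)) = outer_sum N (insert w (F - {b})) (c1(b := 0))"
      using bw by (intro outer_sum_cong) (auto simp: c1_def c0_def)
    also have "\<dots> = outer_sum N G (c1(b := 0))"
      using G bw by (intro outer_sum_mono_neutral) (auto simp: G_def)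
    finally show ?thesis by simp
  qed
  have "c x * c x > 0" if "x \<in> F" for x using c[OF that] by (simp add: zero_less_mult_iff) linarith
  then have "linked N (nondeg N X) (outer_sum N (insert w (F - {b})) (c(w := s))) (outer_sum N (insert w (F - {b})) (c(w := c b)))"
    using F w b e by (intro linked_rescale basis_exchange[OF F(1) b f wc]) (auto simp: s_def mult_ac)
  with l1 l2 show ?thesis unfolding T0 T2 by (meson linked_trans)
qed

text \<open>
  No union of two hyperplanes contains the family. The standard basis vectors show what goes wrong
  otherwise: their rank-one matrices span the diagonal matrices, where \<open>diag(1, -1)\<close> and
  \<open>diag(-1, 1)\<close> cannot be joined by invertible ones.
\<close>

definition generic_family :: "nat \<Rightarrow> complex vec set \<Rightarrow> bool" where
  "generic_family N X \<longleftrightarrow> X \<subseteq> carrier_vec N \<and>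
     (\<forall>f\<in>carrier_vec N. \<forall>g\<in>carrier_vec N. f \<noteq> 0\<^sub>v N \<longrightarrow> g \<noteq> 0\<^sub>v N \<longrightarrow>
        (\<exists>x\<in>X. cip N x f \<noteq> 0 \<and> cip N x g \<noteq> 0))"

text \<open>
  Choose \<open>w\<close> in \<open>X\<close> with nonzero coordinates at \<open>b\<close> and \<open>b'\<close>. Three exchanges that each
  preserve the sign do the swap: \<open>w\<close> for \<open>b\<close>, then \<open>b\<close> for \<open>b'\<close>, then \<open>b'\<close> for \<open>w\<close>.
\<close>

lemma linked_swap:
  assumes X: "generic_family N X" and F: "basis N F" "F \<subseteq> X" and c: "\<And>x. x \<in> F \<Longrightarrow> c x \<noteq> 0"
    and b: "b \<in> F" "b' \<in> F" "b \<noteq> b'"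
  shows "linked N (nondeg N X) (outer_sum N F c) (outer_sum N F (c(b := c b', b' := c b)))"
proof -
  have Xc: "X \<subseteq> carrier_vec N" using X by (simp add: generic_family_def)
  obtain f where f: "f \<in> carrier_vec N" "\<And>x. x \<in> F \<Longrightarrow> cip N x f = (if x = b then 1 else 0)"
    using basis_dual[OF F(1) b(1)] by blast
  obtain g where g: "g \<in> carrier_vec N" "\<And>x. x \<in> F \<Longrightarrow> cip N x g = (if x = b' then 1 else 0)"
    using basis_dual[OF F(1) b(2)] by blast
  have "f \<noteq> 0\<^sub>v N" "g \<noteq> 0\<^sub>v N" using f(2)[OF b(1)] g(2)[OF b(2)] by auto
  then obtain w where w: "w \<in> X" "cip N w f \<noteq> 0" "cip N w g \<noteq> 0"
    using X f(1) g(1) unfolding generic_family_def by blast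
  have wF: "w \<notin> F"
  proof
    assume "w \<in> F"
    from f(2)[OF this] g(2)[OF this] w b(3) show False by (auto split: if_splits)
  qed
  have wc: "w \<in> carrier_vec N" "b \<in> carrier_vec N" "b' \<in> carrier_vec N" using w F b Xc by auto
  have ne: "w \<noteq> b" "w \<noteq> b'" using wF b by auto
  define F1 where "F1 = insert w (F - {b})"
  define F2 where "F2 = insert b (F1 - {b'})"
  have F1: "basis N F1" "F1 \<subseteq> X"
    unfolding F1_def using basis_exchange[OF F(1) b(1) f wc(1) w(2)] F w by auto
  have F2_eq: "F2 = insert w (F - {b'})" using b ne by (auto simp: F2_def F1_def)
  have F2: "basis N F2" "F2 \<subseteq> X"
    unfolding F2_eq using basis_exchange[OF F(1) b(2) g wc(1) w(3)] F w by auto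
  have F3_eq: "insert b' (F2 - {w}) = F" using b ne wF by (auto simp: F2_eq)
  have dual_ne: "cip N v h \<noteq> 0" if "basis N (insert v (H - {u}))" "basis N H" "u \<in> H"
     "h \<in> carrier_vec N" "\<And>x. x \<in> H \<Longrightarrow> cip N x h = (if x = u then 1 else 0)" for H u v h
  proof
    assume "cip N v h = 0"
    then have "h = 0\<^sub>v N" using that(5) by (intro basisD(4)[OF that(1) that(4)]) auto
    then show False using that(5)[OF that(3)] by simp
  qed
  have l1: "linked N (nondeg N X) (outer_sum N F c) (outer_sum N F1 (c(w := c b)))"
    unfolding F1_def by (rule linked_exchange[OF F Xc c b(1) f w(1) wF w(2)])
  have b'1: "b' \<in> F1" using b by (auto simp: F1_def)
  obtain f1 where f1: "f1 \<in> carrier_vec N" "\<And>x. x \<in> F1 \<Longrightarrow> cip N x f1 = (if x = b' then 1 else 0)"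
    using basis_dual[OF F1(1) b'1] by blast
  have l2: "linked N (nondeg N X) (outer_sum N F1 (c(w := c b))) (outer_sum N F2 ((c(w := c b))(b := (c(w := c b)) b')))"
    unfolding F2_def
  proof (rule linked_exchange[OF F1 Xc _ b'1 f1])
    show "cip N b f1 \<noteq> 0" using F2(1) unfolding F2_def by (rule dual_ne) (use F1 b'1 f1 in auto)
  qed (use c b F ne in \<open>auto simp: F1_def\<close>)
  have w2: "w \<in> F2" by (auto simp: F2_eq)
  obtain f2 where f2: "f2 \<in> carrier_vec N" "\<And>x. x \<in> F2 \<Longrightarrow> cip N x f2 = (if x = w then 1 else 0)"
    using basis_dual[OF F2(1) w2] by blast
  define c2 where "c2 = (c(w := c b))(b := c b')"
  have l3: "linked N (nondeg N X) (outer_sum N F2 c2) (outer_sum N (insert b' (F2 - {w})) (c2(b' := c2 w)))"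
  proof (rule linked_exchange[OF F2 Xc _ w2 f2])
    show "cip N b' f2 \<noteq> 0" using F(1) by (intro dual_ne[of b' F2 w f2]) (use F3_eq F2 w2 f2 in auto)
  qed (use c b F ne in \<open>auto simp: F2_eq c2_def\<close>)
  have "outer_sum N (insert b' (F2 - {w})) (c2(b' := c2 w)) = outer_sum N F (c(b := c b', b' := c b))"
    unfolding F3_eq using ne wF by (intro outer_sum_cong) (auto simp: c2_def)
  with l1 l2 l3 ne show ?thesis unfolding c2_def by (auto intro: linked_trans)
qed

text \<open>
  Equally many negative weights differ by a sequence of swaps.
\<close>

lemma linked_same_basis:
  assumes X: "generic_family N X" and F: "basis N F" "F \<subseteq> X"
    and "\<And>x. x \<in> F \<Longrightarrow> c x \<noteq> 0" and d: "\<And>x. x \<in> F \<Longrightarrow> d x \<noteq> 0"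
    and "card {x\<in>F. c x < 0} = card {x\<in>F. d x < 0}"
  shows "linked N (nondeg N X) (outer_sum N F c) (outer_sum N F d)"
  using assms(4,6)
proof (induction "card {x\<in>F. c x < 0 \<and> d x > 0}" arbitrary: c rule: less_induct)
  case less
  have fin: "finite F" using basisD(1)[OF F(1)] .
  show ?case
  proof (cases "{x\<in>F. c x < 0 \<and> d x > 0} = {}")
    case True
    have "d x < 0" if "x \<in> F" "c x < 0" for x using d[OF that(1)] True that by force
    then have "{x\<in>F. c x < 0} \<subseteq> {x\<in>F. d x < 0}" by auto
    then have eq: "{x\<in>F. c x < 0} = {x\<in>F. d x < 0}"
      using less.prems(2) fin by (intro card_subset_eq) auto
    have "c x * d x > 0" if x: "x \<in> F" for x
    proof -
      have "c x < 0 \<longleftrightarrow> d x < 0" using eq x by blast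
      with less.prems(1)[OF x] d[OF x] show ?thesis by (auto simp: zero_less_mult_iff)
    qed
    then show ?thesis by (intro linked_rescale F)
  next
    case False
    then obtain b where b: "b \<in> F" "c b < 0" "d b > 0" by auto
    have "\<not> {x\<in>F. d x < 0} \<subseteq> {x\<in>F. c x < 0}"
    proof
      assume "{x\<in>F. d x < 0} \<subseteq> {x\<in>F. c x < 0}"
      then have "{x\<in>F. d x < 0} = {x\<in>F. c x < 0}"
        using less.prems(2) fin by (intro card_subset_eq) auto
      with b show False by force
    qed
    then obtain b' where b': "b' \<in> F" "d b' < 0" "\<not> c b' < 0" by auto
    then have b': "b' \<in> F" "d b' < 0" "c b' > 0" using less.prems(1)[of b'] by auto
    have ne: "b \<noteq> b'" using b b' by auto
    define c' where "c' = c(b := c b', b' := c b)"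
    have l: "linked N (nondeg N X) (outer_sum N F c) (outer_sum N F c')"
      unfolding c'_def using less.prems b b' ne by (intro linked_swap X F) auto
    have "{x\<in>F. c' x < 0} = insert b' ({x\<in>F. c x < 0} - {b})"
      using b b' ne by (auto simp: c'_def)
    moreover have "card (insert b' ({x\<in>F. c x < 0} - {b})) = card {x\<in>F. c x < 0}"
    proof -
      have "card (insert b' ({x\<in>F. c x < 0} - {b})) = Suc (card ({x\<in>F. c x < 0} - {b}))"
        using fin b' by (intro card_insert_disjoint) auto
      also have "\<dots> = card {x\<in>F. c x < 0}" using fin b by (intro card_Suc_Diff1) auto
      finally show ?thesis .
    qed
    ultimately have card: "card {x\<in>F. c' x < 0} = card {x\<in>F. d x < 0}" using less.prems by simp
    have "{x\<in>F. c' x < 0 \<and> d x > 0} \<subset> {x\<in>F. c x < 0 \<and> d x > 0}"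
      using b b' ne by (auto simp: c'_def)
    then have "card {x\<in>F. c' x < 0 \<and> d x > 0} < card {x\<in>F. c x < 0 \<and> d x > 0}"
      using fin by (intro psubset_card_mono) auto
    then have "linked N (nondeg N X) (outer_sum N F c') (outer_sum N F d)"
      using less.prems b b' card by (intro less.hyps) (auto simp: c'_def)
    with l show ?thesis by (rule linked_trans)
  qed
qed

text \<open>
  The Steinitz exchange property in terms of dual vectors. The coordinates of \<open>w\<close> in the basis \<open>F\<close>
  are the numbers \<open>b\<^sup>* y\<close>, where \<open>(\<Sum> x x\<^sup>*) y = w\<close>. If they vanished outside \<open>G\<close>, then \<open>w\<close> would be a
  combination of other elements of \<open>G\<close>.
\<close>

lemma basis_exchange_partner:
  assumes F: "basis N F" and G: "basis N G" and w: "w \<in> G" "w \<notin> F"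
  obtains b f where "b \<in> F - G" "f \<in> carrier_vec N" "\<And>x. x \<in> F \<Longrightarrow> cip N x f = (if x = b then 1 else 0)"
    "cip N w f \<noteq> 0"
proof -
  note F' = basisD[OF F] and G' = basisD[OF G]
  have wc: "w \<in> carrier_vec N" using w G' by auto
  have inv: "invertible_in N (outer_sum N F (\<lambda>_. 1))" by (intro basis_invertible F) auto
  obtain y where y: "y \<in> carrier_vec N" "outer_sum N F (\<lambda>_. 1) *\<^sub>v y = w"
    using invertible_in_solve[OF _ inv wc] by auto
  obtain g where g: "g \<in> carrier_vec N" "\<And>x. x \<in> G \<Longrightarrow> cip N x g = (if x = w then 1 else 0)"
    using basis_dual[OF G w(1)] by blast
  have cipw: "cip N u w = (\<Sum>x\<in>F. cip N u x * cip N x y)" for u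
    using cip_outer_sum[OF y(1), of u F "\<lambda>_. 1"] by (simp add: y(2))
  have "\<exists>b\<in>F - G. cip N b y \<noteq> 0"
  proof (rule ccontr)
    assume *: "\<not> ?thesis"
    have "cip N g w = (\<Sum>x\<in>F. cip N g x * cip N x y)" by (rule cipw)
    also have "\<dots> = 0"
    proof (rule sum.neutral, rule ballI)
      fix x assume x: "x \<in> F"
      show "cip N g x * cip N x y = 0"
      proof (cases "x \<in> G")
        case True
        then have "cip N x g = 0" using g(2)[OF True] w x by auto
        then show ?thesis by (metis cip_cnj complex_cnj_zero mult_zero_left)
      qed (use * x in auto)
    qed
    finally have "cip N w g = 0" by (metis cip_cnj complex_cnj_zero)
    with g(2)[OF w(1)] show False by simp
  qed
  then obtain b where b: "b \<in> F - G" "cip N b y \<noteq> 0" by auto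
  obtain f where f: "f \<in> carrier_vec N" "\<And>x. x \<in> F \<Longrightarrow> cip N x f = (if x = b then 1 else 0)"
    using basis_dual[OF F, of b] b by blast
  have "cip N f w = (\<Sum>x\<in>F. if x = b then cip N x y else 0)"
    unfolding cipw by (intro sum.cong) (auto simp: f(2) cip_cnj[of N _ f, symmetric])
  also have "\<dots> = cip N b y" using b F'(1) by simp
  finally have "cip N w f \<noteq> 0" using b(2) by (metis cip_cnj complex_cnj_zero)
  with b(1) f show ?thesis by (intro that[of b f]) auto
qed

text \<open>
  Each exchange replaces a vector outside \<open>G\<close> by one inside \<open>G\<close> and keeps the number of negative
  weights, until the two bases agree; then swaps put the signs in place.
\<close>

lemma linked_bases:
  assumes X: "generic_family N X" and G: "basis N G" "G \<subseteq> X" and d: "\<And>x. x \<in> G \<Longrightarrow> d x \<noteq> 0"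
    and "basis N F" "F \<subseteq> X" "\<And>x. x \<in> F \<Longrightarrow> c x \<noteq> 0"
    and "card {x\<in>F. c x < 0} = card {x\<in>G. d x < 0}"
  shows "linked N (nondeg N X) (outer_sum N F c) (outer_sum N G d)"
  using assms(5-8)
proof (induction "card (F - G)" arbitrary: F c rule: less_induct)
  case less
  note F' = basisD[OF less.prems(1)] and G' = basisD[OF G(1)]
  show ?case
  proof (cases "G \<subseteq> F")
    case True
    then have "G = F" using F' G' by (intro card_subset_eq) auto
    then have "linked N (nondeg N X) (outer_sum N F c) (outer_sum N F d)"
      by (intro linked_same_basis[OF X less.prems(1,2,3)]) (use d less.prems(4) in auto)
    then show ?thesis unfolding \<open>G = F\<close> .
  next
    case False
    then obtain w where w: "w \<in> G" "w \<notin> F" by auto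
    obtain b f where b: "b \<in> F - G" and f: "f \<in> carrier_vec N"
        "\<And>x. x \<in> F \<Longrightarrow> cip N x f = (if x = b then 1 else 0)" and wf: "cip N w f \<noteq> 0"
      using basis_exchange_partner[OF less.prems(1) G(1) w] by blast
    have Xc: "X \<subseteq> carrier_vec N" using X by (simp add: generic_family_def)
    define F1 where "F1 = insert w (F - {b})"
    define c1 where "c1 = c(w := c b)"
    have l: "linked N (nondeg N X) (outer_sum N F c) (outer_sum N F1 c1)"
      unfolding F1_def c1_def using w G b
      by (intro linked_exchange[OF less.prems(1,2) Xc less.prems(3) _ f _ _ wf]) auto
    have wc: "w \<in> carrier_vec N" using w G' by auto
    have B1: "basis N F1" unfolding F1_def using basis_exchange[OF less.prems(1) _ f wc wf] b by auto
    have "F1 - G \<subset> F - G" using b w by (auto simp: F1_def)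
    then have lt: "card (F1 - G) < card (F - G)" using F'(1) by (intro psubset_card_mono) auto
    have "{x\<in>F1. c1 x < 0} = (if c b < 0 then insert w ({x\<in>F. c x < 0} - {b}) else {x\<in>F. c x < 0})"
      using b w less.prems(3)[of b] by (auto simp: F1_def c1_def)
    moreover have "card (insert w ({x\<in>F. c x < 0} - {b})) = card {x\<in>F. c x < 0}" if "c b < 0"
    proof -
      have "card (insert w ({x\<in>F. c x < 0} - {b})) = Suc (card ({x\<in>F. c x < 0} - {b}))"
        using F' w by (intro card_insert_disjoint) auto
      also have "\<dots> = card {x\<in>F. c x < 0}" using F' b that by (intro card_Suc_Diff1) auto
      finally show ?thesis .
    qed
    ultimately have card: "card {x\<in>F1. c1 x < 0} = card {x\<in>G. d x < 0}" using less.prems(4) by simp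
    have "linked N (nondeg N X) (outer_sum N F1 c1) (outer_sum N G d)"
      using lt B1 card w b G less.prems(2,3) by (intro less.hyps) (auto simp: F1_def c1_def)
    with l show ?thesis by (rule linked_trans)
  qed
qed

section \<open>The negative index of a Hermitian matrix\<close>

text \<open>
  The form of \<open>T\<close> is positive on a subspace of codimension at most \<open>q\<close> and negative on one of
  codimension at most \<open>N - q\<close>. Describing the subspaces as orthogonal complements of finite sets makes
  uniqueness and additivity matters of counting.
\<close>

definition inertia :: "nat \<Rightarrow> complex mat \<Rightarrow> nat \<Rightarrow> bool" where
  "inertia N T q \<longleftrightarrow> q \<le> N \<and>
     (\<exists>A. finite A \<and> card A \<le> q \<and>
        (\<forall>v\<in>carrier_vec N. v \<noteq> 0\<^sub>v N \<longrightarrow> (\<forall>x\<in>A. cip N x v = 0) \<longrightarrow> Re (cip N v (T *\<^sub>v v)) > 0)) \<and>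
     (\<exists>B. finite B \<and> card B \<le> N - q \<and>
        (\<forall>v\<in>carrier_vec N. v \<noteq> 0\<^sub>v N \<longrightarrow> (\<forall>x\<in>B. cip N x v = 0) \<longrightarrow> Re (cip N v (T *\<^sub>v v)) < 0))"

lemma inertiaI:
  assumes "finite A" "card A \<le> q" "finite B" "card B \<le> N - q" "q \<le> N"
    "\<And>v. v \<in> carrier_vec N \<Longrightarrow> v \<noteq> 0\<^sub>v N \<Longrightarrow> (\<And>x. x \<in> A \<Longrightarrow> cip N x v = 0) \<Longrightarrow> Re (cip N v (T *\<^sub>v v)) > 0"
    "\<And>v. v \<in> carrier_vec N \<Longrightarrow> v \<noteq> 0\<^sub>v N \<Longrightarrow> (\<And>x. x \<in> B \<Longrightarrow> cip N x v = 0) \<Longrightarrow> Re (cip N v (T *\<^sub>v v)) < 0"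
  shows "inertia N T q"
  unfolding inertia_def using assms by blast

text \<open>
  If \<open>q < r\<close>, then the positive subspace for \<open>q\<close> and the negative one for \<open>r\<close> have codimensions with sum
  less than \<open>N\<close>, so they have a common nonzero vector.
\<close>

lemma inertia_le:
  assumes "inertia N T q" "inertia N T r"
  shows "r \<le> q"
proof (rule ccontr)
  assume "\<not> r \<le> q"
  obtain A where A: "finite A" "card A \<le> q"
    "\<And>v. v \<in> carrier_vec N \<Longrightarrow> v \<noteq> 0\<^sub>v N \<Longrightarrow> \<forall>x\<in>A. cip N x v = 0 \<Longrightarrow> Re (cip N v (T *\<^sub>v v)) > 0"
    using assms(1) unfolding inertia_def by blast
  obtain B where B: "finite B" "card B \<le> N - r" "r \<le> N"
    "\<And>v. v \<in> carrier_vec N \<Longrightarrow> v \<noteq> 0\<^sub>v N \<Longrightarrow> \<forall>x\<in>B. cip N x v = 0 \<Longrightarrow> Re (cip N v (T *\<^sub>v v)) < 0"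
    using assms(2) unfolding inertia_def by blast
  have "card (A \<union> B) < N" using card_Un_le[of A B] A(2) B(2,3) \<open>\<not> r \<le> q\<close> by linarith
  then obtain v where "v \<in> carrier_vec N" "v \<noteq> 0\<^sub>v N" "\<And>x. x \<in> A \<union> B \<Longrightarrow> cip N x v = 0"
    using exists_orthogonal[of "A \<union> B" N] A B by auto
  then show False using A(3)[of v] B(4)[of v] by auto
qed

lemma inertia_unique: "inertia N T q \<Longrightarrow> inertia N T r \<Longrightarrow> q = r"
  using inertia_le by (metis le_antisym)

text \<open>
  A coercivity estimate without compactness: \<open>v\<close> is recovered from the numbers \<open>x\<^sup>* v\<close> by a fixed matrix,
  so its 1-norm is bounded by a multiple of their sum.
\<close>

lemma basis_form_bound:
  assumes F: "basis N F" and c: "\<And>x. x \<in> F \<Longrightarrow> c x \<noteq> 0"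
  shows "\<exists>\<delta>>0. \<forall>v\<in>carrier_vec N. \<delta> * (\<Sum>i<N. cmod (v $ i))\<^sup>2 \<le> (\<Sum>x\<in>F. \<bar>c x\<bar> * (cmod (cip N x v))\<^sup>2)"
proof -
  note F' = basisD[OF F]
  define d where "d x = \<bar>c x\<bar>" for x
  have d: "d x > 0" if "x \<in> F" for x using c[OF that] by (simp add: d_def)
  have "invertible_in N (outer_sum N F d)" using d by (intro basis_invertible F) (auto simp: less_le)
  then obtain Y where Y: "Y \<in> carrier_mat N N" "Y * outer_sum N F d = 1\<^sub>m N" by (auto simp: invertible_in_def)
  define C where "C = (\<Sum>i<N. \<Sum>j<N. \<Sum>x\<in>F. cmod (Y $$ (i, j)) * (d x * cmod (x $ j)))"
  have C: "C \<ge> 0" unfolding C_def using d by (intro sum_nonneg) (auto intro!: mult_nonneg_nonneg intro: less_imp_le)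
  define \<kappa> where "\<kappa> = Min (insert 1 (d ` F))"
  have \<kappa>: "\<kappa> > 0" "\<And>x. x \<in> F \<Longrightarrow> \<kappa> \<le> d x" using F'(1) d by (auto simp: \<kappa>_def)
  define \<delta> where "\<delta> = \<kappa> / ((C + 1)\<^sup>2 * (real N + 1))"
  have pos: "(C + 1)\<^sup>2 * (real N + 1) > 0" using C by (intro mult_pos_pos) auto
  have "\<delta> > 0" using \<kappa> pos by (simp add: \<delta>_def)
  moreover have "\<delta> * (\<Sum>i<N. cmod (v $ i))\<^sup>2 \<le> (\<Sum>x\<in>F. d x * (cmod (cip N x v))\<^sup>2)" if v: "v \<in> carrier_vec N" for v
  proof -
    define s where "s = (\<Sum>x\<in>F. cmod (cip N x v))"
    have s: "s \<ge> 0" by (auto simp: s_def intro: sum_nonneg)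
    have xs: "cmod (cip N x v) \<le> s" if "x \<in> F" for x
      unfolding s_def using that F'(1) by (intro member_le_sum) auto
    have "cmod (v $ i) \<le> (\<Sum>j<N. \<Sum>x\<in>F. cmod (Y $$ (i, j)) * (d x * cmod (x $ j))) * s" if i: "i < N" for i
    proof -
      have Wv: "outer_sum N F d *\<^sub>v v \<in> carrier_vec N" by (intro carrier_vecI) simp
      have "v = Y *\<^sub>v (outer_sum N F d *\<^sub>v v)" using Y v by (subst assoc_mult_mat_vec[symmetric]) auto
      then have "v $ i = (Y *\<^sub>v (outer_sum N F d *\<^sub>v v)) $ i" by simp
      also have "\<dots> = (\<Sum>j<N. Y $$ (i, j) * (outer_sum N F d *\<^sub>v v) $ j)"
        by (rule mult_mat_vec_index[OF Y(1) Wv i])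
      also have "\<dots> = (\<Sum>j<N. \<Sum>x\<in>F. Y $$ (i, j) * (complex_of_real (d x) * x $ j * cip N x v))"
        using v by (intro sum.cong refl) (auto simp: outer_sum_mult_index sum_distrib_left simp del: index_mult_mat_vec)
      finally have "cmod (v $ i) \<le> (\<Sum>j<N. \<Sum>x\<in>F. cmod (Y $$ (i, j) * (complex_of_real (d x) * x $ j * cip N x v)))"
        by (auto intro!: sum_norm_le)
      also have "\<dots> \<le> (\<Sum>j<N. \<Sum>x\<in>F. cmod (Y $$ (i, j)) * (d x * cmod (x $ j)) * s)"
      proof (intro sum_mono)
        fix j x assume "x \<in> F"
        with d[OF this] xs[OF this] s show "cmod (Y $$ (i, j) * (complex_of_real (d x) * x $ j * cip N x v))
           \<le> cmod (Y $$ (i, j)) * (d x * cmod (x $ j)) * s"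
          by (auto simp: norm_mult mult.assoc intro!: mult_left_mono)
      qed
      finally show ?thesis by (simp add: sum_distrib_right)
    qed
    then have "(\<Sum>i<N. cmod (v $ i)) \<le> C * s"
      unfolding C_def sum_distrib_right[of _ "{..<N}" s] by (intro sum_mono) auto
    also have "\<dots> \<le> (C + 1) * s" using s by (simp add: algebra_simps)
    finally have "(\<Sum>i<N. cmod (v $ i))\<^sup>2 \<le> ((C + 1) * s)\<^sup>2" by (intro power_mono) (auto intro: sum_nonneg)
    also have "\<dots> = (C + 1)\<^sup>2 * s\<^sup>2" by (simp add: power_mult_distrib)
    also have "s\<^sup>2 \<le> real N * (\<Sum>x\<in>F. (cmod (cip N x v))\<^sup>2)"
      using sum_squared_le_sum_of_squares[of "\<lambda>x. cmod (cip N x v)" F] F'(3) by (simp add: s_def mult.commute)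
    also have "\<dots> \<le> (real N + 1) * (\<Sum>x\<in>F. (cmod (cip N x v))\<^sup>2)"
      by (intro mult_right_mono) (auto intro: sum_nonneg)
    finally have 1: "(\<Sum>i<N. cmod (v $ i))\<^sup>2 \<le> ((C + 1)\<^sup>2 * (real N + 1)) * (\<Sum>x\<in>F. (cmod (cip N x v))\<^sup>2)"
      using C by (simp add: mult.assoc mult_left_mono)
    have "\<delta> * (\<Sum>i<N. cmod (v $ i))\<^sup>2 \<le> \<delta> * (((C + 1)\<^sup>2 * (real N + 1)) * (\<Sum>x\<in>F. (cmod (cip N x v))\<^sup>2))"
      using 1 \<open>\<delta> > 0\<close> by (intro mult_left_mono) auto
    also have "\<dots> = \<kappa> * (\<Sum>x\<in>F. (cmod (cip N x v))\<^sup>2)" using pos C by (simp add: \<delta>_def)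
    also have "\<dots> \<le> (\<Sum>x\<in>F. d x * (cmod (cip N x v))\<^sup>2)"
      unfolding sum_distrib_left using \<kappa>(2) by (intro sum_mono mult_right_mono) auto
    finally show ?thesis .
  qed
  ultimately show ?thesis unfolding d_def by blast
qed

lemma form_perturbation:
  assumes T: "T \<in> carrier_mat N N" "S \<in> carrier_mat N N" and v: "v \<in> carrier_vec N"
    and e: "\<And>i j. i < N \<Longrightarrow> j < N \<Longrightarrow> cmod (T $$ (i, j) - S $$ (i, j)) \<le> e"
  shows "\<bar>Re (cip N v (T *\<^sub>v v)) - Re (cip N v (S *\<^sub>v v))\<bar> \<le> e * (\<Sum>i<N. cmod (v $ i))\<^sup>2"
proof -
  have "cip N v (T *\<^sub>v v) - cip N v (S *\<^sub>v v) =
    (\<Sum>i<N. \<Sum>j<N. cnj (v $ i) * (T $$ (i, j) - S $$ (i, j)) * v $ j)"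
    unfolding cip_mult_mat_vec[OF T(1) v] cip_mult_mat_vec[OF T(2) v]
    by (simp add: sum_subtractf[symmetric] algebra_simps)
  also have "cmod \<dots> \<le> (\<Sum>i<N. \<Sum>j<N. cmod (v $ i) * e * cmod (v $ j))"
    by (intro sum_norm_le) (auto simp: norm_mult intro!: mult_right_mono mult_left_mono e)
  also have "\<dots> = e * (\<Sum>i<N. cmod (v $ i))\<^sup>2"
    by (simp add: power2_eq_square sum_product sum_distrib_left mult_ac)
  finally show ?thesis using abs_Re_le_cmod[of "cip N v (T *\<^sub>v v) - cip N v (S *\<^sub>v v)"] by simp
qed

text \<open>
  The index is locally constant: on the orthogonal complement of the vectors of negative weight the form
  of the sum is bounded below by a multiple of the squared norm, which a small perturbation
  cannot destroy, and similarly for the vectors of positive weight.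
\<close>

lemma inertia_near_basis:
  assumes F: "basis N F" and c: "\<And>x. x \<in> F \<Longrightarrow> c x \<noteq> 0"
  shows "\<exists>e>0. \<forall>T\<in>carrier_mat N N. (\<forall>i<N. \<forall>j<N. cmod (T $$ (i, j) - outer_sum N F c $$ (i, j)) \<le> e) \<longrightarrow>
    inertia N T (card {x\<in>F. c x < 0})"
proof -
  note F' = basisD[OF F]
  obtain \<delta> where \<delta>: "\<delta> > 0" "\<And>v. v \<in> carrier_vec N \<Longrightarrow>
     \<delta> * (\<Sum>i<N. cmod (v $ i))\<^sup>2 \<le> (\<Sum>x\<in>F. \<bar>c x\<bar> * (cmod (cip N x v))\<^sup>2)"
    using basis_form_bound[where c = c, OF F c] by blast
  have "inertia N T (card {x\<in>F. c x < 0})" if T: "T \<in> carrier_mat N N"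
    and e: "\<And>i j. i < N \<Longrightarrow> j < N \<Longrightarrow> cmod (T $$ (i, j) - outer_sum N F c $$ (i, j)) \<le> \<delta> / 2" for T
  proof -
    have pert: "\<bar>Re (cip N v (T *\<^sub>v v)) - (\<Sum>x\<in>F. c x * (cmod (cip N x v))\<^sup>2)\<bar> < (\<Sum>x\<in>F. \<bar>c x\<bar> * (cmod (cip N x v))\<^sup>2)"
      if v: "v \<in> carrier_vec N" "v \<noteq> 0\<^sub>v N" for v
    proof -
      obtain i where i: "i < N" "v $ i \<noteq> 0" using v by (metis carrier_vecD eq_vecI index_zero_vec)
      have "0 < cmod (v $ i)" using i by simp
      also have "\<dots> \<le> (\<Sum>i<N. cmod (v $ i))" using i by (intro member_le_sum) auto
      finally have L: "(\<Sum>i<N. cmod (v $ i))\<^sup>2 > 0" by simp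
      have "\<bar>Re (cip N v (T *\<^sub>v v)) - (\<Sum>x\<in>F. c x * (cmod (cip N x v))\<^sup>2)\<bar> \<le> \<delta> / 2 * (\<Sum>i<N. cmod (v $ i))\<^sup>2"
        using form_perturbation[OF T outer_sum_carrier(1) v(1) e] unfolding cip_outer_sum_self[OF v(1)] Re_complex_of_real by simp
      also have "\<dots> < \<delta> * (\<Sum>i<N. cmod (v $ i))\<^sup>2" using L \<delta>(1) by simp
      also note \<delta>(2)[OF v(1)]
      finally show ?thesis .
    qed
    have split: "card {x\<in>F. c x < 0} + card {x\<in>F. c x > 0} = N"
    proof -
      have "F = {x\<in>F. c x < 0} \<union> {x\<in>F. c x > 0}" using c by (auto simp: not_less less_le)
      then have "card F = card ({x\<in>F. c x < 0} \<union> {x\<in>F. c x > 0})" by simp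
      also have "\<dots> = card {x\<in>F. c x < 0} + card {x\<in>F. c x > 0}" using F'(1) by (intro card_Un_disjoint) auto
      finally show ?thesis using F'(3) by simp
    qed
    show ?thesis
    proof (rule inertiaI[of "{x\<in>F. c x < 0}" _ "{x\<in>F. c x > 0}"])
      fix v assume v: "v \<in> carrier_vec N" "v \<noteq> 0\<^sub>v N" "\<And>x. x \<in> {x \<in> F. c x < 0} \<Longrightarrow> cip N x v = 0"
      have "(\<Sum>x\<in>F. c x * (cmod (cip N x v))\<^sup>2) = (\<Sum>x\<in>F. \<bar>c x\<bar> * (cmod (cip N x v))\<^sup>2)"
        using v by (intro sum.cong) (auto simp: abs_if)
      with pert[OF v(1,2)] show "Re (cip N v (T *\<^sub>v v)) > 0" by linarith
    next
      fix v assume v: "v \<in> carrier_vec N" "v \<noteq> 0\<^sub>v N" "\<And>x. x \<in> {x \<in> F. c x > 0} \<Longrightarrow> cip N x v = 0"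
      have "(\<Sum>x\<in>F. c x * (cmod (cip N x v))\<^sup>2) = - (\<Sum>x\<in>F. \<bar>c x\<bar> * (cmod (cip N x v))\<^sup>2)"
        unfolding sum_negf[symmetric] using v c by (intro sum.cong) (auto simp: abs_if not_less less_le)
      with pert[OF v(1,2)] show "Re (cip N v (T *\<^sub>v v)) < 0" by linarith
    qed (use F' split in auto)
  qed
  with \<delta>(1) show ?thesis by (intro exI[of _ "\<delta> / 2"]) auto
qed

lemma inertia_basis:
  assumes F: "basis N F" and c: "\<And>x. x \<in> F \<Longrightarrow> c x \<noteq> 0"
  shows "inertia N (outer_sum N F c) (card {x\<in>F. c x < 0})"
  using inertia_near_basis[where c = c, OF F c] by (auto intro: less_imp_le)

definition hermitian_mat :: "nat \<Rightarrow> complex mat \<Rightarrow> bool" where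
  "hermitian_mat N T \<longleftrightarrow> (\<forall>i<N. \<forall>j<N. T $$ (i, j) = cnj (T $$ (j, i)))"

lemma cip_hermitian:
  assumes T: "T \<in> carrier_mat N N" and h: "hermitian_mat N T"
    and u: "u \<in> carrier_vec N" and v: "v \<in> carrier_vec N"
  shows "cip N (T *\<^sub>v u) v = cip N u (T *\<^sub>v v)"
proof -
  have "cip N (T *\<^sub>v u) v = cnj (cip N v (T *\<^sub>v u))" by (simp add: cip_cnj)
  also have "\<dots> = (\<Sum>i<N. \<Sum>j<N. cnj (u $ j) * cnj (T $$ (i, j)) * v $ i)"
    unfolding cip_mult_mat_vec[OF T u] by (simp add: mult_ac)
  also have "\<dots> = (\<Sum>i<N. \<Sum>j<N. cnj (u $ j) * T $$ (j, i) * v $ i)"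
    proof (intro sum.cong refl)
    fix i j assume "i \<in> {..<N}" "j \<in> {..<N}"
    then have "T $$ (j, i) = cnj (T $$ (i, j))" using h unfolding hermitian_mat_def by blast
    then show "cnj (u $ j) * cnj (T $$ (i, j)) * v $ i = cnj (u $ j) * T $$ (j, i) * v $ i" by simp
  qed
  also have "\<dots> = (\<Sum>j<N. \<Sum>i<N. cnj (u $ j) * T $$ (j, i) * v $ i)" by (rule sum.swap)
  finally show ?thesis unfolding cip_mult_mat_vec[OF T v] .
qed

lemma cip_self_eq_0:
  assumes "v \<in> carrier_vec N" "cip N v v = 0"
  shows "v = 0\<^sub>v N"
proof -
  have "complex_of_real (\<Sum>i<N. (cmod (v $ i))\<^sup>2) = 0"
    using assms(2) by (simp add: cip_def complex_norm_square mult.commute del: of_real_power)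
  then have "(\<Sum>i<N. (cmod (v $ i))\<^sup>2) = 0" unfolding of_real_eq_0_iff .
  then have "v $ i = 0" if "i < N" for i using that by (subst (asm) sum_nonneg_eq_0_iff) auto
  then show ?thesis using assms(1) by (intro eq_vecI) auto
qed

text \<open>
  Lagrange's diagonalization of Hermitian forms, with \<open>K\<close> as a bound for the rank. If
  \<open>a = y\<^sup>* T y\<close> is not 0, then subtracting \<open>T y (T y)\<^sup>* / a\<close> from \<open>T\<close> enlarges the
  kernel by \<open>y\<close>, so that one condition in \<open>K\<close> can be eliminated.
\<close>

lemma hermitian_rank_decomposition:
  assumes "T \<in> carrier_mat N N" and "hermitian_mat N T"
    and "finite K" "K \<subseteq> carrier_vec N" "card K \<le> k"
    and "\<And>v. v \<in> carrier_vec N \<Longrightarrow> \<forall>x\<in>K. cip N x v = 0 \<Longrightarrow> T *\<^sub>v v = 0\<^sub>v N"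
  shows "\<exists>F c. finite F \<and> F \<subseteq> carrier_vec N \<and> card F \<le> k \<and> T = outer_sum N F c"
  using assms
proof (induction k arbitrary: T K)
  case (Suc k T K)
  note T = Suc.prems(1) and h = Suc.prems(2) and K = Suc.prems(3-6)
  have herm: "cip N (T *\<^sub>v u) v = cip N u (T *\<^sub>v v)"
    if "u \<in> carrier_vec N" "v \<in> carrier_vec N" for u v
    by (rule cip_hermitian[OF T h that])
  have Tc: "T *\<^sub>v v \<in> carrier_vec N" for v using T by (intro carrier_vecI) auto
  show ?case
  proof (cases "\<forall>y\<in>carrier_vec N. cip N y (T *\<^sub>v y) = 0")
    case True
    have "T *\<^sub>v w = 0\<^sub>v N" if w: "w \<in> carrier_vec N" for w
    proof -
      \<comment> \<open>the form vanishes at \<open>w\<close>, at \<open>T w\<close> and at \<open>T w + w\<close>, which leaves only \<open>\<parallel>T w\<parallel>\<^sup>2\<close>\<close>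
      define u where "u = T *\<^sub>v w"
      have u: "u \<in> carrier_vec N" by (simp add: u_def Tc)
      have Tu: "T *\<^sub>v u \<in> carrier_vec N" by (rule Tc)
      have "0 = cip N (u + w) (T *\<^sub>v (u + w))" using True u w by auto
      also have "T *\<^sub>v (u + w) = T *\<^sub>v u + u" using T u w by (simp add: mult_add_distrib_mat_vec u_def)
      also have "cip N (u + w) (T *\<^sub>v u + u) = cip N u (T *\<^sub>v u) + cip N w (T *\<^sub>v u) + cip N u u + cip N w u"
        using u w Tu by (simp add: cip_cnj[of N _ "u + w", symmetric] cip_add cip_cnj)
      also have "cip N u (T *\<^sub>v u) = 0" using True u by auto
      also have "cip N w (T *\<^sub>v u) = cip N u u" using herm[OF w u] by (simp add: u_def)
      also have "cip N w u = 0" using True w by (simp add: u_def)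
      finally have "cip N u u = 0" by simp
      with u show ?thesis unfolding u_def by (rule cip_self_eq_0)
    qed
    then have "T $$ (i, j) = 0" if "i < N" "j < N" for i j
    proof -
      have "(T *\<^sub>v unit_vec N j) $ i = 0" using \<open>\<And>w. w \<in> carrier_vec N \<Longrightarrow> T *\<^sub>v w = 0\<^sub>v N\<close>[of "unit_vec N j"] that by simp
      then show ?thesis using T that by simp
    qed
    then have "T = outer_sum N {} (\<lambda>_. 0)" using T by (intro eq_matI) (auto simp: outer_sum_index)
    then show ?thesis by (intro exI[of _ "{}"] exI[of _ "\<lambda>_. 0"]) auto
  next
    case False
    then obtain y where y: "y \<in> carrier_vec N" "cip N y (T *\<^sub>v y) \<noteq> 0" by auto
    define z where "z = T *\<^sub>v y"
    have z: "z \<in> carrier_vec N" by (simp add: z_def Tc)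
    define a where "a = Re (cip N y z)"
    have "cnj (cip N y z) = cip N y z" unfolding cip_cnj using herm[OF y(1) y(1)] by (simp add: z_def)
    then have a: "cip N y z = complex_of_real a" by (simp add: a_def complex_eq_iff)
    then have a0: "a \<noteq> 0" using y(2) by (auto simp: z_def)
    have "\<not> (\<forall>x\<in>K. cip N x y = 0)"
    proof
      assume "\<forall>x\<in>K. cip N x y = 0"
      from K(4)[OF y(1) this] y(2) show False by simp
    qed
    then obtain x0 where x0: "x0 \<in> K" "cip N x0 y \<noteq> 0" by auto
    have x0c: "x0 \<in> carrier_vec N" using x0 K by auto
    define T' where "T' = mat N N (\<lambda>(i, j). T $$ (i, j) - z $ i * cnj (z $ j) / complex_of_real a)"
    have T': "T' \<in> carrier_mat N N" by (simp add: T'_def)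
    have h': "hermitian_mat N T'" unfolding hermitian_mat_def
    proof (intro allI impI)
      fix i j assume ij: "i < N" "j < N"
      then have "T $$ (i, j) = cnj (T $$ (j, i))" using h unfolding hermitian_mat_def by blast
      with ij show "T' $$ (i, j) = cnj (T' $$ (j, i))" by (simp add: T'_def mult.commute)
    qed
    have T'v: "T' *\<^sub>v v = T *\<^sub>v v - (cip N z v / complex_of_real a) \<cdot>\<^sub>v z" if v: "v \<in> carrier_vec N" for v
    proof (rule eq_vecI)
      fix i assume "i < dim_vec (T *\<^sub>v v - (cip N z v / complex_of_real a) \<cdot>\<^sub>v z)"
      then have i: "i < N" using z by simp
      have "(T' *\<^sub>v v) $ i = (\<Sum>j<N. T $$ (i, j) * v $ j - cnj (z $ j) * v $ j / complex_of_real a * z $ i)"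
        using T' v i by (subst mult_mat_vec_index) (auto simp: T'_def algebra_simps intro!: sum.cong)
      also have "\<dots> = (T *\<^sub>v v - (cip N z v / complex_of_real a) \<cdot>\<^sub>v z) $ i"
        using T v i z Tc[of v] mult_mat_vec_index[OF T v i]
        by (simp add: sum_subtractf cip_def sum_distrib_right sum_divide_distrib del: index_mult_mat_vec)
      finally show "(T' *\<^sub>v v) $ i = (T *\<^sub>v v - (cip N z v / complex_of_real a) \<cdot>\<^sub>v z) $ i" .
    qed (use T' z Tc[of v] in auto)
    have T'y: "T' *\<^sub>v y = 0\<^sub>v N"
    proof -
      have "cip N z y = complex_of_real a" using a by (metis cip_cnj complex_cnj_complex_of_real)
      then show ?thesis unfolding T'v[OF y(1)] using a0 z by (intro eq_vecI) (auto simp: z_def[symmetric] simp del: index_mult_mat_vec)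
    qed
    \<comment> \<open>the conditions of \<open>K\<close>, corrected by multiples of \<open>x0\<close> so that \<open>y\<close> satisfies them\<close>
    define K' where "K' = (\<lambda>x. x - cnj (cip N x y / cip N x0 y) \<cdot>\<^sub>v x0) ` (K - {x0})"
    have "card K' \<le> card (K - {x0})" unfolding K'_def using K(1) by (intro card_image_le) auto
    also have "\<dots> \<le> k" using K(1,3) x0(1) by (simp add: card_Diff_singleton)
    finally have cK': "card K' \<le> k" .
    have "T' *\<^sub>v v = 0\<^sub>v N" if v: "v \<in> carrier_vec N" "\<forall>x\<in>K'. cip N x v = 0" for v
    proof -
      define \<mu> where "\<mu> = cip N x0 v / cip N x0 y"
      define v1 where "v1 = v - \<mu> \<cdot>\<^sub>v y"
      have v1: "v1 \<in> carrier_vec N" using v y by (simp add: v1_def)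
      have "cip N x v1 = 0" if x: "x \<in> K" for x
      proof (cases "x = x0")
        case False
        have xc: "x \<in> carrier_vec N" using x K by auto
        have "0 = cip N (x - cnj (cip N x y / cip N x0 y) \<cdot>\<^sub>v x0) v" using v(2) False x by (auto simp: K'_def)
        also have "\<dots> = cip N x v - cip N x y / cip N x0 y * cip N x0 v"
          using xc x0c by (simp add: cip_minus_left cip_smult_left)
        finally show ?thesis using v y by (simp add: v1_def \<mu>_def cip_minus cip_smult)
      qed (use v y x0 in \<open>auto simp: v1_def \<mu>_def cip_minus cip_smult\<close>)
      then have Tv1: "T *\<^sub>v v1 = 0\<^sub>v N" using K(4)[OF v1] by blast
      have "cip N z v1 = 0" using herm[OF y(1) v1] by (simp add: z_def Tv1)
      then have T'v1: "T' *\<^sub>v v1 = 0\<^sub>v N" unfolding T'v[OF v1] Tv1 using z by (intro eq_vecI) auto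
      have "v = v1 + \<mu> \<cdot>\<^sub>v y" using v y by (intro eq_vecI) (auto simp: v1_def)
      then have "T' *\<^sub>v v = T' *\<^sub>v (v1 + \<mu> \<cdot>\<^sub>v y)" by simp
      also have "\<dots> = T' *\<^sub>v v1 + \<mu> \<cdot>\<^sub>v (T' *\<^sub>v y)" using T' v1 y
        by (simp add: mult_add_distrib_mat_vec[of _ N N] mult_mat_vec[of _ N N])
      finally show ?thesis unfolding T'v1 T'y by (auto intro!: eq_vecI)
    qed
    moreover have "K' \<subseteq> carrier_vec N" "finite K'" using K x0c by (auto simp: K'_def)
    ultimately have "\<exists>F c. finite F \<and> F \<subseteq> carrier_vec N \<and> card F \<le> k \<and> T' = outer_sum N F c"
      by (intro Suc.IH[OF T' h' _ _ cK']) blast+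
    then obtain F c where Fc: "finite F" "F \<subseteq> carrier_vec N" "card F \<le> k" "T' = outer_sum N F c" by blast
    define c0 where "c0 = (\<lambda>x. if x \<in> F then c x else 0)"
    have "T = outer_sum N (insert z F) (c0(z := c0 z + 1 / a))"
    proof (rule eq_matI)
      fix i j assume "i < dim_row (outer_sum N (insert z F) (c0(z := c0 z + 1 / a)))" "j < dim_col (outer_sum N (insert z F) (c0(z := c0 z + 1 / a)))"
      then have ij: "i < N" "j < N" by auto
      define r where "r x = x $ i * cnj (x $ j)" for x :: "complex vec"
      have "outer_sum N F c $$ (i, j) = T $$ (i, j) - r z / complex_of_real a"
        using ij unfolding Fc(4)[symmetric] by (simp add: T'_def r_def)
      then have "T $$ (i, j) = (\<Sum>x\<in>F. complex_of_real (c x) * r x) + r z / complex_of_real a"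
        using ij by (simp add: outer_sum_index r_def mult.assoc)
      also have "(\<Sum>x\<in>F. complex_of_real (c x) * r x) = (\<Sum>x\<in>F. complex_of_real (c0 x) * r x)"
        by (intro sum.cong) (auto simp: c0_def)
      also have "\<dots> = (\<Sum>x\<in>insert z F. complex_of_real (c0 x) * r x)"
        using Fc(1) by (intro sum.mono_neutral_left) (auto simp: c0_def)
      also have "\<dots> = complex_of_real (c0 z) * r z + (\<Sum>x\<in>insert z F - {z}. complex_of_real (c0 x) * r x)"
        using Fc(1) by (intro sum.remove) auto
      also have "(\<Sum>x\<in>insert z F - {z}. complex_of_real (c0 x) * r x) =
         (\<Sum>x\<in>insert z F - {z}. complex_of_real ((c0(z := c0 z + 1 / a)) x) * r x)"
        by (intro sum.cong) auto
      also have "complex_of_real (c0 z) * r z + \<dots> + r z / complex_of_real a =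
          (\<Sum>x\<in>insert z F. complex_of_real ((c0(z := c0 z + 1 / a)) x) * r x)"
        using Fc(1) by (subst sum.remove[of "insert z F" z]) (auto simp: algebra_simps)
      finally show "T $$ (i, j) = outer_sum N (insert z F) (c0(z := c0 z + 1 / a)) $$ (i, j)"
        using ij by (simp add: outer_sum_index r_def mult.assoc)
    qed (use T in auto)
    moreover have "card (insert z F) \<le> Suc k" using Fc(1,3) by (simp add: card_insert_if)
    moreover have "finite (insert z F)" "insert z F \<subseteq> carrier_vec N" using Fc(1,2) z by auto
    ultimately show ?thesis by (intro exI conjI) assumption+
  qed
next
  case (0 T K)
  then have K: "K = {}" by simp
  have "T $$ (i, j) = 0" if "i < N" "j < N" for i j
  proof -
    have "(T *\<^sub>v unit_vec N j) $ i = 0" using 0(6)[of "unit_vec N j"] that K by simp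
    then show ?thesis using 0(1) that by simp
  qed
  then have "T = outer_sum N {} (\<lambda>_. 0)" using 0(1) by (intro eq_matI) (auto simp: outer_sum_index)
  then show ?case by (intro exI[of _ "{}"] exI[of _ "\<lambda>_. 0"]) auto
qed

lemma nondeg_mono: "X \<subseteq> Y \<Longrightarrow> nondeg N X \<subseteq> nondeg N Y"
  unfolding nondeg_def by blast

lemma outer_sum_hermitian: "hermitian_mat N (outer_sum N F c)"
  unfolding hermitian_mat_def by (auto simp: outer_sum_index mult_ac intro!: sum.cong)

lemma orthogonal_unit_vecs:
  assumes v: "v \<in> carrier_vec N" "\<And>x. x \<in> unit_vec N ` {..<N} \<Longrightarrow> cip N x v = 0"
  shows "v = 0\<^sub>v N"
proof -
  have "v $ i = 0" if i: "i < N" for i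
  proof -
    have "0 = cip N (unit_vec N i) v" using v(2) i by auto
    also have "\<dots> = (\<Sum>j<N. if j = i then v $ j else 0)"
      unfolding cip_def using i by (intro sum.cong) (auto simp: unit_vec_def)
    finally show ?thesis using i by simp
  qed
  then show ?thesis using v by (intro eq_vecI) auto
qed

lemma hermitian_is_outer_sum:
  assumes T: "T \<in> carrier_mat N N" and h: "hermitian_mat N T"
  shows "\<exists>F c. finite F \<and> F \<subseteq> carrier_vec N \<and> card F \<le> N \<and> T = outer_sum N F c"
proof (rule hermitian_rank_decomposition[OF T, of "unit_vec N ` {..<N}"])
  show "card (unit_vec N ` {..<N} :: complex vec set) \<le> N" using card_image_le[of "{..<N}" "unit_vec N"] by simp
  fix v :: "complex vec" assume v: "v \<in> carrier_vec N" "\<forall>x\<in>unit_vec N ` {..<N}. cip N x v = 0"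
  then have "v = 0\<^sub>v N" by (intro orthogonal_unit_vecs) auto
  then show "T *\<^sub>v v = 0\<^sub>v N" using T by (intro eq_vecI) (auto simp: scalar_prod_def)
qed (use h in auto)

lemma nondeg_full:
  "nondeg N (carrier_vec N) =
     {T \<in> carrier_mat N N. hermitian_mat N T \<and> invertible_in N T}"
proof (intro equalityI subsetI)
  fix T assume "T \<in> nondeg N (carrier_vec N)"
  then obtain F c where "T = outer_sum N F c" "invertible_in N T" by (auto simp: nondeg_def)
  then show "T \<in> {T \<in> carrier_mat N N. hermitian_mat N T \<and> invertible_in N T}"
    using outer_sum_hermitian by auto
next
  fix T assume T: "T \<in> {T \<in> carrier_mat N N. hermitian_mat N T \<and> invertible_in N T}"
  then obtain F c where "finite F" "F \<subseteq> carrier_vec N" "T = outer_sum N F c" using hermitian_is_outer_sum[of T N] by blast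
  with T show "T \<in> nondeg N (carrier_vec N)" by (auto intro: nondegI)
qed

text \<open>
  Here \<open>T\<close> itself, and not only a matrix in its path component, is a combination of a basis. This
  makes the index available at every point of a path.
\<close>

lemma nondeg_full_basis:
  assumes "T \<in> nondeg N (carrier_vec N)"
  obtains F c where "basis N F" "\<And>x. x \<in> F \<Longrightarrow> c x \<noteq> 0" "T = outer_sum N F c"
proof -
  have T: "T \<in> carrier_mat N N" "hermitian_mat N T" "invertible_in N T"
    using assms unfolding nondeg_full by auto
  obtain F c where F: "finite F" "F \<subseteq> carrier_vec N" "card F \<le> N" and Tc: "T = outer_sum N F c"
    using hermitian_is_outer_sum[OF T(1,2)] by blast
  have "basis N F" "\<And>x. x \<in> F \<Longrightarrow> c x \<noteq> 0"
    using invertible_in_card_le_basis[OF F] T(3) unfolding Tc by blast+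
  then show ?thesis using Tc by (rule that)
qed

definition neg_index :: "nat \<Rightarrow> complex mat \<Rightarrow> nat" where
  "neg_index N T = (THE q. inertia N T q)"

lemma neg_index_eq: "inertia N T q \<Longrightarrow> neg_index N T = q"
  unfolding neg_index_def using inertia_unique by blast

lemma neg_index_basis:
  assumes F: "basis N F" and c: "\<And>x. x \<in> F \<Longrightarrow> c x \<noteq> 0"
  shows "neg_index N (outer_sum N F c) = card {x\<in>F. c x < 0}"
  by (rule neg_index_eq[OF inertia_basis[OF F]]) (rule c)

lemma inertia_neg_index:
  assumes "T \<in> nondeg N (carrier_vec N)"
  shows "inertia N T (neg_index N T)"
proof -
  obtain F c where *: "basis N F" "\<And>x. x \<in> F \<Longrightarrow> c x \<noteq> 0" "T = outer_sum N F c"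
    using nondeg_full_basis[OF assms] by blast
  have "inertia N T (card {x\<in>F. c x < 0})" unfolding *(3) using *(1,2) by (rule inertia_basis)
  then show ?thesis using neg_index_eq by metis
qed

text \<open>
  Along a path the index is locally constant, and the unit interval is connected.
\<close>

lemma linked_neg_index:
  assumes "linked N (nondeg N (carrier_vec N)) T T'"
  shows "neg_index N T = neg_index N T'"
proof -
  obtain g where g: "pathin (subtopology (mat_topology N) (nondeg N (carrier_vec N))) g" "g 0 = T" "g 1 = T'"
    using assms unfolding linked_def path_component_of_def by blast
  have mem: "g t \<in> nondeg N (carrier_vec N)" if "t \<in> {0..1}" for t
    using g(1) that unfolding pathin_def continuous_map_in_subtopology by auto
  have cont: "continuous_on {0..1} (\<lambda>t. g t $$ (i, j))" if "i < N" "j < N" for i j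
    using g(1) that unfolding pathin_def continuous_map_in_subtopology continuous_map_mat_topology_iff
    by (simp add: continuous_map_iff_continuous)
  have "neg_index N (g 0) = neg_index N (g 1)"
  proof (rule connected_local_const[of "{0..1::real}"])
    show "\<forall>a\<in>{0..1}. \<forall>\<^sub>F b in at a within {0..1}. neg_index N (g a) = neg_index N (g b)"
    proof
      fix a :: real assume a: "a \<in> {0..1}"
      obtain F c where F: "basis N F" "\<And>x. x \<in> F \<Longrightarrow> c x \<noteq> 0" "g a = outer_sum N F c"
        using nondeg_full_basis[OF mem[OF a]] by blast
      obtain e where e: "e > 0" "\<And>T. T \<in> carrier_mat N N \<Longrightarrow>
          (\<forall>i<N. \<forall>j<N. cmod (T $$ (i, j) - g a $$ (i, j)) \<le> e) \<Longrightarrow> inertia N T (card {x\<in>F. c x < 0})"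
        using inertia_near_basis[where c = c, OF F(1,2)] unfolding F(3) by blast
      have ev: "\<forall>\<^sub>F b in at a within {0..1}. \<forall>i\<in>{..<N}. \<forall>j\<in>{..<N}. cmod (g b $$ (i, j) - g a $$ (i, j)) < e"
      proof (intro eventually_ball_finite ballI)
        fix i j assume "i \<in> {..<N}" "j \<in> {..<N}"
        then have "((\<lambda>t. g t $$ (i, j)) \<longlongrightarrow> g a $$ (i, j)) (at a within {0..1})"
          using cont a by (auto simp: continuous_on_def)
        from tendstoD[OF this e(1)] show "\<forall>\<^sub>F b in at a within {0..1}. cmod (g b $$ (i, j) - g a $$ (i, j)) < e"
          by (simp add: dist_norm)
      qed auto
      have "\<forall>\<^sub>F b in at a within {0..1}. b \<in> {0..1}" by (simp add: eventually_at_filter)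
      with ev show "\<forall>\<^sub>F b in at a within {0..1}. neg_index N (g a) = neg_index N (g b)"
      proof eventually_elim
        case (elim b)
        have gb: "g b \<in> carrier_mat N N" using mem[OF elim(2)] nondeg_carrier by blast
        have ga: "g a \<in> carrier_mat N N" unfolding F(3) by simp
        have "inertia N (g b) (card {x\<in>F. c x < 0})" using elim by (intro e(2)[OF gb]) (auto intro: less_imp_le)
        moreover have "inertia N (g a) (card {x\<in>F. c x < 0})" using e(1) by (intro e(2)[OF ga]) auto
        ultimately show ?case by (simp add: neg_index_eq)
      qed
    qed
  qed auto
  then show ?thesis by (simp add: g)
qed

lemma linked_subset: "linked N S T T' \<Longrightarrow> S \<subseteq> S' \<Longrightarrow> linked N S' T T'"
  unfolding linked_def by (rule path_component_of_mono)

lemma linked_to_basis: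
  assumes T: "T \<in> nondeg N X" and X: "X \<subseteq> carrier_vec N"
  obtains F c where "basis N F" "F \<subseteq> X" "\<And>x. x \<in> F \<Longrightarrow> c x \<noteq> 0" "linked N (nondeg N X) T (outer_sum N F c)"
proof -
  obtain F0 c0 where F0: "finite F0" "F0 \<subseteq> X" "T = outer_sum N F0 c0" "invertible_in N (outer_sum N F0 c0)"
    using T by (auto simp: nondeg_def)
  obtain F c where F: "finite F" "F \<subseteq> X" "card F \<le> N" "linked N (nondeg N X) T (outer_sum N F c)"
    using linked_card_le[OF F0(1,2) X F0(4)] unfolding F0(3) by blast
  have Fc: "F \<subseteq> carrier_vec N" using F X by auto
  have inv: "invertible_in N (outer_sum N F c)" using linked_mem(2)[OF F(4)] by (auto simp: nondeg_def)
  show ?thesis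
    using that[of F c] invertible_in_card_le_basis[OF F(1) Fc F(3) inv] F by blast
qed

text \<open>
  The classification of path components. Applied to all vectors and to the Toeplitz family it treats
  both spaces of the theorem at once.
\<close>

theorem linked_iff_neg_index:
  assumes X: "generic_family N X" and T: "T \<in> nondeg N X" "T' \<in> nondeg N X"
  shows "linked N (nondeg N X) T T' \<longleftrightarrow> neg_index N T = neg_index N T'"
proof
  have Xc: "X \<subseteq> carrier_vec N" using X by (simp add: generic_family_def)
  note mono = nondeg_mono[OF Xc, of N]
  show "neg_index N T = neg_index N T'" if "linked N (nondeg N X) T T'"
    using linked_neg_index linked_subset[OF that mono] by blast
  assume eq: "neg_index N T = neg_index N T'"
  obtain F c where F: "basis N F" "F \<subseteq> X" "\<And>x. x \<in> F \<Longrightarrow> c x \<noteq> 0" "linked N (nondeg N X) T (outer_sum N F c)"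
    using linked_to_basis[OF T(1) Xc] by blast
  obtain G d where G: "basis N G" "G \<subseteq> X" "\<And>x. x \<in> G \<Longrightarrow> d x \<noteq> 0" "linked N (nondeg N X) T' (outer_sum N G d)"
    using linked_to_basis[OF T(2) Xc] by blast
  have "card {x\<in>F. c x < 0} = neg_index N (outer_sum N F c)" using neg_index_basis[where c = c, OF F(1,3)] by simp
  also have "\<dots> = neg_index N T" using linked_neg_index[OF linked_subset[OF F(4) mono]] by simp
  also have "\<dots> = neg_index N (outer_sum N G d)" using linked_neg_index[OF linked_subset[OF G(4) mono]] eq by simp
  also have "\<dots> = card {x\<in>G. d x < 0}" using neg_index_basis[where c = d, OF G(1,3)] by simp
  finally have "linked N (nondeg N X) (outer_sum N F c) (outer_sum N G d)"
    by (intro linked_bases[OF X G(1,2) _ F(1,2)] F(3) G(3))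
  with F(4) G(4) show "linked N (nondeg N X) T T'" by (meson linked_trans linked_sym)
qed

lemma exists_neg_index:
  assumes X: "generic_family N X" and T: "T \<in> nondeg N X" and q: "q \<le> N"
  shows "\<exists>T'\<in>nondeg N X. neg_index N T' = q"
proof -
  have Xc: "X \<subseteq> carrier_vec N" using X by (simp add: generic_family_def)
  obtain F c where F: "basis N F" "F \<subseteq> X" using linked_to_basis[OF T Xc] by blast
  note F' = basisD[OF F(1)]
  obtain A where A: "A \<subseteq> F" "card A = q" using F' q obtain_subset_with_card_n by metis
  define d :: "complex vec \<Rightarrow> real" where "d x = (if x \<in> A then -1 else 1)" for x
  have d: "d x \<noteq> 0" for x by (simp add: d_def)
  have "{x\<in>F. d x < 0} = A" using A by (auto simp: d_def)
  then have "neg_index N (outer_sum N F d) = q" using neg_index_basis[of N F d, OF F(1) d] A by simp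
  moreover have "outer_sum N F d \<in> nondeg N X" using F F' d by (intro nondegI basis_invertible) auto
  ultimately show ?thesis by blast
qed

section \<open>Block Toeplitz matrices\<close>

definition block_vec :: "nat \<Rightarrow> nat \<Rightarrow> complex \<Rightarrow> (nat \<Rightarrow> complex) \<Rightarrow> complex vec" where
  "block_vec n m z \<xi> = vec (m * n) (\<lambda>k. \<xi> (k div n) * z ^ (k mod n))"

text \<open>
  These are the vectors \<open>\<xi> \<otimes> (1, z, \<dots>, z\<^sup>n\<^sup>-\<^sup>1)\<close>. On the unit circle the conjugate of \<open>z\<close> is its inverse,
  so the associated rank-one matrices have Toeplitz blocks \<open>\<xi>\<^sub>a \<xi>\<^sub>b\<^sup>* z\<^sup>i\<^sup>-\<^sup>j\<close>.
\<close>

definition toeplitz_family :: "nat \<Rightarrow> nat \<Rightarrow> complex vec set" where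
  "toeplitz_family n m = {block_vec n m z \<xi> | z \<xi>. cmod z = 1}"

lemma block_index_less: "a < m \<Longrightarrow> i < n \<Longrightarrow> a * n + i < m * (n::nat)"
proof -
  assume "a < m" "i < n"
  then have "a * n + i < Suc a * n" by simp
  also have "\<dots> \<le> m * n" using \<open>a < m\<close> by (intro mult_right_mono) auto
  finally show ?thesis .
qed

lemma block_index_cases:
  assumes "k < m * (n::nat)"
  obtains a i where "a < m" "i < n" "k = a * n + i"
proof -
  have "n > 0" using assms by (cases n) auto
  then show ?thesis using assms that[of "k div n" "k mod n"] by (simp add: less_mult_imp_div_less)
qed

lemma block_vec_index: "a < m \<Longrightarrow> i < n \<Longrightarrow> block_vec n m z \<xi> $ (a * n + i) = \<xi> a * z ^ i"
  by (simp add: block_vec_def block_index_less)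

lemma block_vec_carrier [simp]: "block_vec n m z \<xi> \<in> carrier_vec (m * n)"
  by (simp add: block_vec_def)

lemma toeplitz_family_carrier: "toeplitz_family n m \<subseteq> carrier_vec (m * n)"
  by (auto simp: toeplitz_family_def)

lemma mat_over_toeplitz_iff:
  "T \<in> mat_over n m (toeplitz n) \<longleftrightarrow> T \<in> carrier_mat (m * n) (m * n) \<and>
     (\<exists>t. \<forall>a<m. \<forall>b<m. \<forall>i<n. \<forall>j<n. T $$ (a * n + i, b * n + j) = t a b (int i - int j))"
proof -
  have "(\<forall>a<m. \<forall>b<m. mat_block n T a b \<in> toeplitz n) \<longleftrightarrow>
    (\<forall>a b. a < m \<longrightarrow> b < m \<longrightarrow> (\<exists>t. \<forall>i<n. \<forall>j<n. T $$ (a * n + i, b * n + j) = t (int i - int j)))"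
    by (auto simp: toeplitz_def mat_block_def)
  also have "\<dots> \<longleftrightarrow> (\<forall>a b. \<exists>t. a < m \<longrightarrow> b < m \<longrightarrow> (\<forall>i<n. \<forall>j<n. T $$ (a * n + i, b * n + j) = t (int i - int j)))"
    by simp
  also have "\<dots> \<longleftrightarrow> (\<exists>t. \<forall>a b. a < m \<longrightarrow> b < m \<longrightarrow> (\<forall>i<n. \<forall>j<n. T $$ (a * n + i, b * n + j) = t a b (int i - int j)))"
    unfolding choice_iff ..
  finally show ?thesis by (auto simp: mat_over_def)
qed

lemma unit_power_cnj:
  assumes "cmod z = 1"
  shows "z ^ i * cnj (z ^ j) = z powi (int i - int j)"
proof -
  have "z \<noteq> 0" using assms by auto
  have "z * cnj z = 1" using assms by (simp add: complex_norm_square[symmetric])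
  then have "cnj z = inverse z" by (simp add: inverse_unique)
  then show ?thesis using \<open>z \<noteq> 0\<close> by (simp add: power_int_diff divide_inverse power_inverse)
qed

lemma outer_sum_family_toeplitz:
  assumes "F \<subseteq> toeplitz_family n m"
  shows "outer_sum (m * n) F c \<in> mat_over n m (toeplitz n)"
proof -
  have "\<exists>z \<xi>. x = block_vec n m z \<xi> \<and> cmod z = 1" if "x \<in> F" for x
    using assms that by (auto simp: toeplitz_family_def)
  then obtain z \<xi> where z: "\<And>x. x \<in> F \<Longrightarrow> x = block_vec n m (z x) (\<xi> x)" "\<And>x. x \<in> F \<Longrightarrow> cmod (z x) = 1"
    by metis
  define t where "t a b k = (\<Sum>x\<in>F. complex_of_real (c x) * \<xi> x a * cnj (\<xi> x b) * z x powi k)" for a b k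
  have "outer_sum (m * n) F c $$ (a * n + i, b * n + j) = t a b (int i - int j)"
    if *: "a < m" "b < m" "i < n" "j < n" for a b i j
  proof -
    have "complex_of_real (c x) * x $ (a * n + i) * cnj (x $ (b * n + j)) =
       complex_of_real (c x) * \<xi> x a * cnj (\<xi> x b) * z x powi (int i - int j)" if "x \<in> F" for x
    proof -
      have "x $ (a * n + i) = \<xi> x a * z x ^ i" "x $ (b * n + j) = \<xi> x b * z x ^ j"
        using z(1)[OF that] block_vec_index * by metis+
      then show ?thesis unfolding unit_power_cnj[OF z(2)[OF that], symmetric] by simp
    qed
    then have "(\<Sum>x\<in>F. complex_of_real (c x) * x $ (a * n + i) * cnj (x $ (b * n + j))) = t a b (int i - int j)"
      unfolding t_def by (rule sum.cong[OF refl])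
    then show ?thesis using * by (simp add: outer_sum_index block_index_less)
  qed
  then show ?thesis unfolding mat_over_toeplitz_iff by (intro conjI exI[of _ t]) auto
qed

definition real_span :: "nat \<Rightarrow> complex vec set \<Rightarrow> complex mat set" where
  "real_span N X = {outer_sum N F c | F c. finite F \<and> F \<subseteq> X}"

lemma real_span_lincomb:
  assumes "S \<in> real_span N X" "T \<in> real_span N X"
  shows "mat N N (\<lambda>p. complex_of_real r * S $$ p + complex_of_real s * T $$ p) \<in> real_span N X"
proof -
  obtain F c where F: "finite F" "F \<subseteq> X" "S = outer_sum N F c" using assms(1) by (auto simp: real_span_def)
  obtain G d where G: "finite G" "G \<subseteq> X" "T = outer_sum N G d" using assms(2) by (auto simp: real_span_def)
  define c' where "c' x = (if x \<in> F then c x else 0)" for x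
  define d' where "d' x = (if x \<in> G then d x else 0)" for x
  have "outer_sum N F c = outer_sum N F c'" by (intro outer_sum_cong) (auto simp: c'_def)
  also have "\<dots> = outer_sum N (F \<union> G) c'" using F G by (intro outer_sum_mono_neutral) (auto simp: c'_def)
  finally have S: "S = outer_sum N (F \<union> G) c'" using F by simp
  have "outer_sum N G d = outer_sum N G d'" by (intro outer_sum_cong) (auto simp: d'_def)
  also have "\<dots> = outer_sum N (F \<union> G) d'" using F G by (intro outer_sum_mono_neutral) (auto simp: d'_def)
  finally have T: "T = outer_sum N (F \<union> G) d'" using G by simp
  have "mat N N (\<lambda>p. complex_of_real r * S $$ p + complex_of_real s * T $$ p) = outer_sum N (F \<union> G) (\<lambda>x. r * c' x + s * d' x)"
    unfolding S T by (intro eq_matI) (auto simp: outer_sum_index distrib_right sum.distrib sum_distrib_left mult.assoc)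
  then show ?thesis using F G unfolding real_span_def by blast
qed

lemma real_span_sum:
  assumes "finite I" "\<And>k. k \<in> I \<Longrightarrow> mat N N (f k) \<in> real_span N X"
  shows "mat N N (\<lambda>p. \<Sum>k\<in>I. f k p) \<in> real_span N X"
  using assms
proof (induction I rule: finite_induct)
  case empty
  have "mat N N (\<lambda>p. \<Sum>k\<in>{}. f k p) = outer_sum N {} (\<lambda>_. 0)" by (intro eq_matI) (auto simp: outer_sum_index)
  then show ?case unfolding real_span_def by blast
next
  case (insert k I)
  have "mat N N (\<lambda>p. complex_of_real 1 * mat N N (f k) $$ p + complex_of_real 1 * mat N N (\<lambda>p. \<Sum>k\<in>I. f k p) $$ p) \<in> real_span N X"
    using insert by (intro real_span_lincomb) auto
  also have "mat N N (\<lambda>p. complex_of_real 1 * mat N N (f k) $$ p + complex_of_real 1 * mat N N (\<lambda>p. \<Sum>k\<in>I. f k p) $$ p)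
     = mat N N (\<lambda>p. \<Sum>k\<in>insert k I. f k p)"
    using insert by (intro eq_matI) auto
  finally show ?case .
qed

lemma real_span_rank_one: "x \<in> X \<Longrightarrow> mat N N (\<lambda>(i, j). x $ i * cnj (x $ j)) \<in> real_span N X"
proof -
  assume "x \<in> X"
  moreover have "mat N N (\<lambda>(i, j). x $ i * cnj (x $ j)) = outer_sum N {x} (\<lambda>_. 1)" by (intro eq_matI) (auto simp: outer_sum_index)
  ultimately show ?thesis unfolding real_span_def by blast
qed

text \<open>
  The matrix is \<open>(x + y) (x + y)\<^sup>* - x x\<^sup>* - y y\<^sup>*\<close>.
\<close>

lemma real_span_polarize:
  assumes "x \<in> X" "y \<in> X" "x + y \<in> X" "X \<subseteq> carrier_vec N"
  shows "mat N N (\<lambda>(i, j). x $ i * cnj (y $ j) + y $ i * cnj (x $ j)) \<in> real_span N X"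
proof -
  let ?R = "\<lambda>x. mat N N (\<lambda>(i, j). x $ i * cnj (x $ j))"
  have "mat N N (\<lambda>p. complex_of_real 1 * ?R (x + y) $$ p + complex_of_real (-1) *
     mat N N (\<lambda>p. complex_of_real 1 * ?R x $$ p + complex_of_real 1 * ?R y $$ p) $$ p) \<in> real_span N X"
    by (intro real_span_lincomb real_span_rank_one assms)
  also have "mat N N (\<lambda>p. complex_of_real 1 * ?R (x + y) $$ p + complex_of_real (-1) *
     mat N N (\<lambda>p. complex_of_real 1 * ?R x $$ p + complex_of_real 1 * ?R y $$ p) $$ p) =
     mat N N (\<lambda>(i, j). x $ i * cnj (y $ j) + y $ i * cnj (x $ j))"
    using assms by (intro eq_matI) (auto simp: algebra_simps)
  finally show ?thesis .
qed

lemma sum_roots_of_unity: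
  fixes d :: int and L :: nat
  assumes "\<bar>d\<bar> < int L"
  shows "(\<Sum>l<L. cis (2 * pi * real l * of_int d / real L)) = (if d = 0 then of_nat L else 0)"
proof (cases "d = 0")
  case False
  define q where "q = cis (2 * pi * of_int d / real L)"
  have L: "L > 0" using assms by auto
  have "q \<noteq> 1"
  proof
    assume "q = 1"
    then have "cos (2 * pi * of_int d / real L) = 1" unfolding q_def by (metis Re_complex_of_real cis.sel(1) of_real_1)
    then obtain k :: int where "2 * pi * of_int d / real L = of_int k * 2 * pi" using cos_one_2pi_int by blast
    then have "of_int d = real L * of_int k" using L by (simp add: field_simps)
    then have "of_int d = (of_int (int L * k) :: real)" by simp
    then have "d = int L * k" by (simp only: of_int_eq_iff)
    with False have "k \<noteq> 0" by auto
    then have "int L * 1 \<le> int L * \<bar>k\<bar>" by (intro mult_left_mono) auto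
    then have "int L \<le> \<bar>d\<bar>" using \<open>d = _\<close> by (simp add: abs_mult)
    with assms show False by simp
  qed
  have "(\<Sum>l<L. cis (2 * pi * real l * of_int d / real L)) = (\<Sum>l<L. q ^ l)"
    unfolding q_def Complex.DeMoivre by (intro sum.cong refl arg_cong[of _ _ cis]) (simp add: field_simps)
  also have "\<dots> = (q ^ L - 1) / (q - 1)" using \<open>q \<noteq> 1\<close> by (rule geometric_sum)
  also have "q ^ L = cis (2 * pi * of_int d)" unfolding q_def Complex.DeMoivre using L by simp
  also have "\<dots> = 1" by (rule cis_multiple_2pi) simp
  finally show ?thesis using False by simp
qed auto

text \<open>
  Fourier inversion on the cyclic group of order \<open>2 n\<close>. Indices in the range from \<open>1 - n\<close> to \<open>n - 1\<close>
  are pairwise incongruent modulo \<open>2 n\<close>.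
\<close>

lemma fourier_coefficients:
  fixes t :: "int \<Rightarrow> complex" and n :: nat
  assumes "n \<ge> 1"
  shows "\<exists>h. \<forall>k. \<bar>k\<bar> < int n \<longrightarrow>
    (\<Sum>l<2 * n. h l * cis (2 * pi * real l * of_int k / real (2 * n))) = t k"
proof -
  define L where "L = 2 * n"
  define K where "K = {- int n<..<int n}"
  define h where "h l = (\<Sum>k\<in>K. t k * cis (- (2 * pi * real l * of_int k / real L))) / of_nat L" for l
  have "(\<Sum>l<L. h l * cis (2 * pi * real l * of_int k / real L)) = t k" if k: "\<bar>k\<bar> < int n" for k
  proof -
    have "(\<Sum>l<L. h l * cis (2 * pi * real l * of_int k / real L)) =
      (\<Sum>l<L. \<Sum>k'\<in>K. t k' / of_nat L * cis (2 * pi * real l * of_int (k - k') / real L))"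
    proof (intro sum.cong refl)
      fix l
      have "cis (- (2 * pi * real l * of_int k' / real L)) * cis (2 * pi * real l * of_int k / real L)
         = cis (2 * pi * real l * of_int (k - k') / real L)" for k'
        unfolding cis_mult by (intro arg_cong[of _ _ cis]) (simp add: field_simps diff_divide_distrib)
      then show "h l * cis (2 * pi * real l * of_int k / real L) =
        (\<Sum>k'\<in>K. t k' / of_nat L * cis (2 * pi * real l * of_int (k - k') / real L))"
        by (simp add: h_def sum_divide_distrib sum_distrib_right mult.assoc)
    qed
    also have "\<dots> = (\<Sum>k'\<in>K. \<Sum>l<L. t k' / of_nat L * cis (2 * pi * real l * of_int (k - k') / real L))"
      by (rule sum.swap)
    also have "\<dots> = (\<Sum>k'\<in>K. t k' / of_nat L * (if k - k' = 0 then of_nat L else 0))"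
      unfolding sum_distrib_left[symmetric]
      using k by (intro sum.cong refl arg_cong2[of _ _ _ _ "(*)"] sum_roots_of_unity) (auto simp: K_def L_def)
    also have "\<dots> = (\<Sum>k'\<in>K. if k' = k then t k' else 0)" using assms by (intro sum.cong) (auto simp: L_def)
    also have "\<dots> = t k" using k by (auto simp: K_def)
    finally show ?thesis .
  qed
  then show ?thesis unfolding L_def by blast
qed

text \<open>
  Fourier inversion writes \<open>T\<close> as a sum of blocks \<open>g\<^sub>a\<^sub>b(l) z\<^sub>l\<^sup>i\<^sup>-\<^sup>j\<close> over roots of unity \<open>z\<^sub>l\<close>. Each
  summand, made self-adjoint by adding its adjoint, is a polarized rank-one matrix of the family. Since
  \<open>T\<close> is self-adjoint, the resulting sum is \<open>2 T\<close>.
\<close>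

lemma hermitian_toeplitz_span:
  assumes n: "n \<ge> 1" and T: "T \<in> mat_over n m (toeplitz n)" and h: "hermitian_mat (m * n) T"
  shows "T \<in> real_span (m * n) (toeplitz_family n m)"
proof -
  define N where "N = m * n"
  define L where "L = 2 * n"
  define X where "X = toeplitz_family n m"
  obtain t where t: "\<And>a b i j. a < m \<Longrightarrow> b < m \<Longrightarrow> i < n \<Longrightarrow> j < n \<Longrightarrow>
      T $$ (a * n + i, b * n + j) = t a b (int i - int j)"
    and Tc: "T \<in> carrier_mat N N"
    using T unfolding mat_over_toeplitz_iff N_def by blast
  define P where "P a b g \<longleftrightarrow> (\<forall>k. \<bar>k\<bar> < int n \<longrightarrow> (\<Sum>l<L. g l * cis (2 * pi * real l * of_int k / real L)) = t a b k)" for a b g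
  define g where "g a b = (SOME g. P a b g)" for a b
  have "P a b (g a b)" for a b
  proof -
    have "\<exists>h. P a b h" unfolding P_def L_def by (rule fourier_coefficients[OF n])
    then show ?thesis unfolding g_def by (rule someI_ex)
  qed
  then have g: "(\<Sum>l<L. g a b l * cis (2 * pi * real l * of_int k / real L)) = t a b k" if "\<bar>k\<bar> < int n" for a b k
    using that unfolding P_def by blast
  define z where "z l = cis (2 * pi * real l / real L)" for l
  define x where "x l a b = block_vec n m (z l) (\<lambda>c. if c = a then g a b l else 0)" for l a b
  define y where "y l b = block_vec n m (z l) (\<lambda>c. if c = b then 1 else 0)" for l and b :: nat
  have mem: "block_vec n m (z l) \<xi> \<in> X" for l \<xi> unfolding X_def toeplitz_family_def z_def by auto
  have add: "x l a b + y l b = block_vec n m (z l) (\<lambda>c. (if c = a then g a b l else 0) + (if c = b then 1 else 0))" for l a b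
    unfolding x_def y_def block_vec_def by (intro eq_vecI) (auto simp: distrib_right)
  define f where "f = (\<lambda>(l, a, b) (p, q). x l a b $ p * cnj (y l b $ q) + y l b $ p * cnj (x l a b $ q))"
  define M where "M = mat N N (\<lambda>p. \<Sum>k\<in>{..<L} \<times> {..<m} \<times> {..<m}. f k p)"
  have M: "M \<in> real_span N X" unfolding M_def
  proof (rule real_span_sum)
    fix k :: "nat \<times> nat \<times> nat"
    obtain l a b where k: "k = (l, a, b)" by (cases k)
    have "mat N N (\<lambda>(i, j). x l a b $ i * cnj (y l b $ j) + y l b $ i * cnj (x l a b $ j)) \<in> real_span N X"
    proof (rule real_span_polarize)
      show "x l a b \<in> X" "y l b \<in> X" unfolding x_def y_def by (rule mem)+
      show "x l a b + y l b \<in> X" unfolding add by (rule mem)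
      show "X \<subseteq> carrier_vec N" unfolding X_def N_def by (rule toeplitz_family_carrier)
    qed
    then show "mat N N (f k) \<in> real_span N X" by (simp add: f_def k)
  qed auto
  have z_pow: "z l ^ i * cnj (z l ^ j) = cis (2 * pi * real l * of_int (int i - int j) / real L)" for l i j
  proof -
    have "z l ^ i * cnj (z l ^ j) = cis (real i * (2 * pi * real l / real L)) * cis (- (real j * (2 * pi * real l / real L)))"
      by (simp add: z_def Complex.DeMoivre cis_cnj)
    also have "\<dots> = cis (2 * pi * real l * of_int (int i - int j) / real L)"
      unfolding cis_mult by (intro arg_cong[of _ _ cis]) (simp add: algebra_simps diff_divide_distrib)
    finally show ?thesis .
  qed
  have entry: "M $$ (p, q) = 2 * T $$ (p, q)" if pq: "p < N" "q < N" for p q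
  proof -
    obtain a i where p: "a < m" "i < n" "p = a * n + i" using block_index_cases[OF pq(1)[unfolded N_def]] .
    obtain b j where q: "b < m" "j < n" "q = b * n + j" using block_index_cases[OF pq(2)[unfolded N_def]] .
    define \<zeta> where "\<zeta> l = z l ^ i * cnj (z l ^ j)" for l
    have f: "f (l, c, d) (p, q) = (if c = a then if d = b then g a b l * \<zeta> l else 0 else 0)
        + (if c = b then if d = a then cnj (g b a l) * \<zeta> l else 0 else 0)" for l c d
      using p q by (auto simp: f_def x_def y_def block_vec_index \<zeta>_def)
    have "M $$ (p, q) = (\<Sum>l<L. \<Sum>c<m. \<Sum>d<m. f (l, c, d) (p, q))"
      using that by (simp add: M_def sum.cartesian_product)
    also have "\<dots> = (\<Sum>l<L. g a b l * \<zeta> l + cnj (g b a l) * \<zeta> l)"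
    proof (intro sum.cong refl)
      fix l
      have "(\<Sum>d<m. f (l, c, d) (p, q)) = (if c = a then g a b l * \<zeta> l else 0) + (if c = b then cnj (g b a l) * \<zeta> l else 0)" for c
        using p q unfolding f sum.distrib by (auto simp: sum.delta)
      then show "(\<Sum>c<m. \<Sum>d<m. f (l, c, d) (p, q)) = g a b l * \<zeta> l + cnj (g b a l) * \<zeta> l"
        using p q by (simp add: sum.distrib)
    qed
    also have "\<dots> = (\<Sum>l<L. g a b l * \<zeta> l) + cnj (\<Sum>l<L. g b a l * cnj (\<zeta> l))"
      by (simp add: sum.distrib)
    also have "(\<Sum>l<L. g a b l * \<zeta> l) = t a b (int i - int j)"
      unfolding \<zeta>_def z_pow using p q by (intro g) auto
    also have "(\<Sum>l<L. g b a l * cnj (\<zeta> l)) = t b a (int j - int i)"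
    proof -
      have "cnj (\<zeta> l) = cis (2 * pi * real l * of_int (int j - int i) / real L)" for l
        using z_pow[of l j i] by (simp add: \<zeta>_def mult.commute)
      moreover have "\<bar>int j - int i\<bar> < int n" using p q by auto
      ultimately show ?thesis by (simp only: g)
    qed
    also have "t a b (int i - int j) = T $$ (p, q)" using t p q by simp
    also have "t b a (int j - int i) = T $$ (q, p)" using t p q by simp
    also have "cnj (T $$ (q, p)) = T $$ (p, q)" using h that unfolding hermitian_mat_def N_def by metis
    finally show ?thesis by simp
  qed
  have "mat N N (\<lambda>p. complex_of_real (1/2) * M $$ p + complex_of_real 0 * M $$ p) \<in> real_span N X"
    by (intro real_span_lincomb M)
  also have "mat N N (\<lambda>p. complex_of_real (1/2) * M $$ p + complex_of_real 0 * M $$ p) = T"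
    using Tc entry by (intro eq_matI) auto
  finally show ?thesis unfolding N_def X_def .
qed

lemma sum_blocks:
  fixes f :: "nat \<Rightarrow> 'a::comm_monoid_add"
  shows "(\<Sum>k<m * n. f k) = (\<Sum>a<m. \<Sum>i<n. f (a * n + i))"
proof -
  have "sum f {a * n..<a * n + n} = (\<Sum>i<n. f (a * n + i))" for a
    using sum.shift_bounds_nat_ivl[of f 0 "a * n" n] by (simp add: add.commute lessThan_atLeast0)
  then show ?thesis using sum.nat_group[of f n m] by simp
qed

lemma cip_block_vec:
  "cip (m * n) (block_vec n m z \<xi>) f = (\<Sum>a<m. cnj (\<xi> a) * (\<Sum>i<n. f $ (a * n + i) * cnj z ^ i))"
  unfolding cip_def sum_blocks sum_distrib_left
  by (intro sum.cong refl) (simp add: block_vec_index mult_ac)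

lemma infinite_unit_circle: "infinite {w. cmod w = 1}"
proof -
  have "inj_on cis {0..1::real}"
  proof (rule inj_onI)
    fix x y :: real assume *: "x \<in> {0..1}" "y \<in> {0..1}" "cis x = cis y"
    have c: "cos x = cos y" using arg_cong[OF *(3), of Re] by simp
    have b: "0 \<le> x" "x \<le> pi" "0 \<le> y" "y \<le> pi" using *(1,2) pi_gt3 by auto
    show "x = y" by (rule cos_inj_pi[OF b c])
  qed
  then have "infinite (cis ` {0..1::real})" by (simp add: finite_image_iff)
  moreover have "cis ` {0..1::real} \<subseteq> {w. cmod w = 1}" by auto
  ultimately show ?thesis using finite_subset by blast
qed

lemma finite_block_roots:
  fixes f :: "complex vec"
  assumes f: "f \<in> carrier_vec (m * n)" "f \<noteq> 0\<^sub>v (m * n)"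
  obtains a where "a < m" "finite {w. (\<Sum>i<n. f $ (a * n + i) * w ^ i) = 0}"
proof -
  obtain k where k: "k < m * n" "f $ k \<noteq> 0" using f by (metis carrier_vecD eq_vecI index_zero_vec)
  obtain a i where a: "a < m" "i < n" "k = a * n + i" using block_index_cases[OF k(1)] .
  have "finite {w. (\<Sum>i\<le>n - 1. f $ (a * n + i) * w ^ i) = 0}"
    using a k by (intro polyfun_roots_finite[of _ i]) auto
  moreover have "{..n - 1} = {..<n}" using a by auto
  ultimately show ?thesis using a by (intro that[of a]) auto
qed

text \<open>
  The inner product with a vector \<open>f\<close> is \<open>\<Sum> cnj \<xi>\<^sub>a p\<^sub>a(cnj z)\<close> with a polynomial \<open>p\<^sub>a\<close> for each block.
  A nonzero \<open>f\<close> has a nonzero polynomial, which has finitely many zeros. So for suitable \<open>z\<close> both \<open>f\<close>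
  and \<open>g\<close> give nonzero functionals of \<open>\<xi>\<close>, and one of \<open>e\<^sub>a\<close>, \<open>e\<^sub>b\<close>, \<open>e\<^sub>a + e\<^sub>b\<close> is in the kernel of
  neither.
\<close>

lemma toeplitz_generic: "generic_family (m * n) (toeplitz_family n m)"
  unfolding generic_family_def
proof (intro conjI ballI impI toeplitz_family_carrier)
  fix f g :: "complex vec"
  assume f: "f \<in> carrier_vec (m * n)" "f \<noteq> 0\<^sub>v (m * n)" and g: "g \<in> carrier_vec (m * n)" "g \<noteq> 0\<^sub>v (m * n)"
  obtain a where a: "a < m" "finite {w. (\<Sum>i<n. f $ (a * n + i) * w ^ i) = 0}"
    using finite_block_roots[OF f] .
  obtain b where b: "b < m" "finite {w. (\<Sum>i<n. g $ (b * n + i) * w ^ i) = 0}"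
    using finite_block_roots[OF g] .
  \<comment> \<open>the zeros of both polynomials, to be avoided\<close>
  define R where "R = {w. (\<Sum>i<n. f $ (a * n + i) * w ^ i) = 0} \<union> {w. (\<Sum>i<n. g $ (b * n + i) * w ^ i) = 0}"
  have "finite R" using a(2) b(2) by (simp add: R_def)
  then have "\<not> {w. cmod w = 1} \<subseteq> R" using infinite_unit_circle finite_subset by blast
  then obtain w where w: "cmod w = 1" "w \<notin> R" by auto
  define A where "A c = (\<Sum>i<n. f $ (c * n + i) * w ^ i)" for c
  define B where "B c = (\<Sum>i<n. g $ (c * n + i) * w ^ i)" for c
  have AB: "A a \<noteq> 0" "B b \<noteq> 0" using w by (auto simp: A_def B_def R_def)
  have z: "cmod (cnj w) = 1" using w by simp
  have cf: "cip (m * n) (block_vec n m (cnj w) \<xi>) f = (\<Sum>c<m. cnj (\<xi> c) * A c)" for \<xi>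
    by (simp add: cip_block_vec A_def)
  have cg: "cip (m * n) (block_vec n m (cnj w) \<xi>) g = (\<Sum>c<m. cnj (\<xi> c) * B c)" for \<xi>
    by (simp add: cip_block_vec B_def)
  have delta: "(\<Sum>c<m. cnj (if c = d then 1 else 0) * E c) = E d" if "d < m" for d and E :: "nat \<Rightarrow> complex"
  proof -
    have "(\<Sum>c<m. cnj (if c = d then 1 else 0) * E c) = (\<Sum>c<m. if c = d then E c else 0)" by (intro sum.cong) auto
    then show ?thesis using that by simp
  qed
  have "\<exists>\<xi>. (\<Sum>c<m. cnj (\<xi> c) * A c) \<noteq> 0 \<and> (\<Sum>c<m. cnj (\<xi> c) * B c) \<noteq> 0"
  proof (cases "B a = 0 \<and> A b = 0")
    case True
    let ?\<xi> = "\<lambda>c. (if c = a then 1 else 0) + (if c = b then 1 else 0)"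
    have "(\<Sum>c<m. cnj (?\<xi> c) * E c) = E a + E b" for E :: "nat \<Rightarrow> complex"
      unfolding complex_cnj_add distrib_right sum.distrib using a b by (simp only: delta)
    then show ?thesis using True AB by (intro exI[of _ ?\<xi>]) simp
  next
    case False
    then show ?thesis
    proof (cases "B a = 0")
      case True
      then show ?thesis using False AB b by (intro exI[of _ "\<lambda>c. if c = b then 1 else 0"]) (simp only: delta, simp)
    next
      case False
      then show ?thesis using AB a by (intro exI[of _ "\<lambda>c. if c = a then 1 else 0"]) (simp only: delta, simp)
    qed
  qed
  then show "\<exists>x\<in>toeplitz_family n m. cip (m * n) x f \<noteq> 0 \<and> cip (m * n) x g \<noteq> 0"
    unfolding cf[symmetric] cg[symmetric] using z unfolding toeplitz_family_def by blast
qed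

text \<open>
  One of \<open>f\<close>, \<open>g\<close> is not orthogonal to the other one, or \<open>f + g\<close> is orthogonal to neither.
\<close>

lemma full_generic: "generic_family N (carrier_vec N)"
  unfolding generic_family_def
proof (intro conjI ballI impI subset_refl)
  fix f g :: "complex vec"
  assume f: "f \<in> carrier_vec N" "f \<noteq> 0\<^sub>v N" and g: "g \<in> carrier_vec N" "g \<noteq> 0\<^sub>v N"
  have ff: "cip N f f \<noteq> 0" "cip N g g \<noteq> 0" using f g cip_self_eq_0 by blast+
  show "\<exists>x\<in>carrier_vec N. cip N x f \<noteq> 0 \<and> cip N x g \<noteq> 0"
  proof (cases "cip N f g = 0")
    case True
    then have "cip N g f = 0" by (metis cip_cnj complex_cnj_zero)
    moreover have "cip N (f + g) v = cip N f v + cip N g v" for v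
      using f g by (simp add: cip_def distrib_right sum.distrib)
    ultimately show ?thesis using True ff f g by (intro bexI[of _ "f + g"]) auto
  qed (use f ff in auto)
qed

lemma mat_adjoint_index:
  "A \<in> carrier_mat k k \<Longrightarrow> i < k \<Longrightarrow> j < k \<Longrightarrow> mat_adjoint A $$ (i, j) = cnj (A $$ (j, i))"
  by (simp add: mat_adjoint_def mat_of_rows_index)

lemma mat_adjoint_carrier: "A \<in> carrier_mat k k \<Longrightarrow> mat_adjoint A \<in> carrier_mat k k"
  by (intro carrier_matI) (simp_all add: mat_adjoint_def)

lemma mat_adjoint_eq_iff:
  assumes "A \<in> carrier_mat N N"
  shows "mat_adjoint A = A \<longleftrightarrow> hermitian_mat N A"
proof
  assume *: "mat_adjoint A = A"
  show "hermitian_mat N A" unfolding hermitian_mat_def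
  proof (intro allI impI)
    fix i j assume "i < N" "j < N"
    from mat_adjoint_index[OF assms this] show "A $$ (i, j) = cnj (A $$ (j, i))" unfolding * .
  qed
next
  assume h: "hermitian_mat N A"
  show "mat_adjoint A = A"
  proof (rule eq_matI)
    fix i j assume "i < dim_row A" "j < dim_col A"
    then have ij: "i < N" "j < N" using assms by auto
    then have "A $$ (i, j) = cnj (A $$ (j, i))" using h unfolding hermitian_mat_def by blast
    then show "mat_adjoint A $$ (i, j) = A $$ (i, j)" using mat_adjoint_index[OF assms ij] by simp
  qed (use mat_adjoint_carrier[OF assms] assms in auto)
qed

lemma mat_over_full: "mat_over n m (carrier_mat n n) = carrier_mat (m * n) (m * n)"
  by (auto simp: mat_over_def mat_block_def)

lemma H_set_full: "H_set n (carrier_mat n n) (carrier_mat n n) m = nondeg (m * n) (carrier_vec (m * n))"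
  unfolding H_set_def nondeg_full mat_over_full invertible_in_def[symmetric]
  by (auto simp: mat_adjoint_eq_iff)

lemma H_set_toeplitz:
  assumes n: "n \<ge> 1"
  shows "H_set n (carrier_mat n n) (toeplitz n) m = nondeg (m * n) (toeplitz_family n m)"
proof (intro equalityI subsetI)
  fix T assume T: "T \<in> H_set n (carrier_mat n n) (toeplitz n) m"
  then have c: "T \<in> carrier_mat (m * n) (m * n)" by (auto simp: H_set_def mat_over_def)
  have i: "invertible_in (m * n) T" using T unfolding H_set_def mat_over_full invertible_in_def by blast
  have "hermitian_mat (m * n) T" using T mat_adjoint_eq_iff[OF c] by (auto simp: H_set_def)
  then have "T \<in> real_span (m * n) (toeplitz_family n m)"
    using T by (intro hermitian_toeplitz_span n) (auto simp: H_set_def)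
  with i show "T \<in> nondeg (m * n) (toeplitz_family n m)" unfolding real_span_def nondeg_def by blast
next
  fix T assume "T \<in> nondeg (m * n) (toeplitz_family n m)"
  then obtain F c where F: "F \<subseteq> toeplitz_family n m" "T = outer_sum (m * n) F c" "invertible_in (m * n) T"
    unfolding nondeg_def by blast
  then show "T \<in> H_set n (carrier_mat n n) (toeplitz n) m"
    using outer_sum_family_toeplitz[OF F(1)] mat_adjoint_eq_iff[OF outer_sum_carrier(1), of "m * n" F c] outer_sum_hermitian
    unfolding H_set_def mat_over_full invertible_in_def by auto
qed

section \<open>The C*-envelope\<close>

definition unit_mat :: "nat \<Rightarrow> nat \<Rightarrow> nat \<Rightarrow> complex mat" where
  "unit_mat n k l = mat n n (\<lambda>p. if p = (k, l) then 1 else 0)"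

lemma mult_unit_mat:
  assumes A: "A \<in> carrier_mat n n" and B: "B \<in> carrier_mat n n" and kl: "k < n" "l < n"
  shows "A * unit_mat n k l * B = mat n n (\<lambda>(p, q). A $$ (p, k) * B $$ (l, q))"
proof -
  have 1: "A * unit_mat n k l = mat n n (\<lambda>(p, q). if q = l then A $$ (p, k) else 0)"
  proof (rule eq_matI)
    fix p q assume "p < dim_row (mat n n (\<lambda>(p, q). if q = l then A $$ (p, k) else 0))"
      "q < dim_col (mat n n (\<lambda>(p, q). if q = l then A $$ (p, k) else 0))"
    then have pq: "p < n" "q < n" by auto
    have "(A * unit_mat n k l) $$ (p, q) = (\<Sum>r<n. A $$ (p, r) * unit_mat n k l $$ (r, q))"
      using A pq by (auto simp: unit_mat_def scalar_prod_def lessThan_atLeast0)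
    also have "\<dots> = (\<Sum>r<n. if r = k then (if q = l then A $$ (p, r) else 0) else 0)"
      using pq by (intro sum.cong) (auto simp: unit_mat_def)
    finally have "(A * unit_mat n k l) $$ (p, q) = (\<Sum>r<n. if r = k then (if q = l then A $$ (p, r) else 0) else 0)" .
    then show "(A * unit_mat n k l) $$ (p, q) = mat n n (\<lambda>(p, q). if q = l then A $$ (p, k) else 0) $$ (p, q)"
      using kl pq by simp
  qed (use A in \<open>auto simp: unit_mat_def\<close>)
  show ?thesis unfolding 1
  proof (rule eq_matI)
    fix p q assume "p < dim_row (mat n n (\<lambda>(p, q). A $$ (p, k) * B $$ (l, q)))"
      "q < dim_col (mat n n (\<lambda>(p, q). A $$ (p, k) * B $$ (l, q)))"
    then have pq: "p < n" "q < n" by auto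
    have "(mat n n (\<lambda>(p, q). if q = l then A $$ (p, k) else 0) * B) $$ (p, q) =
       (\<Sum>r<n. (if r = l then A $$ (p, k) else 0) * B $$ (r, q))"
      using B pq by (auto simp: scalar_prod_def lessThan_atLeast0)
    also have "\<dots> = (\<Sum>r<n. if r = l then A $$ (p, k) * B $$ (r, q) else 0)"
      by (intro sum.cong) auto
    finally have "(mat n n (\<lambda>(p, q). if q = l then A $$ (p, k) else 0) * B) $$ (p, q) =
       (\<Sum>r<n. if r = l then A $$ (p, k) * B $$ (r, q) else 0)" .
    then show "(mat n n (\<lambda>(p, q). if q = l then A $$ (p, k) else 0) * B) $$ (p, q) =
        mat n n (\<lambda>(p, q). A $$ (p, k) * B $$ (l, q)) $$ (p, q)"
      using kl pq by simp
  qed (use B in auto)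
qed

lemma carrier_subset_if_units:
  assumes add: "\<And>x y. x \<in> S \<Longrightarrow> y \<in> S \<Longrightarrow> x + y \<in> S" and zero: "0\<^sub>m n n \<in> S"
    and unit: "\<And>c i j. i < n \<Longrightarrow> j < n \<Longrightarrow> c \<cdot>\<^sub>m unit_mat n i j \<in> S"
  shows "carrier_mat n n \<subseteq> S"
proof
  fix X :: "complex mat" assume X: "X \<in> carrier_mat n n"
  have "mat n n (\<lambda>p. if p \<in> F then X $$ p else 0) \<in> S" if "finite F" "F \<subseteq> {..<n} \<times> {..<n}" for F
    using that
  proof (induction F rule: finite_induct)
    case empty
    have "mat n n (\<lambda>p. if p \<in> {} then X $$ p else 0) = 0\<^sub>m n n" by (intro eq_matI) auto
    then show ?case using zero by simp
  next
    case (insert p F)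
    obtain i j where p: "p = (i, j)" by (cases p)
    then have ij: "i < n" "j < n" using insert by auto
    have "mat n n (\<lambda>p. if p \<in> F then X $$ p else 0) + X $$ p \<cdot>\<^sub>m unit_mat n i j \<in> S"
      using insert ij by (intro add unit) auto
    also have "mat n n (\<lambda>p. if p \<in> F then X $$ p else 0) + X $$ p \<cdot>\<^sub>m unit_mat n i j =
        mat n n (\<lambda>q. if q \<in> insert p F then X $$ q else 0)"
      using insert(2) p by (intro eq_matI) (auto simp: unit_mat_def)
    finally show ?case .
  qed
  from this[of "{..<n} \<times> {..<n}"] have "mat n n (\<lambda>p. if p \<in> {..<n} \<times> {..<n} then X $$ p else 0) \<in> S" by simp
  also have "mat n n (\<lambda>p. if p \<in> {..<n} \<times> {..<n} then X $$ p else 0) = X" using X by (intro eq_matI) auto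
  finally show "X \<in> S" .
qed

lemma toeplitz_carrier: "toeplitz n \<subseteq> carrier_mat n n"
  by (auto simp: toeplitz_def)

lemma toeplitzI:
  assumes "T \<in> carrier_mat n n" "\<And>i j. i < n \<Longrightarrow> j < n \<Longrightarrow> T $$ (i, j) = t (int i - int j)"
  shows "T \<in> toeplitz n"
  using assms unfolding toeplitz_def by blast

lemma operator_system_toeplitz: "operator_system n (toeplitz n)"
  unfolding operator_system_def
proof (intro conjI ballI allI toeplitz_carrier)
  show "1\<^sub>m n \<in> toeplitz n" by (rule toeplitzI[where t = "\<lambda>k. if k = 0 then 1 else 0"]) auto
  fix x y assume x: "x \<in> toeplitz n" and y: "y \<in> toeplitz n"
  obtain t where t: "x \<in> carrier_mat n n" "\<And>i j. i < n \<Longrightarrow> j < n \<Longrightarrow> x $$ (i, j) = t (int i - int j)"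
    using x unfolding toeplitz_def by blast
  obtain s where s: "y \<in> carrier_mat n n" "\<And>i j. i < n \<Longrightarrow> j < n \<Longrightarrow> y $$ (i, j) = s (int i - int j)"
    using y unfolding toeplitz_def by blast
  show "x + y \<in> toeplitz n" using t s by (intro toeplitzI[where t = "\<lambda>k. t k + s k"]) auto
next
  fix c x assume x: "x \<in> toeplitz n"
  obtain t where t: "x \<in> carrier_mat n n" "\<And>i j. i < n \<Longrightarrow> j < n \<Longrightarrow> x $$ (i, j) = t (int i - int j)"
    using x unfolding toeplitz_def by blast
  show "c \<cdot>\<^sub>m x \<in> toeplitz n" using t by (intro toeplitzI[where t = "\<lambda>k. c * t k"]) auto
next
  fix x assume x: "x \<in> toeplitz n"
  obtain t where t: "x \<in> carrier_mat n n" "\<And>i j. i < n \<Longrightarrow> j < n \<Longrightarrow> x $$ (i, j) = t (int i - int j)"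
    using x unfolding toeplitz_def by blast
  show "mat_adjoint x \<in> toeplitz n"
    using t by (intro toeplitzI[where t = "\<lambda>k. cnj (t (- k))"]) (auto simp: mat_adjoint_index intro: mat_adjoint_carrier)
qed

lemma cstar_subalgebra_carrier: "cstar_subalgebra n (carrier_mat n n)"
  unfolding cstar_subalgebra_def operator_system_def by (auto intro: mat_adjoint_carrier)

text \<open>
  Every matrix unit is a product of three shifts, the middle one being the extreme shift, which is
  itself a matrix unit.
\<close>

lemma cstar_generated_toeplitz: "cstar_generated n (toeplitz n) = carrier_mat n n"
proof
  show "cstar_generated n (toeplitz n) \<subseteq> carrier_mat n n"
    unfolding cstar_generated_def using cstar_subalgebra_carrier toeplitz_carrier by blast
  show "carrier_mat n n \<subseteq> cstar_generated n (toeplitz n)"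
    unfolding cstar_generated_def
  proof (rule Inter_greatest)
    fix A assume "A \<in> {A. cstar_subalgebra n A \<and> toeplitz n \<subseteq> A}"
    then have A: "\<And>x y. x \<in> A \<Longrightarrow> y \<in> A \<Longrightarrow> x + y \<in> A" "\<And>x y. x \<in> A \<Longrightarrow> y \<in> A \<Longrightarrow> x * y \<in> A"
        "\<And>c x. x \<in> A \<Longrightarrow> c \<cdot>\<^sub>m x \<in> A" and sub: "toeplitz n \<subseteq> A"
      unfolding cstar_subalgebra_def operator_system_def by auto
    define shift :: "int \<Rightarrow> complex mat" where "shift k = mat n n (\<lambda>(p, q). if int p - int q = k then 1 else 0)" for k
    have shift: "shift k \<in> A" "shift k \<in> carrier_mat n n" for k
    proof -
      have "shift k \<in> toeplitz n" by (rule toeplitzI[where t = "\<lambda>l. if l = k then 1 else 0"]) (auto simp: shift_def)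
      then show "shift k \<in> A" "shift k \<in> carrier_mat n n" using sub toeplitz_carrier by blast+
    qed
    show "carrier_mat n n \<subseteq> A"
    proof (rule carrier_subset_if_units)
      fix c i j assume ij: "i < n" "j < n"
      \<comment> \<open>the extreme shift has a single nonzero entry, in the lower left corner\<close>
      have corner: "shift (int n - 1) = unit_mat n (n - 1) 0"
        unfolding shift_def unit_mat_def using ij by (intro eq_matI) auto
      have "shift (int i - (int n - 1)) * shift (int n - 1) * shift (- int j) = unit_mat n i j"
        using ij by (subst corner, subst mult_unit_mat)
          (auto simp: shift shift_def unit_mat_def intro!: eq_matI)
      then have "unit_mat n i j \<in> A" using A(2) shift by metis
      then show "c \<cdot>\<^sub>m unit_mat n i j \<in> A" by (rule A(3))
    next
      have "0 \<cdot>\<^sub>m shift 0 \<in> A" by (intro A(3) shift)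
      also have "0 \<cdot>\<^sub>m shift 0 = 0\<^sub>m n n" by (intro eq_matI) (auto simp: shift_def)
      finally show "0\<^sub>m n n \<in> A" .
    qed (rule A(1))
  qed
qed

text \<open>
  The matrix algebra is simple: a nonzero entry of an element of \<open>J\<close> can be moved to any place by matrix
  units.
\<close>

lemma cstar_ideal_carrier:
  assumes J: "cstar_ideal n (carrier_mat n n) J" and ne: "J \<noteq> {0\<^sub>m n n}"
  shows "J = carrier_mat n n"
proof
  have add: "\<And>x y. x \<in> J \<Longrightarrow> y \<in> J \<Longrightarrow> x + y \<in> J" and zero: "0\<^sub>m n n \<in> J" and Jc: "J \<subseteq> carrier_mat n n"
    and mult: "\<And>a x. a \<in> carrier_mat n n \<Longrightarrow> x \<in> J \<Longrightarrow> a * x \<in> J" "\<And>a x. a \<in> carrier_mat n n \<Longrightarrow> x \<in> J \<Longrightarrow> x * a \<in> J"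
    using J unfolding cstar_ideal_def by auto
  show "J \<subseteq> carrier_mat n n" by fact
  obtain x where x: "x \<in> J" "x \<noteq> 0\<^sub>m n n" using ne zero by blast
  then have xc: "x \<in> carrier_mat n n" using Jc by auto
  obtain k l where kl: "k < n" "l < n" "x $$ (k, l) \<noteq> 0"
  proof -
    have "\<not> (\<forall>k<n. \<forall>l<n. x $$ (k, l) = 0)" using x(2) xc by (auto intro!: eq_matI)
    then show ?thesis using that by blast
  qed
  show "carrier_mat n n \<subseteq> J"
  proof (rule carrier_subset_if_units[OF add zero])
    fix c i j assume ij: "i < n" "j < n"
    define a where "a = (c / x $$ (k, l)) \<cdot>\<^sub>m unit_mat n i k"
    define b where "b = unit_mat n l j"
    have ab: "a \<in> carrier_mat n n" "b \<in> carrier_mat n n" by (auto simp: a_def b_def unit_mat_def)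
    have "a * x * b = c \<cdot>\<^sub>m unit_mat n i j"
    proof -
      have ax: "(a * x) $$ (p, l) = (if p = i then c else 0)" if p: "p < n" for p
      proof -
        have "(a * x) $$ (p, l) = (\<Sum>r<n. a $$ (p, r) * x $$ (r, l))"
          using ab xc p kl by (auto simp: scalar_prod_def lessThan_atLeast0)
        also have "\<dots> = (\<Sum>r<n. if r = k then (if p = i then c else 0) else 0)"
          using kl p by (intro sum.cong) (auto simp: a_def unit_mat_def)
        finally show ?thesis using kl by simp
      qed
      have ac: "a * x \<in> carrier_mat n n" using ab xc by auto
      have "a * x * b = a * x * unit_mat n l j * 1\<^sub>m n" using ac by (simp add: b_def unit_mat_def)
      also have "\<dots> = mat n n (\<lambda>(p, q). (a * x) $$ (p, l) * 1\<^sub>m n $$ (j, q))"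
        using ac kl ij by (intro mult_unit_mat) auto
      also have "\<dots> = c \<cdot>\<^sub>m unit_mat n i j" using ij ax by (intro eq_matI) (auto simp: unit_mat_def simp del: index_mult_mat)
      finally show ?thesis .
    qed
    then show "c \<cdot>\<^sub>m unit_mat n i j \<in> J" using mult ab x by metis
  qed
qed

text \<open>
  A nonzero boundary ideal is the whole algebra, and modulo it every matrix would be positive, in
  particular \<open>-1\<close>; but \<open>-1\<close> is not of the form \<open>Z\<^sup>* Z\<close>.
\<close>

lemma is_cstar_envelope_toeplitz:
  assumes n: "n \<ge> 1"
  shows "is_cstar_envelope n (carrier_mat n n) (toeplitz n)"
  unfolding is_cstar_envelope_def
proof (intro conjI allI impI operator_system_toeplitz cstar_generated_toeplitz)
  fix J assume J: "boundary_ideal n (carrier_mat n n) (toeplitz n) J"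
  show "J = {0\<^sub>m n n}"
  proof (rule ccontr)
    assume "J \<noteq> {0\<^sub>m n n}"
    then have Jc: "J = carrier_mat n n" using J cstar_ideal_carrier unfolding boundary_ideal_def by blast
    define X :: "complex mat" where "X = - 1\<^sub>m n"
    have X: "X \<in> mat_over n 1 (toeplitz n)" unfolding mat_over_toeplitz_iff
      by (intro conjI exI[of _ "\<lambda>_ _ k. if k = 0 then -1 else 0"]) (auto simp: X_def)
    have "mat_adjoint (1\<^sub>m n) * 1\<^sub>m n - X \<in> mat_over n 1 J"
      unfolding Jc mat_over_full by (auto simp: X_def intro!: minus_carrier_mat)
    moreover have "1\<^sub>m n \<in> mat_over n 1 (carrier_mat n n)" unfolding mat_over_full by simp
    ultimately obtain Z where Z: "Z \<in> mat_over n 1 (carrier_mat n n)" "X = mat_adjoint Z * Z"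
      using J X unfolding boundary_ideal_def by (meson order_refl)
    have Zc: "Z \<in> carrier_mat n n" using Z(1) unfolding mat_over_full by simp
    have "X $$ (0, 0) = (\<Sum>k<n. cnj (Z $$ (k, 0)) * Z $$ (k, 0))"
      unfolding Z(2) using n Zc mat_adjoint_carrier[OF Zc]
      by (auto simp: scalar_prod_def lessThan_atLeast0 mat_adjoint_index[OF Zc] intro!: sum.cong)
    also have "\<dots> = complex_of_real (\<Sum>k<n. (cmod (Z $$ (k, 0)))\<^sup>2)"
      by (simp add: complex_norm_square mult.commute del: of_real_power)
    finally have "Re (X $$ (0, 0)) \<ge> 0" by (simp add: sum_nonneg)
    then show False using n by (simp add: X_def)
  qed
qed

section \<open>Direct sums\<close>

lemma sum_lessThan_add:
  fixes f :: "nat \<Rightarrow> 'a::comm_monoid_add"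
  shows "(\<Sum>i<N + M. f i) = (\<Sum>i<N. f i) + (\<Sum>i<M. f (N + i))"
  by (induction M) (auto simp: add.assoc)

lemma direct_sum_carrier:
  "x \<in> carrier_mat N N \<Longrightarrow> y \<in> carrier_mat M M \<Longrightarrow> direct_sum_mat x y \<in> carrier_mat (N + M) (N + M)"
  unfolding direct_sum_mat_def by auto

lemma direct_sum_index:
  assumes "x \<in> carrier_mat N N" "y \<in> carrier_mat M M" "i < N + M" "j < N + M"
  shows "direct_sum_mat x y $$ (i, j) =
    (if i < N \<and> j < N then x $$ (i, j) else if N \<le> i \<and> N \<le> j then y $$ (i - N, j - N) else 0)"
  using assms unfolding direct_sum_mat_def by auto

lemma direct_sum_hermitian:
  assumes x: "x \<in> carrier_mat N N" "hermitian_mat N x" and y: "y \<in> carrier_mat M M" "hermitian_mat M y"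
  shows "hermitian_mat (N + M) (direct_sum_mat x y)"
  unfolding hermitian_mat_def
proof (intro allI impI)
  fix i j assume ij: "i < N + M" "j < N + M"
  have "x $$ (i, j) = cnj (x $$ (j, i))" if "i < N" "j < N"
    using x(2) that unfolding hermitian_mat_def by blast
  moreover have "y $$ (i - N, j - N) = cnj (y $$ (j - N, i - N))" if "N \<le> i" "N \<le> j"
  proof -
    have "i - N < M" "j - N < M" using that ij by auto
    then show ?thesis using y(2) unfolding hermitian_mat_def by blast
  qed
  ultimately show "direct_sum_mat x y $$ (i, j) = cnj (direct_sum_mat x y $$ (j, i))"
    unfolding direct_sum_index[OF x(1) y(1) ij] direct_sum_index[OF x(1) y(1) ij(2,1)]
    by (cases "i < N"; cases "j < N") simp_all
qed

lemma direct_sum_mult: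
  assumes "x \<in> carrier_mat N N" "y \<in> carrier_mat M M" "x' \<in> carrier_mat N N" "y' \<in> carrier_mat M M"
  shows "direct_sum_mat x y * direct_sum_mat x' y' = direct_sum_mat (x * x') (y * y')"
proof -
  have "x * x' \<in> carrier_mat N N" "y * y' \<in> carrier_mat M M" using assms by auto
  then show ?thesis unfolding direct_sum_mat_def using assms
    by (subst mult_four_block_mat[of _ N N _ M _ M _ _ N _ M]) auto
qed

lemma direct_sum_one: "direct_sum_mat (1\<^sub>m N) (1\<^sub>m M) = 1\<^sub>m (N + M)"
  unfolding direct_sum_mat_def by simp

lemma direct_sum_invertible:
  assumes x: "x \<in> carrier_mat N N" "invertible_in N x" and y: "y \<in> carrier_mat M M" "invertible_in M y"
  shows "invertible_in (N + M) (direct_sum_mat x y)"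
proof -
  obtain x' where x': "x' \<in> carrier_mat N N" "x * x' = 1\<^sub>m N" "x' * x = 1\<^sub>m N" using x(2) unfolding invertible_in_def by blast
  obtain y' where y': "y' \<in> carrier_mat M M" "y * y' = 1\<^sub>m M" "y' * y = 1\<^sub>m M" using y(2) unfolding invertible_in_def by blast
  show ?thesis unfolding invertible_in_def
    using x(1) y(1) x' y' by (intro bexI[of _ "direct_sum_mat x' y'"] direct_sum_carrier)
      (auto simp: direct_sum_mult direct_sum_one)
qed

lemma cip_direct_sum:
  assumes x: "x \<in> carrier_mat N N" and y: "y \<in> carrier_mat M M" and v: "v \<in> carrier_vec (N + M)"
  defines "v1 \<equiv> vec N (\<lambda>i. v $ i)" and "v2 \<equiv> vec M (\<lambda>i. v $ (N + i))"
  shows "cip (N + M) v (direct_sum_mat x y *\<^sub>v v) = cip N v1 (x *\<^sub>v v1) + cip M v2 (y *\<^sub>v v2)"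
proof -
  have vc: "v1 \<in> carrier_vec N" "v2 \<in> carrier_vec M" by (auto simp: v1_def v2_def)
  have h1: "(\<Sum>i<N. \<Sum>j<N. cnj (v $ i) * direct_sum_mat x y $$ (i, j) * v $ j) =
      (\<Sum>i<N. \<Sum>j<N. cnj (v1 $ i) * x $$ (i, j) * v1 $ j)"
    by (intro sum.cong refl) (simp add: v1_def direct_sum_index[OF x y])
  have h2: "(\<Sum>i<N. \<Sum>j<M. cnj (v $ i) * direct_sum_mat x y $$ (i, N + j) * v $ (N + j)) = 0"
    by (intro sum.neutral ballI) (simp add: direct_sum_index[OF x y])
  have h3: "(\<Sum>i<M. \<Sum>j<N. cnj (v $ (N + i)) * direct_sum_mat x y $$ (N + i, j) * v $ j) = 0"
    by (intro sum.neutral ballI) (simp add: direct_sum_index[OF x y])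
  have h4: "(\<Sum>i<M. \<Sum>j<M. cnj (v $ (N + i)) * direct_sum_mat x y $$ (N + i, N + j) * v $ (N + j)) =
      (\<Sum>i<M. \<Sum>j<M. cnj (v2 $ i) * y $$ (i, j) * v2 $ j)"
    by (intro sum.cong refl) (simp add: v2_def direct_sum_index[OF x y])
  show ?thesis
    unfolding cip_mult_mat_vec[OF direct_sum_carrier[OF x y] v] cip_mult_mat_vec[OF x vc(1)] cip_mult_mat_vec[OF y vc(2)]
      sum_lessThan_add sum.distrib h1 h2 h3 h4 by simp
qed

lemma inertia_direct_sum:
  assumes x: "x \<in> carrier_mat N N" "inertia N x p" and y: "y \<in> carrier_mat M M" "inertia M y q"
  shows "inertia (N + M) (direct_sum_mat x y) (p + q)"
proof -
  define l where "l a = vec (N + M) (\<lambda>i. if i < N then a $ i else 0)" for a :: "complex vec"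
  define r where "r a = vec (N + M) (\<lambda>i. if i < N then 0 else a $ (i - N))" for a :: "complex vec"
  have cl: "cip (N + M) (l a) v = cip N a (vec N (\<lambda>i. v $ i))" for a v
    unfolding cip_def sum_lessThan_add by (simp add: l_def)
  have cr: "cip (N + M) (r a) v = cip M a (vec M (\<lambda>i. v $ (N + i)))" for a v
    unfolding cip_def sum_lessThan_add by (simp add: r_def)
  have card: "card (l ` A \<union> r ` B) \<le> a + b" if "finite A" "finite B" "card A \<le> a" "card B \<le> b" for A B a b
    using card_Un_le[of "l ` A" "r ` B"] card_image_le[OF that(1), of l] card_image_le[OF that(2), of r] that by linarith
  have nz: "vec N (\<lambda>i. v $ i) \<noteq> 0\<^sub>v N \<or> vec M (\<lambda>i. v $ (N + i)) \<noteq> 0\<^sub>v M"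
    if v: "v \<in> carrier_vec (N + M)" "v \<noteq> 0\<^sub>v (N + M)" for v :: "complex vec"
  proof (rule ccontr)
    assume "\<not> ?thesis"
    then have *: "vec N (\<lambda>i. v $ i) = 0\<^sub>v N" "vec M (\<lambda>i. v $ (N + i)) = 0\<^sub>v M" by auto
    have "v $ i = 0" if i: "i < N + M" for i
    proof (cases "i < N")
      case True
      then show ?thesis using arg_cong[OF *(1), of "\<lambda>u. u $ i"] by simp
    next
      case False
      then have "N + (i - N) = i" by simp
      then show ?thesis using arg_cong[OF *(2), of "\<lambda>u. u $ (i - N)"] i False by simp
    qed
    then have "v = 0\<^sub>v (N + M)" using v by (intro eq_vecI) auto
    with v show False by simp
  qed
  obtain A1 where A1: "finite A1" "card A1 \<le> p"
    "\<And>v. v \<in> carrier_vec N \<Longrightarrow> v \<noteq> 0\<^sub>v N \<Longrightarrow> \<forall>a\<in>A1. cip N a v = 0 \<Longrightarrow> Re (cip N v (x *\<^sub>v v)) > 0"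
    using x(2) unfolding inertia_def by blast
  obtain B1 where B1: "finite B1" "card B1 \<le> N - p" "p \<le> N"
    "\<And>v. v \<in> carrier_vec N \<Longrightarrow> v \<noteq> 0\<^sub>v N \<Longrightarrow> \<forall>a\<in>B1. cip N a v = 0 \<Longrightarrow> Re (cip N v (x *\<^sub>v v)) < 0"
    using x(2) unfolding inertia_def by blast
  obtain A2 where A2: "finite A2" "card A2 \<le> q"
    "\<And>v. v \<in> carrier_vec M \<Longrightarrow> v \<noteq> 0\<^sub>v M \<Longrightarrow> \<forall>a\<in>A2. cip M a v = 0 \<Longrightarrow> Re (cip M v (y *\<^sub>v v)) > 0"
    using y(2) unfolding inertia_def by blast
  obtain B2 where B2: "finite B2" "card B2 \<le> M - q" "q \<le> M"
    "\<And>v. v \<in> carrier_vec M \<Longrightarrow> v \<noteq> 0\<^sub>v M \<Longrightarrow> \<forall>a\<in>B2. cip M a v = 0 \<Longrightarrow> Re (cip M v (y *\<^sub>v v)) < 0"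
    using y(2) unfolding inertia_def by blast
  have zero: "cip N v (x *\<^sub>v v) = 0" if "v = 0\<^sub>v N" for v using that by (simp add: cip_def)
  have zero': "cip M v (y *\<^sub>v v) = 0" if "v = 0\<^sub>v M" for v using that by (simp add: cip_def)
  show ?thesis
  proof (rule inertiaI[of "l ` A1 \<union> r ` A2" _ "l ` B1 \<union> r ` B2"])
    have "card (l ` B1 \<union> r ` B2) \<le> (N - p) + (M - q)" by (intro card B1 B2)
    then show "card (l ` B1 \<union> r ` B2) \<le> N + M - (p + q)" using B1(3) B2(3) by simp
  next
    fix v assume v: "v \<in> carrier_vec (N + M)" "v \<noteq> 0\<^sub>v (N + M)" "\<And>a. a \<in> l ` A1 \<union> r ` A2 \<Longrightarrow> cip (N + M) a v = 0"
    define v1 where "v1 = vec N (\<lambda>i. v $ i)"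
    define v2 where "v2 = vec M (\<lambda>i. v $ (N + i))"
    have o: "\<forall>a\<in>A1. cip N a v1 = 0" "\<forall>a\<in>A2. cip M a v2 = 0"
      using v(3) unfolding v1_def v2_def cl[symmetric] cr[symmetric] by blast+
    have vc: "v1 \<in> carrier_vec N" "v2 \<in> carrier_vec M" by (auto simp: v1_def v2_def)
    have "v1 \<noteq> 0\<^sub>v N \<or> v2 \<noteq> 0\<^sub>v M" using nz[OF v(1,2)] by (simp add: v1_def v2_def)
    then show "Re (cip (N + M) v (direct_sum_mat x y *\<^sub>v v)) > 0"
      unfolding cip_direct_sum[OF x(1) y(1) v(1)] v1_def[symmetric] v2_def[symmetric]
      using A1(3)[OF vc(1) _ o(1)] A2(3)[OF vc(2) _ o(2)] zero[of v1] zero'[of v2]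
      by (cases "v1 = 0\<^sub>v N"; cases "v2 = 0\<^sub>v M") (simp_all del: cip_zero)
  next
    fix v assume v: "v \<in> carrier_vec (N + M)" "v \<noteq> 0\<^sub>v (N + M)" "\<And>a. a \<in> l ` B1 \<union> r ` B2 \<Longrightarrow> cip (N + M) a v = 0"
    define v1 where "v1 = vec N (\<lambda>i. v $ i)"
    define v2 where "v2 = vec M (\<lambda>i. v $ (N + i))"
    have o: "\<forall>a\<in>B1. cip N a v1 = 0" "\<forall>a\<in>B2. cip M a v2 = 0"
      using v(3) unfolding v1_def v2_def cl[symmetric] cr[symmetric] by blast+
    have vc: "v1 \<in> carrier_vec N" "v2 \<in> carrier_vec M" by (auto simp: v1_def v2_def)
    have "v1 \<noteq> 0\<^sub>v N \<or> v2 \<noteq> 0\<^sub>v M" using nz[OF v(1,2)] by (simp add: v1_def v2_def)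
    then show "Re (cip (N + M) v (direct_sum_mat x y *\<^sub>v v)) < 0"
      unfolding cip_direct_sum[OF x(1) y(1) v(1)] v1_def[symmetric] v2_def[symmetric]
      using B1(4)[OF vc(1) _ o(1)] B2(4)[OF vc(2) _ o(2)] zero[of v1] zero'[of v2]
      by (cases "v1 = 0\<^sub>v N"; cases "v2 = 0\<^sub>v M") (simp_all del: cip_zero)
  next
    show "card (l ` A1 \<union> r ` A2) \<le> p + q" by (intro card A1 A2)
  qed (use A1(1) A2(1) B1(1,3) B2(1,3) in auto)
qed

lemma inertia_one: "inertia N (1\<^sub>m N) 0"
proof (rule inertiaI[of "{}" _ "unit_vec N ` {..<N}"])
  show "card (unit_vec N ` {..<N} :: complex vec set) \<le> N - 0" using card_image_le[of "{..<N}" "unit_vec N"] by simp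
  fix v :: "complex vec" assume v: "v \<in> carrier_vec N" "v \<noteq> 0\<^sub>v N"
  have "cip N v (1\<^sub>m N *\<^sub>v v) = complex_of_real (\<Sum>i<N. (cmod (v $ i))\<^sup>2)"
    using v by (simp add: cip_def complex_norm_square mult.commute del: of_real_power)
  moreover have "cip N v (1\<^sub>m N *\<^sub>v v) \<noteq> 0" using cip_self_eq_0[of v N] v by auto
  ultimately have "(\<Sum>i<N. (cmod (v $ i))\<^sup>2) \<noteq> 0" "Re (cip N v (1\<^sub>m N *\<^sub>v v)) = (\<Sum>i<N. (cmod (v $ i))\<^sup>2)"
    by (auto simp del: of_real_sum)
  then show "Re (cip N v (1\<^sub>m N *\<^sub>v v)) > 0" by (simp add: less_le sum_nonneg)
next
  fix v :: "complex vec" assume v: "v \<in> carrier_vec N" "v \<noteq> 0\<^sub>v N" "\<And>x. x \<in> unit_vec N ` {..<N} \<Longrightarrow> cip N x v = 0"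
  show "Re (cip N v (1\<^sub>m N *\<^sub>v v)) < 0" using orthogonal_unit_vecs[OF v(1)] v by blast
qed auto

section \<open>The semigroup of path components and its Grothendieck group\<close>

text \<open>
  The common hypotheses for the Toeplitz matrices and the full matrix algebra under which the
  path components for all \<open>m\<close>, together with their direct sums, are described by the negative index.
\<close>

locale stable_classification =
  fixes n :: nat and E :: "complex mat set" and X :: "nat \<Rightarrow> complex vec set"
  assumes n_pos: "1 \<le> n"
    and H_nondeg: "H_set n (carrier_mat n n) E m = nondeg (m * n) (X m)"
    and generic: "generic_family (m * n) (X m)"
    and zero_mem: "0\<^sub>m n n \<in> E" and one_mem: "1\<^sub>m n \<in> E"
begin

abbreviation H :: "nat \<Rightarrow> complex mat set" where
  "H \<equiv> H_set n (carrier_mat n n) E"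

text \<open>
  For \<open>q \<le> m n\<close> these are the path components, by \<open>path_component_H\<close>.
\<close>

definition index_class :: "nat \<Rightarrow> nat \<Rightarrow> complex mat set" where
  "index_class m q = {x \<in> H m. neg_index (m * n) x = q}"

lemma H_full: "x \<in> H m \<Longrightarrow> x \<in> nondeg (m * n) (carrier_vec (m * n))"
  using H_nondeg generic nondeg_mono unfolding generic_family_def by blast

lemma H_carrier: "x \<in> H m \<Longrightarrow> x \<in> carrier_mat (m * n) (m * n)"
  using H_full nondeg_carrier by blast

lemma neg_index_le: "x \<in> H m \<Longrightarrow> neg_index (m * n) x \<le> m * n"
  using inertia_neg_index[OF H_full] unfolding inertia_def by blast

lemma one_H: "1\<^sub>m (m * n) \<in> H m"
proof -
  have "mat_block n (1\<^sub>m (m * n)) a b = (if a = b then 1\<^sub>m n else 0\<^sub>m n n)" if "a < m" "b < m" for a b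
  proof (rule eq_matI)
    fix i j assume "i < dim_row (if a = b then 1\<^sub>m n else 0\<^sub>m n n :: complex mat)"
       "j < dim_col (if a = b then 1\<^sub>m n else 0\<^sub>m n n :: complex mat)"
    then have ij: "i < n" "j < n" by (auto split: if_splits)
    have "a * n + i = b * n + j \<longleftrightarrow> a = b \<and> i = j"
    proof
      assume *: "a * n + i = b * n + j"
      have "(a * n + i) div n = a" "(b * n + j) div n = b" using ij by auto
      with * show "a = b \<and> i = j" by auto
    qed auto
    then show "mat_block n (1\<^sub>m (m * n)) a b $$ (i, j) = (if a = b then 1\<^sub>m n else 0\<^sub>m n n) $$ (i, j)"
      using ij that by (auto simp: mat_block_def block_index_less)
  qed (auto simp: mat_block_def)
  then have "1\<^sub>m (m * n) \<in> mat_over n m E" unfolding mat_over_def using zero_mem one_mem by auto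
  moreover have "mat_adjoint (1\<^sub>m (m * n)) = (1\<^sub>m (m * n) :: complex mat)"
    by (subst mat_adjoint_eq_iff) (auto simp: hermitian_mat_def)
  ultimately show ?thesis unfolding H_set_def mat_over_full by (auto intro!: bexI[of _ "1\<^sub>m (m * n)"])
qed

lemma neg_index_one: "neg_index (m * n) (1\<^sub>m (m * n)) = 0"
  by (rule neg_index_eq[OF inertia_one])

lemma direct_sum_H:
  assumes x: "x \<in> H m" and y: "y \<in> H m'"
  shows "direct_sum_mat x y \<in> H (m + m')"
    and "neg_index ((m + m') * n) (direct_sum_mat x y) = neg_index (m * n) x + neg_index (m' * n) y"
proof -
  note xc = H_carrier[OF x] and yc = H_carrier[OF y]
  have dim: "(m + m') * n = m * n + m' * n" by (simp add: distrib_right)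
  have dc: "direct_sum_mat x y \<in> carrier_mat ((m + m') * n) ((m + m') * n)"
    unfolding dim by (rule direct_sum_carrier[OF xc yc])
  have blocks: "mat_block n (direct_sum_mat x y) a b \<in> E" if ab: "a < m + m'" "b < m + m'" for a b
  proof -
    have less: "a' * n + i < k * n \<longleftrightarrow> a' < k" if "i < n" for a' i k
      using block_index_less[OF _ that] that by (metis add_leD1 le_add1 mult_le_mono1 not_less order_trans)
    have entry: "direct_sum_mat x y $$ (a * n + i, b * n + j) =
       (if a < m \<and> b < m then x $$ (a * n + i, b * n + j)
        else if m \<le> a \<and> m \<le> b then y $$ ((a - m) * n + i, (b - m) * n + j) else 0)" if ij: "i < n" "j < n" for i j
    proof -
      have "a * n + i < m * n + m' * n" "b * n + j < m * n + m' * n"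
        using block_index_less[OF ab(1) ij(1)] block_index_less[OF ab(2) ij(2)] by (auto simp: dim)
      then show ?thesis
        using ij by (subst direct_sum_index[OF xc yc]) (auto simp: less not_less[symmetric] diff_mult_distrib)
    qed
    consider "a < m" "b < m" | "m \<le> a" "m \<le> b" | "a < m \<longleftrightarrow> m \<le> b" by linarith
    then show ?thesis
    proof cases
      case 1
      then have "mat_block n (direct_sum_mat x y) a b = mat_block n x a b"
        unfolding mat_block_def by (intro eq_matI) (auto simp: entry)
      then show ?thesis using x 1 by (auto simp: H_set_def mat_over_def)
    next
      case 2
      then have "mat_block n (direct_sum_mat x y) a b = mat_block n y (a - m) (b - m)"
        unfolding mat_block_def by (intro eq_matI) (auto simp: entry)
      moreover have "a - m < m'" "b - m < m'" using 2 ab by auto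
      ultimately show ?thesis using y by (auto simp: H_set_def mat_over_def)
    next
      case 3
      then have "mat_block n (direct_sum_mat x y) a b = 0\<^sub>m n n"
        unfolding mat_block_def by (intro eq_matI) (auto simp: entry)
      then show ?thesis using zero_mem by simp
    qed
  qed
  have full: "x \<in> nondeg (m * n) (carrier_vec (m * n))" "y \<in> nondeg (m' * n) (carrier_vec (m' * n))"
    using x y H_full by auto
  have "invertible_in ((m + m') * n) (direct_sum_mat x y)" "hermitian_mat ((m + m') * n) (direct_sum_mat x y)"
    using full unfolding nondeg_full dim by (auto intro: direct_sum_invertible direct_sum_hermitian)
  then show "direct_sum_mat x y \<in> H (m + m')"
    using dc blocks mat_adjoint_eq_iff[OF dc] unfolding H_set_def mat_over_full invertible_in_def[symmetric]
    by (auto simp: mat_over_def)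
  show "neg_index ((m + m') * n) (direct_sum_mat x y) = neg_index (m * n) x + neg_index (m' * n) y"
    unfolding dim by (intro neg_index_eq inertia_direct_sum inertia_neg_index full xc yc)
qed

lemma path_component_H:
  assumes "x \<in> H m"
  shows "path_component_of_set (H_space n (carrier_mat n n) E m) x = index_class m (neg_index (m * n) x)"
proof -
  have "path_component_of (H_space n (carrier_mat n n) E m) x y \<longleftrightarrow> y \<in> index_class m (neg_index (m * n) x)" for y
  proof -
    have "path_component_of (H_space n (carrier_mat n n) E m) x y \<longleftrightarrow> linked (m * n) (nondeg (m * n) (X m)) x y"
      by (simp add: H_space_def linked_def H_nondeg)
    also have "\<dots> \<longleftrightarrow> y \<in> H m \<and> neg_index (m * n) x = neg_index (m * n) y"
      using linked_iff_neg_index[OF generic, of x m y] linked_mem(2)[of "m * n" _ x y] assms unfolding H_nondeg by blast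
    finally show ?thesis by (auto simp: index_class_def)
  qed
  then show ?thesis by auto
qed

lemma index_class_nonempty: "q \<le> m * n \<Longrightarrow> \<exists>x\<in>H m. neg_index (m * n) x = q"
  using exists_neg_index[OF generic, of "1\<^sub>m (m * n)" m q] one_H unfolding H_nondeg by blast

lemma index_class_inj: "q \<le> m * n \<Longrightarrow> index_class m q = index_class m q' \<Longrightarrow> q = q'"
  using index_class_nonempty[of q m] unfolding index_class_def by blast

lemma V0_eq: "V0 n (carrier_mat n n) E m = index_class m ` {..m * n}"
proof -
  have top: "topspace (H_space n (carrier_mat n n) E m) = H m"
    unfolding H_space_def using H_carrier by auto
  have "V0 n (carrier_mat n n) E m = (\<lambda>x. index_class m (neg_index (m * n) x)) ` H m"
    unfolding V0_def path_components_of_def top by (intro image_cong refl path_component_H)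
  also have "\<dots> = index_class m ` {..m * n}"
    using neg_index_le index_class_nonempty[of _ m] by (auto simp: image_iff) metis
  finally show ?thesis .
qed

text \<open>
  Adding an identity matrix does not change the negative index.
\<close>

lemma V0_connect_index_class:
  assumes mk: "m \<le> k" and q: "q \<le> m * n"
  shows "V0_connect n (carrier_mat n n) E m k (index_class m q) = index_class k q"
proof -
  have "path_component_of_set (H_space n (carrier_mat n n) E k) (direct_sum_mat x (1\<^sub>m ((k - m) * n))) = index_class k q"
    if "x \<in> index_class m q" for x
  proof -
    have x: "x \<in> H m" "neg_index (m * n) x = q" using that by (auto simp: index_class_def)
    have "direct_sum_mat x (1\<^sub>m ((k - m) * n)) \<in> H k" "neg_index (k * n) (direct_sum_mat x (1\<^sub>m ((k - m) * n))) = q"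
      using direct_sum_H[OF x(1) one_H[of "k - m"]] mk x(2) by (simp_all add: neg_index_one)
    then show ?thesis using path_component_H by simp
  qed
  moreover have "index_class m q \<noteq> {}" using index_class_nonempty[OF q] by (auto simp: index_class_def)
  ultimately show ?thesis unfolding V0_connect_def pi0_map_def by simp
qed

text \<open>
  The element of the direct limit that corresponds to the number \<open>q\<close>. As an equivalence class it contains
  one path component for each \<open>m\<close> that is large enough to admit the index \<open>q\<close>.
\<close>

definition lim_class :: "nat \<Rightarrow> (nat \<times> complex mat set) set" where
  "lim_class q = {(m, index_class m q) | m. 1 \<le> m \<and> q \<le> m * n}"

lemma V0_union_eq: "V0_union n (carrier_mat n n) E = {(m, index_class m q) | m q. 1 \<le> m \<and> q \<le> m * n}"
  unfolding V0_union_def V0_eq by auto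

lemma V0_rel_index_class:
  assumes "1 \<le> m" "q \<le> m * n"
  shows "V0_rel n (carrier_mat n n) E `` {(m, index_class m q)} = lim_class q"
proof -
  have "((m, index_class m q), (m', c)) \<in> V0_rel n (carrier_mat n n) E \<longleftrightarrow> 1 \<le> m' \<and> q \<le> m' * n \<and> c = index_class m' q" for m' c
  proof
    assume "((m, index_class m q), (m', c)) \<in> V0_rel n (carrier_mat n n) E"
    then obtain k where r: "(m', c) \<in> V0_union n (carrier_mat n n) E" "m \<le> k" "m' \<le> k"
      "V0_connect n (carrier_mat n n) E m k (index_class m q) = V0_connect n (carrier_mat n n) E m' k c"
      unfolding V0_rel_def by blast
    obtain q' where q': "c = index_class m' q'" "1 \<le> m'" "q' \<le> m' * n" using r(1) unfolding V0_union_eq by blast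
    have "index_class k q = index_class k q'" using r(4) unfolding q'(1) V0_connect_index_class[OF r(2) assms(2)] V0_connect_index_class[OF r(3) q'(3)] .
    moreover have "q \<le> k * n" using assms(2) r(2) by (meson mult_le_mono1 order_trans)
    ultimately have "q = q'" by (intro index_class_inj)
    with q' show "1 \<le> m' \<and> q \<le> m' * n \<and> c = index_class m' q" by simp
  next
    assume r: "1 \<le> m' \<and> q \<le> m' * n \<and> c = index_class m' q"
    define k where "k = max m m'"
    have "m \<le> k" "m' \<le> k" by (auto simp: k_def)
    moreover have "V0_connect n (carrier_mat n n) E m k (index_class m q) = V0_connect n (carrier_mat n n) E m' k c"
      using r assms V0_connect_index_class \<open>m \<le> k\<close> \<open>m' \<le> k\<close> by simp
    moreover have "(m, index_class m q) \<in> V0_union n (carrier_mat n n) E" "(m', c) \<in> V0_union n (carrier_mat n n) E"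
      unfolding V0_union_eq using r assms by blast+
    ultimately show "((m, index_class m q), (m', c)) \<in> V0_rel n (carrier_mat n n) E"
      unfolding V0_rel_def by blast
  qed
  then show ?thesis by (auto simp: lim_class_def)
qed

lemma V0_class_eq: "1 \<le> m \<Longrightarrow> x \<in> H m \<Longrightarrow> V0_class n (carrier_mat n n) E m x = lim_class (neg_index (m * n) x)"
  unfolding V0_class_def by (simp add: path_component_H V0_rel_index_class neg_index_le)

lemma lim_class_rep: "\<exists>m x. 1 \<le> m \<and> x \<in> H m \<and> neg_index (m * n) x = q"
proof -
  have "q \<le> Suc q * n" using n_pos by (cases n) auto
  then show ?thesis using index_class_nonempty[of q "Suc q"] by (intro exI[of _ "Suc q"]) auto
qed

lemma lim_class_inj: "inj lim_class"
proof (rule injI)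
  fix p q assume eq: "lim_class p = lim_class q"
  obtain m x where m: "1 \<le> m" "x \<in> H m" "neg_index (m * n) x = p" using lim_class_rep by blast
  then have p: "p \<le> m * n" using neg_index_le by blast
  then have "(m, index_class m p) \<in> lim_class q" unfolding eq[symmetric] using m(1) by (simp add: lim_class_def)
  then have "index_class m p = index_class m q" unfolding lim_class_def by blast
  then show "p = q" using p by (intro index_class_inj)
qed

lemma V0_lim_carrier: "carrier (V0_lim n (carrier_mat n n) E) = range lim_class"
proof -
  have "carrier (V0_lim n (carrier_mat n n) E) = (\<lambda>u. V0_rel n (carrier_mat n n) E `` {u}) ` V0_union n (carrier_mat n n) E"
    by (auto simp: V0_lim_def quotient_def)
  also have "\<dots> = lim_class ` {q. \<exists>m\<ge>1. q \<le> m * n}"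
  proof -
    show ?thesis
    proof (intro equalityI subsetI)
      fix s assume "s \<in> (\<lambda>u. V0_rel n (carrier_mat n n) E `` {u}) ` V0_union n (carrier_mat n n) E"
      then obtain m q where "s = V0_rel n (carrier_mat n n) E `` {(m, index_class m q)}" "1 \<le> m" "q \<le> m * n"
        unfolding V0_union_eq by blast
      then show "s \<in> lim_class ` {q. \<exists>m\<ge>1. q \<le> m * n}" using V0_rel_index_class by blast
    next
      fix s assume "s \<in> lim_class ` {q. \<exists>m\<ge>1. q \<le> m * n}"
      then obtain m q where mq: "s = lim_class q" "1 \<le> m" "q \<le> m * n" by blast
      then have "s = V0_rel n (carrier_mat n n) E `` {(m, index_class m q)}" using V0_rel_index_class by simp
      moreover have "(m, index_class m q) \<in> V0_union n (carrier_mat n n) E" unfolding V0_union_eq using mq by blast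
      ultimately show "s \<in> (\<lambda>u. V0_rel n (carrier_mat n n) E `` {u}) ` V0_union n (carrier_mat n n) E" by blast
    qed
  qed
  also have "{q. \<exists>m\<ge>1. q \<le> m * n} = UNIV"
  proof -
    have "\<exists>m\<ge>1. q \<le> m * n" for q
    proof -
      obtain m x where "1 \<le> m" "x \<in> H m" "neg_index (m * n) x = q" using lim_class_rep by blast
      then show ?thesis using neg_index_le by blast
    qed
    then show ?thesis by simp
  qed
  finally show ?thesis .
qed

lemma V0_lim_one: "\<one>\<^bsub>V0_lim n (carrier_mat n n) E\<^esub> = lim_class 0"
  using V0_class_eq[of 1 "1\<^sub>m n"] one_H[of 1] neg_index_one[of 1] by (simp add: V0_lim_def)

lemma V0_lim_mult: "lim_class p \<otimes>\<^bsub>V0_lim n (carrier_mat n n) E\<^esub> lim_class q = lim_class (p + q)"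
proof -
  define S where "S = {V0_class n (carrier_mat n n) E (m + m') (direct_sum_mat x x') | m x m' x'.
         1 \<le> m \<and> x \<in> H m \<and> V0_class n (carrier_mat n n) E m x = lim_class p \<and>
         1 \<le> m' \<and> x' \<in> H m' \<and> V0_class n (carrier_mat n n) E m' x' = lim_class q}"
  have val: "V0_class n (carrier_mat n n) E (m + m') (direct_sum_mat x x') = lim_class (neg_index (m * n) x + neg_index (m' * n) x')"
    if "1 \<le> m" "x \<in> H m" "x' \<in> H m'" for m x m' x'
    using direct_sum_H[OF that(2,3)] that(1) by (subst V0_class_eq) auto
  have "S = {lim_class (p + q)}"
  proof (intro equalityI subsetI)
    fix s assume "s \<in> S"
    then obtain m x m' x' where *: "s = V0_class n (carrier_mat n n) E (m + m') (direct_sum_mat x x')"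
      "1 \<le> m" "x \<in> H m" "V0_class n (carrier_mat n n) E m x = lim_class p"
      "1 \<le> m'" "x' \<in> H m'" "V0_class n (carrier_mat n n) E m' x' = lim_class q"
      unfolding S_def by blast
    have "neg_index (m * n) x = p" "neg_index (m' * n) x' = q"
      using *(4,7) V0_class_eq[OF *(2,3)] V0_class_eq[OF *(5,6)] lim_class_inj by (simp_all add: inj_eq)
    then show "s \<in> {lim_class (p + q)}" using val[OF *(2,3,6)] *(1) by simp
  next
    fix s assume s: "s \<in> {lim_class (p + q)}"
    obtain m x where x: "1 \<le> m" "x \<in> H m" "neg_index (m * n) x = p" using lim_class_rep by blast
    obtain m' x' where x': "1 \<le> m'" "x' \<in> H m'" "neg_index (m' * n) x' = q" using lim_class_rep by blast
    have "s = V0_class n (carrier_mat n n) E (m + m') (direct_sum_mat x x')" using s val[OF x(1,2) x'(2)] x x' by simp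
    moreover have "V0_class n (carrier_mat n n) E m x = lim_class p" "V0_class n (carrier_mat n n) E m' x' = lim_class q"
      using V0_class_eq x x' by auto
    ultimately show "s \<in> S" unfolding S_def using x x' by blast
  qed
  then show ?thesis unfolding V0_lim_def S_def by simp
qed

end

text \<open>
  The Grothendieck group of the additive natural numbers is that of the integers, here for any monoid
  record that \<open>\<kappa>\<close> identifies with the natural numbers.
\<close>

lemma grothendieck_group_nat:
  fixes M :: "'a monoid" and \<kappa> :: "nat \<Rightarrow> 'a"
  assumes inj: "inj \<kappa>" and carrier: "carrier M = range \<kappa>"
    and mult: "\<And>p q. \<kappa> p \<otimes>\<^bsub>M\<^esub> \<kappa> q = \<kappa> (p + q)" and one: "\<one>\<^bsub>M\<^esub> = \<kappa> 0"
  shows "comm_group (grothendieck_group M)" "grothendieck_group M \<cong> integer_group"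
proof -
  let ?G = "grothendieck_group M"
  define D where "D z = {(\<kappa> a, \<kappa> b) | a b. int a - int b = z}" for z
  have rel: "((\<kappa> a, \<kappa> b), (\<kappa> c, \<kappa> d)) \<in> grothendieck_rel M \<longleftrightarrow> int a - int b = int c - int d" for a b c d
    unfolding grothendieck_rel_def carrier by (auto simp: mult inj_eq[OF inj])
  have img: "grothendieck_rel M `` {(\<kappa> a, \<kappa> b)} = D (int a - int b)" for a b
  proof -
    have "(c, d) \<in> grothendieck_rel M `` {(\<kappa> a, \<kappa> b)} \<longleftrightarrow> (c, d) \<in> D (int a - int b)" for c d
    proof
      assume *: "(c, d) \<in> grothendieck_rel M `` {(\<kappa> a, \<kappa> b)}"
      then have "c \<in> carrier M" "d \<in> carrier M" unfolding grothendieck_rel_def by auto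
      then obtain c' d' where "c = \<kappa> c'" "d = \<kappa> d'" unfolding carrier by blast
      with * show "(c, d) \<in> D (int a - int b)" using rel unfolding D_def by fastforce
    next
      assume "(c, d) \<in> D (int a - int b)"
      then show "(c, d) \<in> grothendieck_rel M `` {(\<kappa> a, \<kappa> b)}" unfolding D_def using rel by fastforce
    qed
    then show ?thesis by auto
  qed
  have D_ne: "\<exists>a b. int a - int b = z \<and> (\<kappa> a, \<kappa> b) \<in> D z" for z
  proof -
    have "int (nat z) - int (nat (- z)) = z" by simp
    then show ?thesis unfolding D_def by blast
  qed
  have D_inj: "inj D"
  proof (rule injI)
    fix z w assume eq: "D z = D w"
    obtain a b where ab: "int a - int b = z" "(\<kappa> a, \<kappa> b) \<in> D z" using D_ne by blast
    then show "z = w" unfolding eq by (auto simp: D_def inj_eq[OF inj])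
  qed
  have carr: "carrier ?G = range D"
  proof -
    have "carrier ?G = (\<lambda>(a, b). grothendieck_rel M `` {(\<kappa> a, \<kappa> b)}) ` UNIV"
      by (auto simp: grothendieck_group_def quotient_def carrier)
    also have "\<dots> = range D"
    proof -
      have "D z \<in> (\<lambda>(a, b). D (int a - int b)) ` UNIV" for z
        using D_ne[of z] by force
      then show ?thesis unfolding img by auto
    qed
    finally show ?thesis .
  qed
  have mult_D: "D z \<otimes>\<^bsub>?G\<^esub> D w = D (z + w)" for z w
  proof -
    have "{grothendieck_rel M `` {(a \<otimes>\<^bsub>M\<^esub> c, b \<otimes>\<^bsub>M\<^esub> d)} | a b c d. (a, b) \<in> D z \<and> (c, d) \<in> D w} = {D (z + w)}"
    proof (intro equalityI subsetI)
      fix s assume "s \<in> {grothendieck_rel M `` {(a \<otimes>\<^bsub>M\<^esub> c, b \<otimes>\<^bsub>M\<^esub> d)} | a b c d. (a, b) \<in> D z \<and> (c, d) \<in> D w}"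
      then obtain a b c d where "s = grothendieck_rel M `` {(\<kappa> a \<otimes>\<^bsub>M\<^esub> \<kappa> c, \<kappa> b \<otimes>\<^bsub>M\<^esub> \<kappa> d)}"
        "int a - int b = z" "int c - int d = w" unfolding D_def by blast
      then show "s \<in> {D (z + w)}" by (simp add: mult img algebra_simps)
    next
      fix s assume s: "s \<in> {D (z + w)}"
      obtain a b where ab: "int a - int b = z" "(\<kappa> a, \<kappa> b) \<in> D z" using D_ne by blast
      obtain c d where cd: "int c - int d = w" "(\<kappa> c, \<kappa> d) \<in> D w" using D_ne by blast
      have "s = grothendieck_rel M `` {(\<kappa> a \<otimes>\<^bsub>M\<^esub> \<kappa> c, \<kappa> b \<otimes>\<^bsub>M\<^esub> \<kappa> d)}"
        using s ab(1) cd(1) by (simp add: mult img algebra_simps)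
      then show "s \<in> {grothendieck_rel M `` {(a \<otimes>\<^bsub>M\<^esub> c, b \<otimes>\<^bsub>M\<^esub> d)} | a b c d. (a, b) \<in> D z \<and> (c, d) \<in> D w}"
        using ab(2) cd(2) by blast
    qed
    then show ?thesis unfolding grothendieck_group_def by simp
  qed
  have one_D: "\<one>\<^bsub>?G\<^esub> = D 0" unfolding grothendieck_group_def by (simp add: one img)
  show "comm_group ?G"
  proof (rule comm_groupI)
    fix x assume "x \<in> carrier ?G"
    then obtain z where "x = D z" using carr by auto
    then show "\<exists>y\<in>carrier ?G. y \<otimes>\<^bsub>?G\<^esub> x = \<one>\<^bsub>?G\<^esub>"
      using carr by (intro bexI[of _ "D (- z)"]) (auto simp: mult_D one_D)
  qed (auto simp: carr one_D mult_D add_ac)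
  have hom: "D \<in> iso integer_group ?G"
    unfolding iso_def hom_def using D_inj by (auto simp: carr mult_D bij_betw_def)
  then have "integer_group \<cong> ?G" unfolding is_iso_def by blast
  then show "?G \<cong> integer_group" by (rule group.iso_sym[OF group_integer_group])
qed

lemma (in stable_classification) K0_group:
  "comm_group (K0 n (carrier_mat n n) E)" "K0 n (carrier_mat n n) E \<cong> integer_group"
  unfolding K0_def
  by (intro grothendieck_group_nat[OF lim_class_inj V0_lim_carrier V0_lim_mult V0_lim_one])+

section \<open>Toeplitz matrices compared with all matrices\<close>

lemma stable_classification_toeplitz:
  assumes "1 \<le> n"
  shows "stable_classification n (toeplitz n) (toeplitz_family n)"
proof
  show "0\<^sub>m n n \<in> toeplitz n" by (rule toeplitzI[where t = "\<lambda>_. 0"]) auto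
  show "1\<^sub>m n \<in> toeplitz n" using operator_system_toeplitz unfolding operator_system_def by blast
qed (use assms H_set_toeplitz toeplitz_generic in auto)

lemma stable_classification_full:
  assumes "1 \<le> n"
  shows "stable_classification n (carrier_mat n n) (\<lambda>m. carrier_vec (m * n))"
  by standard (use assms H_set_full full_generic in auto)

text \<open>
  The negative index of a matrix does not depend on the space in which it is considered.
\<close>

lemma V0_incl_index_class:
  assumes E: "stable_classification n E X" and q: "q \<le> m * n" and sub: "E \<subseteq> carrier_mat n n"
  shows "V0_incl n (carrier_mat n n) m (stable_classification.index_class n E m q) =
    stable_classification.index_class n (carrier_mat n n) m q"
proof -
  interpret E: stable_classification n E X by (rule E)
  interpret A: stable_classification n "carrier_mat n n" "\<lambda>m. carrier_vec (m * n)"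
    by (rule stable_classification_full[OF E.n_pos])
  have "E.H m \<subseteq> A.H m" using E.H_full H_set_full by blast
  then have "path_component_of_set (H_space n (carrier_mat n n) (carrier_mat n n) m) x = A.index_class m q"
    if "x \<in> E.index_class m q" for x
    using that A.path_component_H[of x m] by (auto simp: E.index_class_def)
  moreover have "E.index_class m q \<noteq> {}" using E.index_class_nonempty[OF q] by (auto simp: E.index_class_def)
  ultimately show ?thesis unfolding V0_incl_def pi0_map_def by simp
qed

theorem mainTheorem5:
  fixes n :: nat
  assumes "1 \<le> n"
  shows "is_cstar_envelope n (carrier_mat n n) (toeplitz n) \<and>
    (\<forall>m\<ge>1. bij_betw (V0_incl n (carrier_mat n n) m)
       (V0 n (carrier_mat n n) (toeplitz n) m)
       (V0 n (carrier_mat n n) (carrier_mat n n) m)) \<and>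
    (\<forall>m\<ge>1. \<forall>m'\<ge>m. \<forall>c \<in> V0 n (carrier_mat n n) (toeplitz n) m.
       V0_incl n (carrier_mat n n) m' (V0_connect n (carrier_mat n n) (toeplitz n) m m' c) =
       V0_connect n (carrier_mat n n) (carrier_mat n n) m m'
         (V0_incl n (carrier_mat n n) m c)) \<and>
    comm_group (K0 n (carrier_mat n n) (toeplitz n)) \<and>
    comm_group (K0 n (carrier_mat n n) (carrier_mat n n)) \<and>
    K0 n (carrier_mat n n) (toeplitz n) \<cong> K0 n (carrier_mat n n) (carrier_mat n n) \<and>
    K0 n (carrier_mat n n) (carrier_mat n n) \<cong> integer_group"
proof -
  note T_class = stable_classification_toeplitz[OF assms]
  interpret T: stable_classification n "toeplitz n" "toeplitz_family n" by (rule T_class)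
  interpret A: stable_classification n "carrier_mat n n" "\<lambda>m. carrier_vec (m * n)"
    by (rule stable_classification_full[OF assms])
  have incl: "V0_incl n (carrier_mat n n) m (T.index_class m q) = A.index_class m q" if "q \<le> m * n" for m q
    by (rule V0_incl_index_class[OF T_class that toeplitz_carrier])
  show ?thesis
  proof (intro conjI allI impI ballI)
    show "is_cstar_envelope n (carrier_mat n n) (toeplitz n)"
      by (rule is_cstar_envelope_toeplitz[OF assms])
    fix m
    show "bij_betw (V0_incl n (carrier_mat n n) m) (V0 n (carrier_mat n n) (toeplitz n) m)
       (V0 n (carrier_mat n n) (carrier_mat n n) m)"
      unfolding bij_betw_def
    proof
      show "inj_on (V0_incl n (carrier_mat n n) m) (V0 n (carrier_mat n n) (toeplitz n) m)"
        unfolding T.V0_eq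
      proof (rule inj_onI)
        fix c d assume "c \<in> T.index_class m ` {..m * n}" "d \<in> T.index_class m ` {..m * n}"
        then obtain q r where qr: "c = T.index_class m q" "d = T.index_class m r" "q \<le> m * n" "r \<le> m * n" by auto
        assume "V0_incl n (carrier_mat n n) m c = V0_incl n (carrier_mat n n) m d"
        then have "q = r" using A.index_class_inj[OF qr(3)] qr by (simp add: incl)
        then show "c = d" using qr by simp
      qed
      show "V0_incl n (carrier_mat n n) m ` V0 n (carrier_mat n n) (toeplitz n) m =
          V0 n (carrier_mat n n) (carrier_mat n n) m"
        unfolding T.V0_eq A.V0_eq image_image by (intro image_cong refl) (simp add: incl)
    qed
  next
    fix m m' c assume m: "m \<le> m'" and c: "c \<in> V0 n (carrier_mat n n) (toeplitz n) m"
    obtain q where q: "c = T.index_class m q" "q \<le> m * n" using c unfolding T.V0_eq by auto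
    have q': "q \<le> m' * n" using q(2) m by (meson mult_le_mono1 order_trans)
    show "V0_incl n (carrier_mat n n) m' (V0_connect n (carrier_mat n n) (toeplitz n) m m' c) =
       V0_connect n (carrier_mat n n) (carrier_mat n n) m m' (V0_incl n (carrier_mat n n) m c)"
      unfolding q(1) T.V0_connect_index_class[OF m q(2)] incl[OF q(2)] incl[OF q'] A.V0_connect_index_class[OF m q(2)] ..
  next
    have "integer_group \<cong> K0 n (carrier_mat n n) (carrier_mat n n)"
      by (rule group.iso_sym[OF comm_group.axioms(2)[OF A.K0_group(1)] A.K0_group(2)])
    with T.K0_group(2) show "K0 n (carrier_mat n n) (toeplitz n) \<cong> K0 n (carrier_mat n n) (carrier_mat n n)"
      by (rule iso_trans)
  qed (rule T.K0_group A.K0_group)+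
qed

end
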